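(* Let $M$ be an integrable quaternionic contact manifold whose vertical distribution $V$ is integrable, and let $\lambda>0$. Then the Levi-Civita connection $\overline\nabla^\lambda$ of the metric $g^\lambda$ is given, for sections $X,Y$ of $H$ and $a,b\in\{1,2,3\}$, by $$\overline\nabla^\lambda_XY=\nabla_XY-\frac12\sum_a\langle J_aX,Y\rangle U_a-\lambda^{-2}\sum_a\langle T_a^\Sigma X,Y\rangle U_a,$$ $$\overline\nabla^\lambda_{U_a}X=\nabla_{U_a}X+\frac{\lambda^2}{2}J_aX-T_a^{\mathfrak o}X,$$ $$\overline\nabla^\lambda_XU_a=\nabla_XU_a+\frac{\lambda^2}{2}J_aX+T_a^\Sigma X,$$ $$\overline\nabla^\lambda_{U_a}U_b=\nabla_{U_a}U_b-\frac12\sum_c\tau_{ab}^cU_c .$$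
   Context: Quaternionic contact (qc) setting. $M$ is a smooth manifold with a smooth distribution $H\subseteq TM$ of rank $h$ carrying a smooth positive definite inner product $\langle\cdot,\cdot\rangle$, with $[H,H]=TM$. $V^*\subseteq T^*M$ is the annihilator of $H$ and $\mathcal J:V^*\to\mathrm{End}(H)$ is defined by $\langle\mathcal J(\xi)X,Y\rangle=d\xi(X,Y)$. On $\mathrm{End}(H)$ use $\langle A,B\rangle=\mathrm{tr}(B^\top A)$, and on $V^*$ use $\langle\xi,\eta\rangle=\frac1h\langle\mathcal J(\xi),\mathcal J(\eta)\rangle$. $M$ is quaternionic contact if $\mathcal J(V^* )\cong\mathfrak{sp}_1$ at each point: there are local orthonormal coframes $\eta^1,\eta^2,\eta^3$ of $V^*$ such that $J_a=\mathcal J(\eta^a)$ satisfy $J_a^2=-1=J_1J_2J_3$; then $V^*$ has rank 3. A complement $V$ ($TM=H\oplus V$) determines dual vectors $U_a\in V$, $\eta^a(U_b)=\delta^a_b$, and a Riemannian metric $g=\langle\cdot,\cdot\rangle$ with $H\perp V$ and $U_1,U_2,U_3$ orthonormal. $M$ is integrable if $h>4$, or $h=4$ and there is a complement with $d\eta^a(U_b,X)+d\eta^b(U_a,X)=0$ for all $X\in H$ and all $a,b$. For integrable $M$ there are a unique complement $V$ and connection $\nabla$ (the Biquard connection) such that $H,V,g,\mathcal J$ are parallel, the torsion $T(A,B)=\nabla_AB-\nabla_BA-[A,B]$ satisfies $T(H,H)\subseteq V$, $T(H,V)\subseteq H$, and for each $U\in V$ the operator $T(U,\cdot):H\to H$ lies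 in $\mathfrak t^\perp\oplus\Sigma_h$. Here $\Sigma_h$ denotes symmetric endomorphisms of $H$, $\mathfrak t\subset\mathfrak{so}_h$ is the sum of $\mathfrak{sp}_1=\mathrm{span}(J_1,J_2,J_3)$ and its centralizer in $\mathfrak{so}_h$, and $\mathfrak t^\perp$ is the orthogonal complement in $\mathfrak{so}_h$. $T_aX=T(U_a,X)$ for $X\in H$; $T_a=T_a^\Sigma+T_a^{\mathfrak o}$ is the decomposition into symmetric and skew-symmetric parts. $\tau^c_{ab}=\eta^c(T(U_a,U_b))$. For $\lambda>0$, $g^\lambda(A,B)=\langle A_H,B_H\rangle+\lambda^2g(A_V,B_V)$, with subscripts denoting projections along $TM=H\oplus V$. *)

theory Defs
  imports "HOL-Analysis.Analysis" "HOL-Library.Function_Algebras"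
begin

text \<open>
  Tangent vectors are real-valued functionals on functions, and vector fields are functions into
  those, so the pointwise real vector space structure on function types is used throughout.
\<close>

instantiation "fun" :: (type, real_vector) real_vector
begin

definition scaleR_fun :: "real \<Rightarrow> ('a \<Rightarrow> 'b) \<Rightarrow> 'a \<Rightarrow> 'b" where
  "scaleR_fun c f = (\<lambda>x. c *\<^sub>R f x)"

instance
  by standard (simp_all add: scaleR_fun_def fun_eq_iff scaleR_add_right scaleR_add_left)

end

lemma scaleR_fun_apply [simp]: "(c *\<^sub>R f) x = c *\<^sub>R f x"
  by (simp add: scaleR_fun_def)


section \<open>Smooth manifolds\<close>

primrec Ck_on :: "nat \<Rightarrow> 'a::euclidean_space set \<Rightarrow> ('a \<Rightarrow> 'b::real_normed_vector) \<Rightarrow> bool" where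
  "Ck_on 0 S f \<longleftrightarrow> continuous_on S f"
| "Ck_on (Suc k) S f \<longleftrightarrow>
     (\<forall>x\<in>S. f differentiable (at x)) \<and> (\<forall>v. Ck_on k S (\<lambda>x. frechet_derivative f (at x) v))"

definition smooth_on :: "'a::euclidean_space set \<Rightarrow> ('a \<Rightarrow> 'b::real_normed_vector) \<Rightarrow> bool" where
  "smooth_on S f \<longleftrightarrow> open S \<and> (\<forall>k. Ck_on k S f)"

text \<open>
  The manifold is a whole topological space type; a chart is a pair \<open>(U, \<phi>)\<close> of its domain and the
  coordinate map, whose inverse is \<open>inv_into U \<phi>\<close>. The atlas need not be maximal.
\<close>

type_synonym ('m, 'e) atlas = "('m set \<times> ('m \<Rightarrow> 'e)) set"

definition smooth_atlas ::
  "('m::{second_countable_topology,t2_space}, 'e::euclidean_space) atlas \<Rightarrow> bool" where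
  "smooth_atlas A \<longleftrightarrow>
     (\<Union>(U, \<phi>)\<in>A. U) = UNIV \<and>
     (\<forall>(U, \<phi>)\<in>A. open U \<and> open (\<phi> ` U) \<and> homeomorphism U (\<phi> ` U) \<phi> (inv_into U \<phi>)) \<and>
     (\<forall>(U, \<phi>)\<in>A. \<forall>(U', \<phi>')\<in>A. smooth_on (\<phi> ` (U \<inter> U')) (\<phi>' \<circ> inv_into U \<phi>))"

definition smooth_fun ::
  "('m::topological_space, 'e::euclidean_space) atlas \<Rightarrow> 'm set \<Rightarrow> ('m \<Rightarrow> real) \<Rightarrow> bool" where
  "smooth_fun A W f \<longleftrightarrow>
     open W \<and> (\<forall>(U, \<phi>)\<in>A. smooth_on (\<phi> ` (U \<inter> W)) (f \<circ> inv_into U \<phi>))"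

definition smooth_near ::
  "('m::topological_space, 'e::euclidean_space) atlas \<Rightarrow> 'm \<Rightarrow> ('m \<Rightarrow> real) \<Rightarrow> bool" where
  "smooth_near A p f \<longleftrightarrow> (\<exists>W. p \<in> W \<and> smooth_fun A W f)"


section \<open>Tangent vectors, vector fields and one-forms\<close>

text \<open>
  A tangent vector at \<open>p\<close> is a derivation on germs at \<open>p\<close> of smooth functions. As it is a total
  functional, it is required to vanish on functions that are not smooth near \<open>p\<close>; this makes it
  determined by its values on germs of smooth functions.
\<close>

type_synonym 'm tvec = "('m \<Rightarrow> real) \<Rightarrow> real"
type_synonym 'm vf = "'m \<Rightarrow> 'm tvec"
type_synonym 'm covec = "'m tvec \<Rightarrow> real"
type_synonym 'm endo = "'m tvec \<Rightarrow> 'm tvec"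

definition tangent ::
  "('m::topological_space, 'e::euclidean_space) atlas \<Rightarrow> 'm \<Rightarrow> 'm tvec set" where
  "tangent A p = {v.
     (\<forall>f. \<not> smooth_near A p f \<longrightarrow> v f = 0) \<and>
     (\<forall>f g. (\<exists>W. open W \<and> p \<in> W \<and> (\<forall>q\<in>W. f q = g q)) \<longrightarrow> v f = v g) \<and>
     (\<forall>f g. smooth_near A p f \<longrightarrow> smooth_near A p g \<longrightarrow> v (\<lambda>q. f q + g q) = v f + v g) \<and>
     (\<forall>c f. smooth_near A p f \<longrightarrow> v (\<lambda>q. c * f q) = c * v f) \<and>
     (\<forall>f g. smooth_near A p f \<longrightarrow> smooth_near A p g \<longrightarrow>
        v (\<lambda>q. f q * g q) = v f * g p + f p * v g)}"

definition vfield ::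
  "('m::topological_space, 'e::euclidean_space) atlas \<Rightarrow> 'm set \<Rightarrow> 'm vf \<Rightarrow> bool" where
  "vfield A W X \<longleftrightarrow> open W \<and> (\<forall>q\<in>W. X q \<in> tangent A q) \<and>
     (\<forall>W' f. W' \<subseteq> W \<longrightarrow> smooth_fun A W' f \<longrightarrow> smooth_fun A W' (\<lambda>q. X q f))"

definition vfield_near ::
  "('m::topological_space, 'e::euclidean_space) atlas \<Rightarrow> 'm \<Rightarrow> 'm vf \<Rightarrow> bool" where
  "vfield_near A p X \<longleftrightarrow> (\<exists>W. p \<in> W \<and> vfield A W X)"

definition bracket ::
  "('m::topological_space, 'e::euclidean_space) atlas \<Rightarrow> 'm vf \<Rightarrow> 'm vf \<Rightarrow> 'm vf" where
  "bracket A X Y = (\<lambda>p f.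
     if smooth_near A p f then X p (\<lambda>q. Y q f) - Y p (\<lambda>q. X q f) else 0)"

definition lin_on :: "'a::real_vector set \<Rightarrow> ('a \<Rightarrow> 'b::real_vector) \<Rightarrow> bool" where
  "lin_on S F \<longleftrightarrow>
     (\<forall>x\<in>S. \<forall>y\<in>S. F (x + y) = F x + F y) \<and> (\<forall>c. \<forall>x\<in>S. F (c *\<^sub>R x) = c *\<^sub>R F x)"

definition one_form ::
  "('m::topological_space, 'e::euclidean_space) atlas \<Rightarrow> 'm set \<Rightarrow> ('m \<Rightarrow> 'm covec) \<Rightarrow> bool" where
  "one_form A W \<xi> \<longleftrightarrow> open W \<and> (\<forall>q\<in>W. lin_on (tangent A q) (\<xi> q)) \<and>
     (\<forall>W' X. W' \<subseteq> W \<longrightarrow> vfield A W' X \<longrightarrow> smooth_fun A W' (\<lambda>q. \<xi> q (X q)))"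

text \<open>The exterior derivative, normalised without the factor 1/2.\<close>

definition ext_deriv ::
  "('m::topological_space, 'e::euclidean_space) atlas \<Rightarrow> ('m \<Rightarrow> 'm covec) \<Rightarrow>
     'm vf \<Rightarrow> 'm vf \<Rightarrow> 'm \<Rightarrow> real" where
  "ext_deriv A \<xi> X Y p =
     X p (\<lambda>q. \<xi> q (Y q)) - Y p (\<lambda>q. \<xi> q (X q)) - \<xi> p (bracket A X Y p)"


section \<open>Distributions\<close>

definition distribution ::
  "('m::topological_space, 'e::euclidean_space) atlas \<Rightarrow> nat \<Rightarrow> ('m \<Rightarrow> 'm tvec set) \<Rightarrow> bool" where
  "distribution A k H \<longleftrightarrow>
     (\<forall>p. \<exists>W E. p \<in> W \<and> (\<forall>i<k. vfield A W (E i)) \<and> open W \<and>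
        (\<forall>q\<in>W. inj_on (\<lambda>i. E i q) {..<k} \<and> independent ((\<lambda>i. E i q) ` {..<k}) \<and>
           span ((\<lambda>i. E i q) ` {..<k}) = H q \<and> H q \<subseteq> tangent A q))"

definition dsection ::
  "('m::topological_space, 'e::euclidean_space) atlas \<Rightarrow> ('m \<Rightarrow> 'm tvec set) \<Rightarrow>
     'm set \<Rightarrow> 'm vf \<Rightarrow> bool" where
  "dsection A H W X \<longleftrightarrow> vfield A W X \<and> (\<forall>q\<in>W. X q \<in> H q)"

definition dsection_near ::
  "('m::topological_space, 'e::euclidean_space) atlas \<Rightarrow> ('m \<Rightarrow> 'm tvec set) \<Rightarrow>
     'm \<Rightarrow> 'm vf \<Rightarrow> bool" where
  "dsection_near A H p X \<longleftrightarrow> (\<exists>W. p \<in> W \<and> dsection A H W X)"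

definition complement ::
  "('m::topological_space, 'e::euclidean_space) atlas \<Rightarrow> ('m \<Rightarrow> 'm tvec set) \<Rightarrow>
     ('m \<Rightarrow> 'm tvec set) \<Rightarrow> bool" where
  "complement A H V \<longleftrightarrow> (\<exists>k. distribution A k V) \<and>
     (\<forall>p. H p \<inter> V p = {0} \<and> tangent A p = {x + u | x u. x \<in> H p \<and> u \<in> V p})"

text \<open>The projections of \<open>H \<oplus> V\<close> at a point onto the first and second summand.\<close>

definition proj1 :: "'a::real_vector set \<Rightarrow> 'a set \<Rightarrow> 'a \<Rightarrow> 'a" where
  "proj1 S T v = (THE x. x \<in> S \<and> v - x \<in> T)"

definition proj2 :: "'a::real_vector set \<Rightarrow> 'a set \<Rightarrow> 'a \<Rightarrow> 'a" where
  "proj2 S T v = (THE u. u \<in> T \<and> v - u \<in> S)"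

text \<open>
  A distribution is integrable if it is the tangent distribution of a foliation, that is, if it is
  locally the vertical distribution of a smooth submersion \<open>(f 0, \<dots>, f (m - 1))\<close>.
\<close>

definition integrable_distribution ::
  "('m::topological_space, 'e::euclidean_space) atlas \<Rightarrow> ('m \<Rightarrow> 'm tvec set) \<Rightarrow> bool" where
  "integrable_distribution A V \<longleftrightarrow>
     (\<forall>p. \<exists>W (m::nat) f. open W \<and> p \<in> W \<and> (\<forall>j<m. smooth_fun A W (f j)) \<and>
        (\<forall>q\<in>W. (\<forall>c::nat \<Rightarrow> real. \<exists>v\<in>tangent A q. \<forall>j<m. v (f j) = c j) \<and>
           V q = {v \<in> tangent A q. \<forall>j<m. v (f j) = 0}))"


section \<open>Inner product spaces and their endomorphisms\<close>

text \<open>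
  Here \<open>S\<close> is a finite-dimensional subspace with inner product \<open>b\<close>. Endomorphisms of \<open>S\<close> are total
  functions of which only the restriction to \<open>S\<close> matters.
\<close>

definition inner_on :: "'a::real_vector set \<Rightarrow> ('a \<Rightarrow> 'a \<Rightarrow> real) \<Rightarrow> bool" where
  "inner_on S b \<longleftrightarrow>
     (\<forall>x\<in>S. lin_on S (b x)) \<and> (\<forall>x\<in>S. \<forall>y\<in>S. b x y = b y x) \<and> (\<forall>x\<in>S. x \<noteq> 0 \<longrightarrow> b x x > 0)"

definition orthonormal_basis :: "'a::real_vector set \<Rightarrow> ('a \<Rightarrow> 'a \<Rightarrow> real) \<Rightarrow> 'a set \<Rightarrow> bool" where
  "orthonormal_basis S b E \<longleftrightarrow>
     finite E \<and> span E = S \<and> (\<forall>x\<in>E. \<forall>y\<in>E. b x y = (if x = y then 1 else 0))"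

definition endo_on :: "'a::real_vector set \<Rightarrow> ('a \<Rightarrow> 'a) \<Rightarrow> bool" where
  "endo_on S B \<longleftrightarrow> lin_on S B \<and> B ` S \<subseteq> S"

definition trace_on :: "'a::real_vector set \<Rightarrow> ('a \<Rightarrow> 'a \<Rightarrow> real) \<Rightarrow> ('a \<Rightarrow> 'a) \<Rightarrow> real" where
  "trace_on S b B = (\<Sum>e\<in>(SOME E. orthonormal_basis S b E). b (B e) e)"

definition transp_on ::
  "'a::real_vector set \<Rightarrow> ('a \<Rightarrow> 'a \<Rightarrow> real) \<Rightarrow> ('a \<Rightarrow> 'a) \<Rightarrow> 'a \<Rightarrow> 'a" where
  "transp_on S b B x = (THE y. y \<in> S \<and> (\<forall>z\<in>S. b y z = b x (B z)))"

definition endo_inner ::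
  "'a::real_vector set \<Rightarrow> ('a \<Rightarrow> 'a \<Rightarrow> real) \<Rightarrow> ('a \<Rightarrow> 'a) \<Rightarrow> ('a \<Rightarrow> 'a) \<Rightarrow> real" where
  "endo_inner S b B C = trace_on S b (transp_on S b C \<circ> B)"

definition sym_part ::
  "'a::real_vector set \<Rightarrow> ('a \<Rightarrow> 'a \<Rightarrow> real) \<Rightarrow> ('a \<Rightarrow> 'a) \<Rightarrow> 'a \<Rightarrow> 'a" where
  "sym_part S b B x = (1/2) *\<^sub>R (B x + transp_on S b B x)"

definition skew_part ::
  "'a::real_vector set \<Rightarrow> ('a \<Rightarrow> 'a \<Rightarrow> real) \<Rightarrow> ('a \<Rightarrow> 'a) \<Rightarrow> 'a \<Rightarrow> 'a" where
  "skew_part S b B x = (1/2) *\<^sub>R (B x - transp_on S b B x)"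

definition symmetric_endos :: "'a::real_vector set \<Rightarrow> ('a \<Rightarrow> 'a \<Rightarrow> real) \<Rightarrow> ('a \<Rightarrow> 'a) set" where
  "symmetric_endos S b = {B. endo_on S B \<and> (\<forall>x\<in>S. \<forall>y\<in>S. b (B x) y = b x (B y))}"

definition skew_endos :: "'a::real_vector set \<Rightarrow> ('a \<Rightarrow> 'a \<Rightarrow> real) \<Rightarrow> ('a \<Rightarrow> 'a) set" where
  "skew_endos S b = {B. endo_on S B \<and> (\<forall>x\<in>S. \<forall>y\<in>S. b (B x) y = - b x (B y))}"


section \<open>Connections\<close>

text \<open>
  \<open>D p v Y\<close> is the covariant derivative at \<open>p\<close> of the vector field \<open>Y\<close>, defined near \<open>p\<close>, in
  the direction \<open>v\<close>; so \<open>\<lambda>q. D q (X q) Y\<close> is the covariant derivative of \<open>Y\<close> along \<open>X\<close>.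
\<close>

type_synonym 'm conn = "'m \<Rightarrow> 'm tvec \<Rightarrow> 'm vf \<Rightarrow> 'm tvec"

definition connection ::
  "('m::topological_space, 'e::euclidean_space) atlas \<Rightarrow> 'm conn \<Rightarrow> bool" where
  "connection A D \<longleftrightarrow>
     (\<forall>p Y. vfield_near A p Y \<longrightarrow>
        lin_on (tangent A p) (\<lambda>v. D p v Y) \<and> (\<forall>v\<in>tangent A p. D p v Y \<in> tangent A p)) \<and>
     (\<forall>p. \<forall>v\<in>tangent A p. \<forall>Y Z. vfield_near A p Y \<longrightarrow> vfield_near A p Z \<longrightarrow>
        D p v (\<lambda>q. Y q + Z q) = D p v Y + D p v Z) \<and>
     (\<forall>p. \<forall>v\<in>tangent A p. \<forall>f Y. smooth_near A p f \<longrightarrow> vfield_near A p Y \<longrightarrow>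
        D p v (\<lambda>q. f q *\<^sub>R Y q) = v f *\<^sub>R Y p + f p *\<^sub>R D p v Y) \<and>
     (\<forall>p. \<forall>v\<in>tangent A p. \<forall>Y Z. vfield_near A p Y \<longrightarrow>
        (\<exists>W. open W \<and> p \<in> W \<and> (\<forall>q\<in>W. Y q = Z q)) \<longrightarrow> D p v Y = D p v Z) \<and>
     (\<forall>W X Y. vfield A W X \<longrightarrow> vfield A W Y \<longrightarrow> vfield A W (\<lambda>q. D q (X q) Y))"

definition torsion ::
  "('m::topological_space, 'e::euclidean_space) atlas \<Rightarrow> 'm conn \<Rightarrow> 'm vf \<Rightarrow> 'm vf \<Rightarrow> 'm vf" where
  "torsion A D X Y = (\<lambda>p. D p (X p) Y - D p (Y p) X - bracket A X Y p)"

text \<open>The torsion as a tensor at \<open>p\<close>, evaluated through arbitrary extensions of the arguments.\<close>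

definition torsion_at ::
  "('m::topological_space, 'e::euclidean_space) atlas \<Rightarrow> 'm conn \<Rightarrow>
     'm \<Rightarrow> 'm tvec \<Rightarrow> 'm tvec \<Rightarrow> 'm tvec" where
  "torsion_at A D p u v = (THE w. \<forall>X Y. vfield_near A p X \<longrightarrow> vfield_near A p Y \<longrightarrow>
     X p = u \<longrightarrow> Y p = v \<longrightarrow> w = torsion A D X Y p)"

definition parallel_distribution ::
  "('m::topological_space, 'e::euclidean_space) atlas \<Rightarrow> 'm conn \<Rightarrow> ('m \<Rightarrow> 'm tvec set) \<Rightarrow> bool" where
  "parallel_distribution A D H \<longleftrightarrow>
     (\<forall>p. \<forall>v\<in>tangent A p. \<forall>Y. dsection_near A H p Y \<longrightarrow> D p v Y \<in> H p)"

definition parallel_metric ::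
  "('m::topological_space, 'e::euclidean_space) atlas \<Rightarrow> 'm conn \<Rightarrow>
     ('m \<Rightarrow> 'm tvec \<Rightarrow> 'm tvec \<Rightarrow> real) \<Rightarrow> bool" where
  "parallel_metric A D g \<longleftrightarrow>
     (\<forall>p. \<forall>v\<in>tangent A p. \<forall>Y Z. vfield_near A p Y \<longrightarrow> vfield_near A p Z \<longrightarrow>
        v (\<lambda>q. g q (Y q) (Z q)) = g p (D p v Y) (Z p) + g p (Y p) (D p v Z))"

definition levi_civita ::
  "('m::topological_space, 'e::euclidean_space) atlas \<Rightarrow>
     ('m \<Rightarrow> 'm tvec \<Rightarrow> 'm tvec \<Rightarrow> real) \<Rightarrow> 'm conn \<Rightarrow> bool" where
  "levi_civita A g D \<longleftrightarrow> connection A D \<and> parallel_metric A D g \<and>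
     (\<forall>p X Y. vfield_near A p X \<longrightarrow> vfield_near A p Y \<longrightarrow> torsion A D X Y p = 0)"

text \<open>The derivative at \<open>p\<close> along \<open>v\<close> of a one-form, for the induced dual connection.\<close>

definition dual_conn ::
  "('m::topological_space, 'e::euclidean_space) atlas \<Rightarrow> 'm conn \<Rightarrow>
     'm \<Rightarrow> 'm tvec \<Rightarrow> ('m \<Rightarrow> 'm covec) \<Rightarrow> 'm covec" where
  "dual_conn A D p v \<xi> z = (THE r. \<forall>Z. vfield_near A p Z \<longrightarrow> Z p = z \<longrightarrow>
     r = v (\<lambda>q. \<xi> q (Z q)) - \<xi> p (D p v Z))"


section \<open>Quaternionic contact manifolds\<close>

type_synonym 'm metric = "'m \<Rightarrow> 'm tvec \<Rightarrow> 'm tvec \<Rightarrow> real"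

text \<open>
  \<open>H\<close> is the horizontal distribution, of rank \<open>h\<close>, \<open>ip\<close> the inner product on it.
\<close>

definition sub_riemannian ::
  "('m::{second_countable_topology,t2_space}, 'e::euclidean_space) atlas \<Rightarrow>
     ('m \<Rightarrow> 'm tvec set) \<Rightarrow> 'm metric \<Rightarrow> nat \<Rightarrow> bool" where
  "sub_riemannian A H ip h \<longleftrightarrow> smooth_atlas A \<and> distribution A h H \<and>
     (\<forall>p. inner_on (H p) (ip p)) \<and>
     (\<forall>W X Y. dsection A H W X \<longrightarrow> dsection A H W Y \<longrightarrow> smooth_fun A W (\<lambda>q. ip q (X q) (Y q))) \<and>
     (\<forall>p. span {bracket A X Y p | X Y. dsection_near A H p X \<and> dsection_near A H p Y}
        = tangent A p)"

definition annihilator ::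
  "('m::topological_space, 'e::euclidean_space) atlas \<Rightarrow> ('m \<Rightarrow> 'm tvec set) \<Rightarrow>
     'm \<Rightarrow> 'm covec set" where
  "annihilator A H p = {\<xi>. lin_on (tangent A p) \<xi> \<and> (\<forall>x\<in>H p. \<xi> x = 0)}"

definition ann_section ::
  "('m::topological_space, 'e::euclidean_space) atlas \<Rightarrow> ('m \<Rightarrow> 'm tvec set) \<Rightarrow>
     'm set \<Rightarrow> ('m \<Rightarrow> 'm covec) \<Rightarrow> bool" where
  "ann_section A H W \<xi> \<longleftrightarrow> one_form A W \<xi> \<and> (\<forall>q\<in>W. \<xi> q \<in> annihilator A H q)"

definition ann_section_near ::
  "('m::topological_space, 'e::euclidean_space) atlas \<Rightarrow> ('m \<Rightarrow> 'm tvec set) \<Rightarrow>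
     'm \<Rightarrow> ('m \<Rightarrow> 'm covec) \<Rightarrow> bool" where
  "ann_section_near A H p \<xi> \<longleftrightarrow> (\<exists>W. p \<in> W \<and> ann_section A H W \<xi>)"

text \<open>
  The endomorphism of \<open>H p\<close> attached to \<open>\<xi>\<close> in the annihilator of \<open>H p\<close>: the inner product of
  \<open>Jop A H ip p \<xi> x\<close> with \<open>y\<close> is the exterior derivative of \<open>\<xi>\<close> on \<open>x\<close> and \<open>y\<close>, where \<open>\<xi>\<close> is
  extended to a local section of the annihilator and \<open>x\<close>, \<open>y\<close> to local sections of \<open>H\<close>. The value
  does not depend on the extensions.
\<close>

definition Jop ::
  "('m::topological_space, 'e::euclidean_space) atlas \<Rightarrow> ('m \<Rightarrow> 'm tvec set) \<Rightarrow> 'm metric \<Rightarrow>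
     'm \<Rightarrow> 'm covec \<Rightarrow> 'm endo" where
  "Jop A H ip p \<xi> x = (THE w. w \<in> H p \<and>
     (\<forall>\<Xi> X Y. ann_section_near A H p \<Xi> \<longrightarrow> (\<forall>v\<in>tangent A p. \<Xi> p v = \<xi> v) \<longrightarrow>
        dsection_near A H p X \<longrightarrow> X p = x \<longrightarrow> dsection_near A H p Y \<longrightarrow>
        ip p w (Y p) = ext_deriv A \<Xi> X Y p))"

definition ann_inner ::
  "('m::topological_space, 'e::euclidean_space) atlas \<Rightarrow> ('m \<Rightarrow> 'm tvec set) \<Rightarrow> 'm metric \<Rightarrow>
     nat \<Rightarrow> 'm \<Rightarrow> 'm covec \<Rightarrow> 'm covec \<Rightarrow> real" where
  "ann_inner A H ip h p \<xi> \<eta> =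
     (1 / real h) * endo_inner (H p) (ip p) (Jop A H ip p \<xi>) (Jop A H ip p \<eta>)"

text \<open>
  Orthonormal coframes of the annihilator over \<open>W\<close>, indexed by 1, 2, 3, satisfying the
  quaternionic relations.
\<close>

definition qc_coframe ::
  "('m::topological_space, 'e::euclidean_space) atlas \<Rightarrow> ('m \<Rightarrow> 'm tvec set) \<Rightarrow> 'm metric \<Rightarrow>
     nat \<Rightarrow> 'm set \<Rightarrow> (nat \<Rightarrow> 'm \<Rightarrow> 'm covec) \<Rightarrow> bool" where
  "qc_coframe A H ip h W \<eta> \<longleftrightarrow> open W \<and> (\<forall>a\<in>{1..3}. ann_section A H W (\<eta> a)) \<and>
     (\<forall>p\<in>W.
        (\<forall>\<xi>\<in>annihilator A H p. \<exists>c. \<forall>v\<in>tangent A p. \<xi> v = (\<Sum>a\<in>{1..3}. c a * \<eta> a p v)) \<and>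
        (\<forall>a\<in>{1..3}. \<forall>b\<in>{1..3}.
           ann_inner A H ip h p (\<eta> a p) (\<eta> b p) = (if a = b then 1 else 0)) \<and>
        (let J = (\<lambda>a. Jop A H ip p (\<eta> a p)) in
           \<forall>x\<in>H p. (\<forall>a\<in>{1..3}. J a (J a x) = - x) \<and> J 1 (J 2 (J 3 x)) = - x))"

definition qc_manifold ::
  "('m::{second_countable_topology,t2_space}, 'e::euclidean_space) atlas \<Rightarrow>
     ('m \<Rightarrow> 'm tvec set) \<Rightarrow> 'm metric \<Rightarrow> nat \<Rightarrow> bool" where
  "qc_manifold A H ip h \<longleftrightarrow> sub_riemannian A H ip h \<and>
     (\<forall>p. \<exists>W \<eta>. p \<in> W \<and> qc_coframe A H ip h W \<eta>)"

text \<open>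
  The local frame of \<open>V\<close> dual to a coframe. The values of \<open>U\<close> are determined by \<open>\<eta>\<close>
  and are automatically smooth.
\<close>

definition dual_frame ::
  "('m::topological_space, 'e::euclidean_space) atlas \<Rightarrow> ('m \<Rightarrow> 'm tvec set) \<Rightarrow> 'm set \<Rightarrow>
     (nat \<Rightarrow> 'm \<Rightarrow> 'm covec) \<Rightarrow> (nat \<Rightarrow> 'm vf) \<Rightarrow> bool" where
  "dual_frame A V W \<eta> U \<longleftrightarrow> (\<forall>a\<in>{1..3}. dsection A V W (U a)) \<and>
     (\<forall>a\<in>{1..3}. \<forall>b\<in>{1..3}. \<forall>p\<in>W. \<eta> a p (U b p) = (if a = b then 1 else 0))"

text \<open>
  The metric extending \<open>ip\<close> for which \<open>H\<close> and \<open>V\<close> are orthogonal and dual frames are orthonormal: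
  the components of a vector in the dual frame are the values of the coframe on it. Two orthonormal
  coframes at \<open>p\<close> differ by an orthogonal matrix, so the choice is immaterial.
\<close>

definition qc_metric ::
  "('m::topological_space, 'e::euclidean_space) atlas \<Rightarrow> ('m \<Rightarrow> 'm tvec set) \<Rightarrow> 'm metric \<Rightarrow>
     nat \<Rightarrow> ('m \<Rightarrow> 'm tvec set) \<Rightarrow> 'm metric" where
  "qc_metric A H ip h V p v w =
     (let \<eta> = (SOME \<eta>. \<exists>W. p \<in> W \<and> qc_coframe A H ip h W \<eta>) in
        ip p (proj1 (H p) (V p) v) (proj1 (H p) (V p) w) + (\<Sum>a\<in>{1..3}. \<eta> a p v * \<eta> a p w))"

definition qc_metric_scaled ::
  "('m::topological_space, 'e::euclidean_space) atlas \<Rightarrow> ('m \<Rightarrow> 'm tvec set) \<Rightarrow> 'm metric \<Rightarrow>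
     nat \<Rightarrow> ('m \<Rightarrow> 'm tvec set) \<Rightarrow> real \<Rightarrow> 'm metric" where
  "qc_metric_scaled A H ip h V l p v w =
     ip p (proj1 (H p) (V p) v) (proj1 (H p) (V p) w) +
     l\<^sup>2 * qc_metric A H ip h V p (proj2 (H p) (V p) v) (proj2 (H p) (V p) w)"

definition integrable_qc ::
  "('m::{second_countable_topology,t2_space}, 'e::euclidean_space) atlas \<Rightarrow>
     ('m \<Rightarrow> 'm tvec set) \<Rightarrow> 'm metric \<Rightarrow> nat \<Rightarrow> bool" where
  "integrable_qc A H ip h \<longleftrightarrow> qc_manifold A H ip h \<and>
     (h > 4 \<or> h = 4 \<and> (\<exists>V. complement A H V \<and>
        (\<forall>W \<eta> U. qc_coframe A H ip h W \<eta> \<longrightarrow> dual_frame A V W \<eta> U \<longrightarrow>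
           (\<forall>a\<in>{1..3}. \<forall>b\<in>{1..3}. \<forall>p\<in>W. \<forall>X. dsection_near A H p X \<longrightarrow>
              ext_deriv A (\<eta> a) (U b) X p + ext_deriv A (\<eta> b) (U a) X p = 0))))"

definition sp1 ::
  "('m::topological_space, 'e::euclidean_space) atlas \<Rightarrow> ('m \<Rightarrow> 'm tvec set) \<Rightarrow> 'm metric \<Rightarrow>
     'm \<Rightarrow> 'm endo set" where
  "sp1 A H ip p = Jop A H ip p ` annihilator A H p"

text \<open>The sum of \<open>sp1\<close> and its centralizer in the skew endomorphisms.\<close>

definition t_alg ::
  "('m::topological_space, 'e::euclidean_space) atlas \<Rightarrow> ('m \<Rightarrow> 'm tvec set) \<Rightarrow> 'm metric \<Rightarrow>
     'm \<Rightarrow> 'm endo set" where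
  "t_alg A H ip p = {B + C | B C. B \<in> sp1 A H ip p \<and> C \<in> skew_endos (H p) (ip p) \<and>
     (\<forall>J\<in>sp1 A H ip p. \<forall>x\<in>H p. C (J x) = J (C x))}"

definition t_perp ::
  "('m::topological_space, 'e::euclidean_space) atlas \<Rightarrow> ('m \<Rightarrow> 'm tvec set) \<Rightarrow> 'm metric \<Rightarrow>
     'm \<Rightarrow> 'm endo set" where
  "t_perp A H ip p = {B \<in> skew_endos (H p) (ip p).
     \<forall>C\<in>t_alg A H ip p. endo_inner (H p) (ip p) B C = 0}"

text \<open>
  The section \<open>Jop\<close> of the bundle of homomorphisms from the annihilator of \<open>H\<close> to the endomorphisms
  of \<open>H\<close> is parallel for the induced connections.
\<close>

definition parallel_J ::
  "('m::topological_space, 'e::euclidean_space) atlas \<Rightarrow> ('m \<Rightarrow> 'm tvec set) \<Rightarrow> 'm metric \<Rightarrow>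
     'm conn \<Rightarrow> bool" where
  "parallel_J A H ip D \<longleftrightarrow>
     (\<forall>p. \<forall>v\<in>tangent A p. \<forall>\<xi> X. ann_section_near A H p \<xi> \<longrightarrow> dsection_near A H p X \<longrightarrow>
        D p v (\<lambda>q. Jop A H ip q (\<xi> q) (X q)) =
          Jop A H ip p (dual_conn A D p v \<xi>) (X p) + Jop A H ip p (\<xi> p) (D p v X))"

definition biquard ::
  "('m::topological_space, 'e::euclidean_space) atlas \<Rightarrow> ('m \<Rightarrow> 'm tvec set) \<Rightarrow> 'm metric \<Rightarrow>
     nat \<Rightarrow> ('m \<Rightarrow> 'm tvec set) \<Rightarrow> 'm conn \<Rightarrow> bool" where
  "biquard A H ip h V D \<longleftrightarrow> complement A H V \<and> connection A D \<and>
     parallel_distribution A D H \<and> parallel_distribution A D V \<and>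
     parallel_metric A D (qc_metric A H ip h V) \<and> parallel_J A H ip D \<and>
     (\<forall>p. \<forall>x\<in>H p. \<forall>y\<in>H p. torsion_at A D p x y \<in> V p) \<and>
     (\<forall>p. \<forall>x\<in>H p. \<forall>u\<in>V p. torsion_at A D p x u \<in> H p) \<and>
     (\<forall>p. \<forall>u\<in>V p. \<exists>B\<in>t_perp A H ip p. \<exists>S\<in>symmetric_endos (H p) (ip p).
        \<forall>x\<in>H p. torsion_at A D p u x = B x + S x)"

end

theory Submission
  imports Defs
begin

text \<open>
  Let \<open>S(v, Y)\<close> be the covariant derivative of \<open>Y\<close> along \<open>v\<close> for the Levi-Civita connection of
  \<open>G = g^l\<close> minus that for the Biquard connection. Both connections are metric for \<open>G\<close>: the Biquard connection
  preserves \<open>g\<close>, \<open>H\<close> and \<open>V\<close>, and \<open>G\<close> rescales \<open>g\<close> by a constant on \<open>V\<close>. So \<open>S(v, -)\<close> is skew for \<open>G\<close>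
  (\<open>difference_skew_fields\<close>). Since \<open>G\<close> is definite, skewness alone makes \<open>S\<close> a tensor (\<open>difference_zero\<close>).
  The Levi-Civita connection has no torsion, so the skew-symmetrization of \<open>S\<close> is minus the torsion \<open>T\<close> of the
  Biquard connection, and the Koszul formula (\<open>koszul\<close>) expresses \<open>S\<close> by \<open>T\<close>.

  It remains to know \<open>T\<close>. By definition it maps \<open>H \<times> H\<close> to \<open>V\<close> and \<open>H \<times> V\<close> to \<open>H\<close>, and integrability of \<open>V\<close>
  gives \<open>V \<times> V\<close> to \<open>V\<close> (\<open>torsion_VV\<close>). On \<open>H\<close> the exterior derivative of \<open>\<eta>^a\<close> is \<open>\<eta>^a \<circ> T\<close>, so
  \<open>T(X, Y)\<close> is the sum of the \<open>\<langle>J_a X, Y\<rangle> U_a\<close> (\<open>Jop_value\<close>). The metric \<open>g\<close> on \<open>V\<close> may be computed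
  from any qc coframe: for a unit vector \<open>x\<close> in \<open>H\<close> the \<open>J_a x\<close> are orthonormal by the quaternion
  relations, for either of two coframes, so their transition matrix is orthogonal (\<open>coframes_orthogonal\<close>).
  The first three formulas follow.

  For the fourth one the Koszul formula gives three terms in \<open>\<tau>\<close>, and the formula claims that two of them cancel, for
  which \<open>\<tau>\<close> has to be totally skew (\<open>vertical_torsion_skew\<close>). This follows from the first Bianchi
  identity for \<open>X\<close>, \<open>Y\<close> in \<open>H\<close> and \<open>U_a\<close>. As \<open>H\<close> and \<open>V\<close> are parallel and \<open>T\<close> is parallel on \<open>H\<close>
  (because \<open>J\<close> and \<open>g\<close> are), its vertical component says that \<open>\<langle>R(X, Y) U_a, U_b\<rangle>\<close> equals the sum over \<open>c\<close>
  of \<open>\<langle>J_c X, Y\<rangle> \<tau>_ca^b\<close> plus \<open>\<langle>J_b T_a X, Y\<rangle> + \<langle>T_a Y, J_b X\<rangle>\<close>. The left side is skew in \<open>a, b\<close>, so the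
  symmetric part of the right side vanishes. Contract it with \<open>J_k\<close>. The trace of \<open>T_a\<close> against \<open>J_b J_k\<close> vanishes
  for \<open>b \<noteq> k\<close>, because \<open>J_b J_k\<close> is then a multiple of the third \<open>J\<close>, to which the skew part of \<open>T_a\<close> is
  orthogonal by the condition that defines the Biquard connection; for \<open>b = k\<close> it is minus the trace of the symmetric part. Taking
  \<open>a = b = k\<close>, where \<open>\<tau>_aa^a = 0\<close>, shows that this trace vanishes as well, and then so does
  \<open>\<tau>_ka^b + \<tau>_kb^a\<close> (\<open>contraction_skew\<close>).
\<close>

section \<open>Smooth functions\<close>

lemma Ck_on_cong:
  assumes "open S" "\<And>x. x \<in> S \<Longrightarrow> f x = g x" "Ck_on k S f"
  shows "Ck_on k S g"
  using assms(2,3)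
proof (induction k arbitrary: f g)
  case 0
  then show ?case using continuous_on_cong[of S S f g] by auto
next
  case (Suc k)
  have *: "(g has_derivative frechet_derivative f (at x)) (at x)" if "x \<in> S" for x
  proof -
    have "(f has_derivative frechet_derivative f (at x)) (at x)"
      using Suc.prems(2) that frechet_derivative_works by auto
    then show ?thesis
      by (rule has_derivative_transform_within_open[OF _ assms(1) that]) (use Suc.prems in auto)
  qed
  then have "frechet_derivative g (at x) = frechet_derivative f (at x)" if "x \<in> S" for x
    using that frechet_derivative_at by metis
  then have "Ck_on k S (\<lambda>x. frechet_derivative g (at x) v)" for v
    using Suc.IH[of "\<lambda>x. frechet_derivative f (at x) v" "\<lambda>x. frechet_derivative g (at x) v"]
      Suc.prems(2) by simp
  then show ?case using * by (auto intro: differentiableI)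
qed

lemma Ck_on_Suc_imp_Ck_on: "Ck_on (Suc k) S f \<Longrightarrow> Ck_on k S f"
proof (induction k arbitrary: f)
  case 0
  then show ?case
    by (auto intro!: continuous_at_imp_continuous_on differentiable_imp_continuous_within)
qed auto

lemma Ck_on_const: "Ck_on k S (\<lambda>x. c)"
  by (induction k arbitrary: c) (auto simp: frechet_derivative_const)

lemma Ck_on_add:
  assumes "open S" "Ck_on k S f" "Ck_on k S g"
  shows "Ck_on k S (\<lambda>x. f x + g x)"
  using assms(2,3)
proof (induction k arbitrary: f g)
  case (Suc k)
  have "frechet_derivative (\<lambda>x. f x + g x) (at x) =
    (\<lambda>v. frechet_derivative f (at x) v + frechet_derivative g (at x) v)" if "x \<in> S" for x
    by (rule frechet_derivative_at[symmetric])
      (use Suc.prems that in \<open>auto intro!: has_derivative_add simp: frechet_derivative_works[symmetric]\<close>)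
  then have "Ck_on k S (\<lambda>x. frechet_derivative (\<lambda>x. f x + g x) (at x) v)" for v
    using Ck_on_cong[OF assms(1) _ Suc.IH[of "\<lambda>x. frechet_derivative f (at x) v"
        "\<lambda>x. frechet_derivative g (at x) v"]] Suc.prems by simp
  then show ?case using Suc.prems by auto
qed (auto intro: continuous_intros)

lemma Ck_on_mult:
  fixes f g :: "'a::euclidean_space \<Rightarrow> real"
  assumes "open S" "Ck_on k S f" "Ck_on k S g"
  shows "Ck_on k S (\<lambda>x. f x * g x)"
  using assms(2,3)
proof (induction k arbitrary: f g)
  case (Suc k)
  have "frechet_derivative (\<lambda>x. f x * g x) (at x) =
    (\<lambda>v. f x * frechet_derivative g (at x) v + frechet_derivative f (at x) v * g x)" if "x \<in> S" for x
    by (rule frechet_derivative_at[symmetric])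
      (use Suc.prems that in \<open>auto intro!: has_derivative_mult simp: frechet_derivative_works[symmetric]\<close>)
  moreover have "Ck_on k S (\<lambda>x. f x * frechet_derivative g (at x) v + frechet_derivative f (at x) v * g x)" for v
    using Suc.prems Suc.prems[THEN Ck_on_Suc_imp_Ck_on]
    by (intro Ck_on_add[OF assms(1)] Suc.IH) auto
  ultimately have "Ck_on k S (\<lambda>x. frechet_derivative (\<lambda>x. f x * g x) (at x) v)" for v
    using Ck_on_cong[OF assms(1)] by (smt (verit, best))
  then show ?case using Suc.prems by auto
qed (auto intro: continuous_intros)

lemma Ck_on_inverse:
  fixes f :: "'a::euclidean_space \<Rightarrow> real"
  assumes "open S" "\<And>x. x \<in> S \<Longrightarrow> f x \<noteq> 0" "Ck_on k S f"
  shows "Ck_on k S (\<lambda>x. inverse (f x))"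
  using assms(3)
proof (induction k)
  case 0
  then show ?case using assms by (auto intro: continuous_intros)
next
  case (Suc k)
  have d: "((\<lambda>x. inverse (f x)) has_derivative
    (\<lambda>v. - (inverse (f x) * frechet_derivative f (at x) v * inverse (f x)))) (at x)" if "x \<in> S" for x
    by (rule Deriv.has_derivative_inverse)
      (use Suc.prems that assms(2) in \<open>auto simp: frechet_derivative_works[symmetric]\<close>)
  have eq: "frechet_derivative (\<lambda>x. inverse (f x)) (at x) v =
    (- 1) * (inverse (f x) * frechet_derivative f (at x) v * inverse (f x))" if "x \<in> S" for x v
    using frechet_derivative_at[OF d[OF that]] by (metis mult_minus1)
  have "Ck_on k S (\<lambda>x. (- 1) * (inverse (f x) * frechet_derivative f (at x) v * inverse (f x)))" for v
    using Suc.prems Suc.IH[OF Ck_on_Suc_imp_Ck_on[OF Suc.prems]]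
    by (intro Ck_on_mult[OF assms(1)] Ck_on_const) auto
  then have "Ck_on k S (\<lambda>x. frechet_derivative (\<lambda>x. inverse (f x)) (at x) v)" for v
    using Ck_on_cong[OF assms(1)] eq by (smt (verit, best))
  then show ?case using d by (auto intro: differentiableI)
qed

lemma Ck_on_subset: "Ck_on k S f \<Longrightarrow> S' \<subseteq> S \<Longrightarrow> Ck_on k S' f"
  by (induction k arbitrary: f) (auto intro: continuous_on_subset)

lemma chart_image_open:
  assumes "smooth_atlas A" "(U, \<phi>) \<in> A" "open W"
  shows "open (\<phi> ` (U \<inter> W))"
proof -
  have h: "open U" "open (\<phi> ` U)" "homeomorphism U (\<phi> ` U) \<phi> (inv_into U \<phi>)"
    using assms unfolding smooth_atlas_def by blast+
  have "openin (top_of_set U) (U \<inter> W)" using assms(3) by auto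
  from homeomorphism_imp_open_map[OF h(3) this] show ?thesis
    using h(2) openin_open_trans by blast
qed

lemma chart_inv: 
  assumes "smooth_atlas A" "(U, \<phi>) \<in> A" "x \<in> U"
  shows "inv_into U \<phi> (\<phi> x) = x"
proof -
  have "homeomorphism U (\<phi> ` U) \<phi> (inv_into U \<phi>)"
    using assms unfolding smooth_atlas_def by blast
  then show ?thesis using assms(3) by (auto simp: homeomorphism_def)
qed

lemma smooth_fun_open: "smooth_fun A W f \<Longrightarrow> open W"
  by (simp add: smooth_fun_def)

lemma smooth_fun_subset:
  assumes "smooth_atlas A" "smooth_fun A W f" "open W'" "W' \<subseteq> W"
  shows "smooth_fun A W' f"
proof -
  have "smooth_on (\<phi> ` (U \<inter> W')) (f \<circ> inv_into U \<phi>)" if "(U, \<phi>) \<in> A" for U \<phi>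
    using assms that chart_image_open[OF assms(1) that assms(3)]
      Ck_on_subset[of _ "\<phi> ` (U \<inter> W)" "f \<circ> inv_into U \<phi>" "\<phi> ` (U \<inter> W')"]
    unfolding smooth_fun_def smooth_on_def by fast
  then show ?thesis using assms unfolding smooth_fun_def by auto
qed

lemma smooth_fun_cong:
  assumes "smooth_atlas A" "smooth_fun A W f" "\<And>x. x \<in> W \<Longrightarrow> f x = g x"
  shows "smooth_fun A W g"
proof -
  have "smooth_on (\<phi> ` (U \<inter> W)) (g \<circ> inv_into U \<phi>)" if c: "(U, \<phi>) \<in> A" for U \<phi>
  proof -
    have s: "smooth_on (\<phi> ` (U \<inter> W)) (f \<circ> inv_into U \<phi>)"
      using assms c unfolding smooth_fun_def by auto
    have "Ck_on k (\<phi> ` (U \<inter> W)) (g \<circ> inv_into U \<phi>)" for k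
      by (rule Ck_on_cong[of _ "f \<circ> inv_into U \<phi>"])
        (use s chart_inv[OF assms(1) c] assms(3) in \<open>auto simp: smooth_on_def\<close>)
    then show ?thesis using s by (auto simp: smooth_on_def)
  qed
  then show ?thesis using assms unfolding smooth_fun_def by auto
qed

lemma smooth_fun_const: "smooth_atlas A \<Longrightarrow> open W \<Longrightarrow> smooth_fun A W (\<lambda>x. c)"
  unfolding smooth_fun_def smooth_on_def comp_def
  by (auto intro: chart_image_open Ck_on_const)

lemma smooth_fun_add: "smooth_fun A W f \<Longrightarrow> smooth_fun A W g \<Longrightarrow> smooth_fun A W (\<lambda>x. f x + g x)"
  unfolding smooth_fun_def smooth_on_def comp_def by (fast intro: Ck_on_add)

lemma smooth_fun_mult: "smooth_fun A W f \<Longrightarrow> smooth_fun A W g \<Longrightarrow> smooth_fun A W (\<lambda>x. f x * g x)"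
  unfolding smooth_fun_def smooth_on_def comp_def by (fast intro: Ck_on_mult)

lemma smooth_fun_inverse:
  assumes "smooth_atlas A" "smooth_fun A W f" "\<And>x. x \<in> W \<Longrightarrow> f x \<noteq> 0"
  shows "smooth_fun A W (\<lambda>x. inverse (f x))"
proof -
  have "smooth_on (\<phi> ` (U \<inter> W)) ((\<lambda>x. inverse (f x)) \<circ> inv_into U \<phi>)" if c: "(U, \<phi>) \<in> A" for U \<phi>
    using assms c chart_inv[OF assms(1) c] unfolding smooth_fun_def smooth_on_def comp_def
    by (auto intro!: Ck_on_inverse)
  then show ?thesis using assms unfolding smooth_fun_def by auto
qed

lemma smooth_fun_cmult:
  "smooth_atlas A \<Longrightarrow> smooth_fun A W f \<Longrightarrow> smooth_fun A W (\<lambda>x. c * f x)"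
  using smooth_fun_mult[OF smooth_fun_const] smooth_fun_open by blast

lemma smooth_fun_diff:
  assumes "smooth_atlas A" "smooth_fun A W f" "smooth_fun A W g"
  shows "smooth_fun A W (\<lambda>x. f x - g x)"
  using smooth_fun_add[OF assms(2) smooth_fun_cmult[OF assms(1,3), of "-1"]] by simp

lemma smooth_fun_sum:
  assumes "smooth_atlas A" "open W" "\<And>i. i \<in> I \<Longrightarrow> smooth_fun A W (f i)"
  shows "smooth_fun A W (\<lambda>x. \<Sum>i\<in>I. f i x)"
  using assms(3)
  by (induction I rule: infinite_finite_induct)
    (auto intro: smooth_fun_const smooth_fun_add assms(1,2))

lemma smooth_near_const: "smooth_atlas A \<Longrightarrow> smooth_near A p (\<lambda>x. c)"
  unfolding smooth_near_def using smooth_fun_const[of A UNIV] by auto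

lemma smooth_near_cmult: "smooth_atlas A \<Longrightarrow> smooth_near A p f \<Longrightarrow> smooth_near A p (\<lambda>x. c * f x)"
  unfolding smooth_near_def using smooth_fun_cmult by blast


section \<open>Tangent vectors and vector fields\<close>

lemma tangentD:
  assumes "v \<in> tangent A p"
  shows "\<not> smooth_near A p f \<Longrightarrow> v f = 0"
    and "open W \<Longrightarrow> p \<in> W \<Longrightarrow> (\<And>q. q \<in> W \<Longrightarrow> f q = g q) \<Longrightarrow> v f = v g"
    and "smooth_near A p f \<Longrightarrow> smooth_near A p g \<Longrightarrow> v (\<lambda>q. f q + g q) = v f + v g"
    and "smooth_near A p f \<Longrightarrow> v (\<lambda>q. c * f q) = c * v f"
    and "smooth_near A p f \<Longrightarrow> smooth_near A p g \<Longrightarrow> v (\<lambda>q. f q * g q) = v f * g p + f p * v g"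
proof -
  note t = assms[unfolded tangent_def mem_Collect_eq]
  note t2 = t[THEN conjunct2]
  note t3 = t2[THEN conjunct2]
  note t4 = t3[THEN conjunct2]
  show "\<not> smooth_near A p f \<Longrightarrow> v f = 0"
    using t[THEN conjunct1, rule_format, of f] by simp
  show "open W \<Longrightarrow> p \<in> W \<Longrightarrow> (\<And>q. q \<in> W \<Longrightarrow> f q = g q) \<Longrightarrow> v f = v g"
    using t2[THEN conjunct1, rule_format, of f g] by auto
  show "smooth_near A p f \<Longrightarrow> smooth_near A p g \<Longrightarrow> v (\<lambda>q. f q + g q) = v f + v g"
    using t3[THEN conjunct1, rule_format, of f g] by simp
  show "smooth_near A p f \<Longrightarrow> v (\<lambda>q. c * f q) = c * v f"
    using t4[THEN conjunct1, rule_format, of f c] by simp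
  show "smooth_near A p f \<Longrightarrow> smooth_near A p g \<Longrightarrow> v (\<lambda>q. f q * g q) = v f * g p + f p * v g"
    using t4[THEN conjunct2, rule_format, of f g] by simp
qed

text \<open>
  A multiple of a function that is not smooth near \<open>p\<close> is not smooth near \<open>p\<close> either, unless the
  factor is zero; so the convention for such functions does not spoil homogeneity.
\<close>

lemma tangent_cmult:
  assumes "smooth_atlas A" "v \<in> tangent A p"
  shows "v (\<lambda>q. c * f q) = c * v f"
proof (cases "smooth_near A p f")
  case False
  show ?thesis
  proof (cases "c = 0")
    case True
    then show ?thesis
      using tangentD(4)[OF assms(2) smooth_near_const[OF assms(1), of p 0], of 0] by simp
  next
    case c: False
    have "\<not> smooth_near A p (\<lambda>q. c * f q)"
      using smooth_near_cmult[OF assms(1), of p "\<lambda>q. c * f q" "1 / c"] False c by auto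
    then show ?thesis using tangentD(1)[OF assms(2)] False by simp
  qed
qed (use tangentD(4)[OF assms(2)] in auto)

lemma tangent_const:
  assumes "smooth_atlas A" "v \<in> tangent A p"
  shows "v (\<lambda>q. c) = 0"
proof -
  have "v (\<lambda>q. 1 * 1) = v (\<lambda>q. 1) * 1 + 1 * v (\<lambda>q. 1)"
    using tangentD(5)[OF assms(2) smooth_near_const smooth_near_const] assms(1) by blast
  then have "v (\<lambda>q. 1) = 0" by simp
  then show ?thesis using tangent_cmult[OF assms, of c "\<lambda>q. 1"] by simp
qed

lemma tangent_locally_const:
  assumes "smooth_atlas A" "v \<in> tangent A p" "open W" "p \<in> W" "\<And>q. q \<in> W \<Longrightarrow> f q = c"
  shows "v f = 0"
  using tangentD(2)[OF assms(2-4), of f "\<lambda>q. c"] tangent_const[OF assms(1,2)] assms(5) by simp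

lemma tangent_diff:
  assumes "smooth_atlas A" "v \<in> tangent A p" "smooth_near A p f" "smooth_near A p g"
  shows "v (\<lambda>q. f q - g q) = v f - v g"
  using tangentD(3)[OF assms(2,3) smooth_near_cmult[OF assms(1,4), of "-1"]]
    tangent_cmult[OF assms(1,2), of "-1" g] by simp

lemma tangent_lincomb:
  assumes u: "u \<in> tangent A p" and v: "v \<in> tangent A p"
  shows "c *\<^sub>R u + v \<in> tangent A p"
  unfolding tangent_def
proof (intro CollectI conjI allI impI)
  fix f g :: "'a \<Rightarrow> real" and r :: real
  show "\<not> smooth_near A p f \<Longrightarrow> (c *\<^sub>R u + v) f = 0"
    using tangentD(1)[OF u] tangentD(1)[OF v] by simp
  assume f: "smooth_near A p f"
  show "(c *\<^sub>R u + v) (\<lambda>q. r * f q) = r * (c *\<^sub>R u + v) f"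
    using tangentD(4)[OF u f] tangentD(4)[OF v f] by (simp add: algebra_simps)
  assume g: "smooth_near A p g"
  show "(c *\<^sub>R u + v) (\<lambda>q. f q + g q) = (c *\<^sub>R u + v) f + (c *\<^sub>R u + v) g"
    using tangentD(3)[OF u f g] tangentD(3)[OF v f g] by (simp add: algebra_simps)
  show "(c *\<^sub>R u + v) (\<lambda>q. f q * g q) = (c *\<^sub>R u + v) f * g p + f p * (c *\<^sub>R u + v) g"
    using tangentD(5)[OF u f g] tangentD(5)[OF v f g] by (simp add: algebra_simps)
next
  fix f g :: "'a \<Rightarrow> real"
  assume "\<exists>W. open W \<and> p \<in> W \<and> (\<forall>q\<in>W. f q = g q)"
  then obtain W where W: "open W" "p \<in> W" "\<And>q. q \<in> W \<Longrightarrow> f q = g q" by blast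
  show "(c *\<^sub>R u + v) f = (c *\<^sub>R u + v) g"
    using tangentD(2)[OF u W] tangentD(2)[OF v W] by simp
qed

lemma subspace_tangent: "subspace (tangent A p)"
proof -
  have "0 \<in> tangent A p" by (auto simp: tangent_def)
  then show ?thesis
    using tangent_lincomb[of _ A p _ 1] tangent_lincomb[of _ A p 0]
    by (auto simp: subspace_def)
qed

lemma vfieldD:
  assumes "vfield A W X"
  shows vfield_open: "open W"
    and vfield_tangent: "q \<in> W \<Longrightarrow> X q \<in> tangent A q"
    and vfield_smooth: "W' \<subseteq> W \<Longrightarrow> smooth_fun A W' f \<Longrightarrow> smooth_fun A W' (\<lambda>q. X q f)"
  using assms by (simp_all add: vfield_def)

lemma vfieldI:
  assumes "open W" "\<And>q. q \<in> W \<Longrightarrow> X q \<in> tangent A q"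
    and "\<And>W' f. W' \<subseteq> W \<Longrightarrow> smooth_fun A W' f \<Longrightarrow> smooth_fun A W' (\<lambda>q. X q f)"
  shows "vfield A W X"
  using assms by (simp add: vfield_def)

lemma vfield_subset: "vfield A W X \<Longrightarrow> open W' \<Longrightarrow> W' \<subseteq> W \<Longrightarrow> vfield A W' X"
  by (rule vfieldI) (auto intro: vfield_tangent vfield_smooth[of A W X])

lemma vfield_cong:
  assumes sm: "smooth_atlas A" and X: "vfield A W X" and eq: "\<And>q. q \<in> W \<Longrightarrow> X q = Y q"
  shows "vfield A W Y"
proof (rule vfieldI)
  show "open W" by (rule vfield_open[OF X])
  show "Y q \<in> tangent A q" if "q \<in> W" for q
    using vfield_tangent[OF X that] eq[OF that] by simp
  fix W' f assume W': "W' \<subseteq> W" and f: "smooth_fun A W' f"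
  show "smooth_fun A W' (\<lambda>q. Y q f)"
    by (rule smooth_fun_cong[OF sm vfield_smooth[OF X W' f]]) (use eq W' in auto)
qed

lemma vfield_add:
  assumes X: "vfield A W X" and Y: "vfield A W Y"
  shows "vfield A W (\<lambda>q. X q + Y q)"
proof (rule vfieldI)
  show "open W" by (rule vfield_open[OF X])
  show "X q + Y q \<in> tangent A q" if "q \<in> W" for q
    by (intro subspace_add subspace_tangent vfield_tangent[OF X that] vfield_tangent[OF Y that])
  fix W' f assume W': "W' \<subseteq> W" and f: "smooth_fun A W' f"
  show "smooth_fun A W' (\<lambda>q. (X q + Y q) f)"
    using smooth_fun_add[OF vfield_smooth[OF X W' f] vfield_smooth[OF Y W' f]] by simp
qed

lemma vfield_scale:
  assumes sm: "smooth_atlas A" and X: "vfield A W X" and f: "smooth_fun A W f"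
  shows "vfield A W (\<lambda>q. f q *\<^sub>R X q)"
proof (rule vfieldI)
  show "open W" by (rule vfield_open[OF X])
  show "f q *\<^sub>R X q \<in> tangent A q" if "q \<in> W" for q
    by (intro subspace_scale subspace_tangent vfield_tangent[OF X that])
  fix W' g assume W': "W' \<subseteq> W" and g: "smooth_fun A W' g"
  show "smooth_fun A W' (\<lambda>q. (f q *\<^sub>R X q) g)"
    using smooth_fun_mult[OF smooth_fun_subset[OF sm f smooth_fun_open[OF g] W'] vfield_smooth[OF X W' g]]
    by simp
qed

lemma vfield_cscale:
  "smooth_atlas A \<Longrightarrow> vfield A W X \<Longrightarrow> vfield A W (\<lambda>q. c *\<^sub>R X q)"
  by (rule vfield_scale) (auto intro: smooth_fun_const vfield_open)

lemma vfield_diff: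
  assumes "smooth_atlas A" "vfield A W X" "vfield A W Y"
  shows "vfield A W (\<lambda>q. X q - Y q)"
  using vfield_add[OF assms(2) vfield_cscale[OF assms(1,3), of "-1"]] by simp

lemma vfield_smooth_near:
  assumes sm: "smooth_atlas A" and X: "vfield A W X" and p: "p \<in> W" and f: "smooth_near A p f"
  shows "smooth_near A p (\<lambda>q. X q f)"
proof -
  obtain W' where W': "p \<in> W'" "smooth_fun A W' f" using f by (auto simp: smooth_near_def)
  have "smooth_fun A (W \<inter> W') f"
    using W' vfield_open[OF X] smooth_fun_open[OF W'(2)] by (intro smooth_fun_subset[OF sm W'(2)]) auto
  then have "smooth_fun A (W \<inter> W') (\<lambda>q. X q f)" by (rule vfield_smooth[OF X, rotated]) simp
  then show ?thesis using p W'(1) unfolding smooth_near_def by blast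
qed

lemma smooth_near_open:
  assumes "smooth_near A p f"
  shows "\<exists>W. open W \<and> p \<in> W \<and> (\<forall>q\<in>W. smooth_near A q f)"
proof -
  obtain W where W: "p \<in> W" "smooth_fun A W f" using assms by (auto simp: smooth_near_def)
  then have "open W" "\<forall>q\<in>W. smooth_near A q f"
    using smooth_fun_open by (auto simp: smooth_near_def)
  then show ?thesis using W(1) by blast
qed

text \<open>Each double bracket expands, on functions, into four compositions that cancel in the cyclic sum.\<close>

lemma bracket_jacobi:
  assumes sm: "smooth_atlas A" and p: "p \<in> W"
    and v: "vfield A W X" "vfield A W Y" "vfield A W Z"
    and b: "vfield A W (bracket A X Y)" "vfield A W (bracket A Y Z)" "vfield A W (bracket A Z X)"
  shows "bracket A X (bracket A Y Z) p + bracket A Y (bracket A Z X) p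
    + bracket A Z (bracket A X Y) p = 0"
proof
  fix f
  show "(bracket A X (bracket A Y Z) p + bracket A Y (bracket A Z X) p
    + bracket A Z (bracket A X Y) p) f = 0 f"
  proof (cases "smooth_near A p f")
    case True
    note s = vfield_smooth_near[OF sm _ p]
    have expand: "bracket A P (bracket A Q R) p f =
        P p (\<lambda>q. Q q (\<lambda>q. R q f)) - P p (\<lambda>q. R q (\<lambda>q. Q q f))
        - Q p (\<lambda>q. R q (\<lambda>q. P q f)) + R p (\<lambda>q. Q q (\<lambda>q. P q f))"
      if "vfield A W P" "vfield A W Q" "vfield A W R" for P Q R
    proof -
      have Pp: "P p \<in> tangent A p" by (rule vfield_tangent[OF that(1) p])
      obtain N where N: "open N" "p \<in> N" "\<forall>q\<in>N. smooth_near A q f"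
        using smooth_near_open[OF True] by blast
      have "P p (\<lambda>q. bracket A Q R q f) = P p (\<lambda>q. Q q (\<lambda>q. R q f) - R q (\<lambda>q. Q q f))"
        by (rule tangentD(2)[OF Pp N(1,2)]) (use N(3) in \<open>auto simp: bracket_def\<close>)
      also have "\<dots> = P p (\<lambda>q. Q q (\<lambda>q. R q f)) - P p (\<lambda>q. R q (\<lambda>q. Q q f))"
        by (rule tangent_diff[OF sm Pp s[OF that(2) s[OF that(3) True]] s[OF that(3) s[OF that(2) True]]])
      finally show ?thesis
        using True s[OF that(1) True] by (simp add: bracket_def[of A P] bracket_def[of A Q R])
    qed
    show ?thesis using expand[OF v] expand[OF v(2,3,1)] expand[OF v(3,1,2)] by simp
  qed (simp add: bracket_def)
qed


section \<open>Finite-dimensional inner product spaces\<close>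

lemma lin_on_zero: "lin_on S F \<Longrightarrow> 0 \<in> S \<Longrightarrow> F 0 = 0"
  unfolding lin_on_def by (metis scaleR_zero_left)

lemma lin_on_minus: "lin_on S F \<Longrightarrow> x \<in> S \<Longrightarrow> F (- x) = - F x"
  unfolding lin_on_def by (metis scaleR_minus1_left)

lemma lin_on_diff: "subspace S \<Longrightarrow> lin_on S F \<Longrightarrow> x \<in> S \<Longrightarrow> y \<in> S \<Longrightarrow> F (x - y) = F x - F y"
  using lin_on_minus[of S F y] unfolding lin_on_def
  by (metis add.inverse_inverse diff_minus_eq_add minus_diff_eq subspace_neg uminus_add_conv_diff)

lemma lin_on_sum:
  assumes "subspace S" "lin_on S F" "\<And>i. i \<in> I \<Longrightarrow> f i \<in> S"
  shows "F (\<Sum>i\<in>I. f i) = (\<Sum>i\<in>I. F (f i))"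
  using assms(3)
proof (induction I rule: infinite_finite_induct)
  case (insert i I)
  have "(\<Sum>i\<in>I. f i) \<in> S" using insert by (intro subspace_sum assms(1)) auto
  then show ?case using insert assms(2) by (simp add: lin_on_def)
qed (use lin_on_zero[OF assms(2)] subspace_0[OF assms(1)] in auto)

lemma lin_on_lincomb:
  assumes "subspace S" "lin_on S F" "\<And>i. i \<in> I \<Longrightarrow> f i \<in> S"
  shows "F (\<Sum>i\<in>I. c i *\<^sub>R f i) = (\<Sum>i\<in>I. c i *\<^sub>R F (f i))"
proof -
  have "F (\<Sum>i\<in>I. c i *\<^sub>R f i) = (\<Sum>i\<in>I. F (c i *\<^sub>R f i))"
    using assms(3) by (intro lin_on_sum[OF assms(1,2)] subspace_scale[OF assms(1)])
  then show ?thesis using assms(2,3) by (simp add: lin_on_def cong: sum.cong)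
qed

locale inner_space =
  fixes S :: "'a::real_vector set" and b :: "'a \<Rightarrow> 'a \<Rightarrow> real"
  assumes sub: "subspace S" and inner: "inner_on S b" and fin: "\<exists>F. finite F \<and> span F = S"
begin

lemma lin: "x \<in> S \<Longrightarrow> lin_on S (b x)"
  using inner by (auto simp: inner_on_def)

lemma sym: "x \<in> S \<Longrightarrow> y \<in> S \<Longrightarrow> b x y = b y x"
  using inner by (auto simp: inner_on_def)

lemma pos: "x \<in> S \<Longrightarrow> x \<noteq> 0 \<Longrightarrow> b x x > 0"
  using inner by (auto simp: inner_on_def)

lemmas mem = subspace_0[OF sub] subspace_add[OF sub] subspace_diff[OF sub] subspace_neg[OF sub]
  subspace_scale[OF sub] subspace_sum[OF sub]

lemma right:
  assumes "x \<in> S" "y \<in> S"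
  shows add_right: "z \<in> S \<Longrightarrow> b x (y + z) = b x y + b x z"
    and diff_right: "z \<in> S \<Longrightarrow> b x (y - z) = b x y - b x z"
    and scale_right: "b x (c *\<^sub>R y) = c * b x y"
    and minus_right: "b x (- y) = - b x y"
  using lin[OF assms(1)] assms(2) lin_on_diff[OF sub lin[OF assms(1)], of y z]
    lin_on_minus[OF lin[OF assms(1)], of y]
  by (auto simp: lin_on_def)

lemma zero_right: "x \<in> S \<Longrightarrow> b x 0 = 0"
  using lin lin_on_zero mem(1) by blast

lemma sum_right: "x \<in> S \<Longrightarrow> (\<And>i. i \<in> I \<Longrightarrow> f i \<in> S) \<Longrightarrow> b x (\<Sum>i\<in>I. f i) = (\<Sum>i\<in>I. b x (f i))"
  by (rule lin_on_sum[OF sub lin])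

lemma left:
  assumes "x \<in> S" "y \<in> S"
  shows add_left: "z \<in> S \<Longrightarrow> b (y + z) x = b y x + b z x"
    and diff_left: "z \<in> S \<Longrightarrow> b (y - z) x = b y x - b z x"
    and scale_left: "b (c *\<^sub>R y) x = c * b y x"
    and minus_left: "b (- y) x = - b y x"
  using add_right[OF assms, of z] diff_right[OF assms, of z] scale_right[OF assms, of c]
    minus_right[OF assms] assms
  by (auto simp: sym[of _ x] mem)

lemma zero_left: "x \<in> S \<Longrightarrow> b 0 x = 0"
  using zero_right[of x] sym[of 0 x] mem(1) by simp

lemma sum_left:
  assumes "x \<in> S" "\<And>i. i \<in> I \<Longrightarrow> f i \<in> S"
  shows "b (\<Sum>i\<in>I. f i) x = (\<Sum>i\<in>I. b (f i) x)"
proof -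
  have "b (\<Sum>i\<in>I. f i) x = (\<Sum>i\<in>I. b x (f i))"
    using sym[OF assms(1) mem(6)[of I f]] sum_right[of x I f] assms by simp
  then show ?thesis using sym[OF assms(1) assms(2)] by simp
qed

lemma eq_zero: "x \<in> S \<Longrightarrow> b x x = 0 \<Longrightarrow> x = 0"
  using pos by fastforce

lemma eqI: "x \<in> S \<Longrightarrow> y \<in> S \<Longrightarrow> (\<And>z. z \<in> S \<Longrightarrow> b x z = b y z) \<Longrightarrow> x = y"
  using eq_zero[of "x - y"] diff_left[of "x - y" x y] mem(3)[of x y] by simp

lemma orthogonal_span:
  assumes "x \<in> S" "E \<subseteq> S" "\<And>e. e \<in> E \<Longrightarrow> b x e = 0" "y \<in> span E"
  shows "b x y = 0"
proof -
  have "y \<in> S \<and> b x y = 0"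
    using assms(4)
    by (induction rule: span_induct_alt)
      (use assms in \<open>auto simp: mem zero_right add_right scale_right subset_iff\<close>)
  then show ?thesis by simp
qed

lemma onb_expand:
  assumes "orthonormal_basis T b E" "T \<subseteq> S" "x \<in> T"
  shows "x = (\<Sum>e\<in>E. b x e *\<^sub>R e)"
proof -
  have E: "finite E" "E \<subseteq> S" "span E = T" and o: "\<And>e f. e \<in> E \<Longrightarrow> f \<in> E \<Longrightarrow> b e f = (if e = f then 1 else 0)"
    using assms by (auto simp: orthonormal_basis_def span_base)
  let ?y = "\<Sum>e\<in>E. b x e *\<^sub>R e"
  have "?y \<in> span E" by (intro span_sum span_scale span_base)
  then have y: "?y \<in> S" "?y \<in> T" using E(3) assms(2) by auto
  have xS: "x \<in> S" using assms by auto
  have orth: "b (x - ?y) e = 0" if "e \<in> E" for e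
  proof -
    have "b ?y e = (\<Sum>f\<in>E. b (b x f *\<^sub>R f) e)"
      using that E by (intro sum_left) (auto intro: mem)
    also have "\<dots> = (\<Sum>f\<in>E. if e = f then b x f else 0)"
      using that E by (intro sum.cong) (auto simp: scale_left o subset_iff)
    finally show ?thesis using that E y xS by (auto simp: diff_left subset_iff sum.delta')
  qed
  have "x - ?y \<in> span E"
    using assms(3) y(2) E(3) span_diff[of x E ?y] by simp
  from orthogonal_span[OF mem(3)[OF xS y(1)] E(2) orth this]
  have "b (x - ?y) (x - ?y) = 0" .
  then show ?thesis using eq_zero[OF mem(3)[OF xS y(1)]] by simp
qed

lemma onb_exists_span:
  assumes "finite F" "F \<subseteq> S"
  shows "\<exists>E. orthonormal_basis (span F) b E"
  using assms
proof (induction F)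
  case empty
  then show ?case by (auto simp: orthonormal_basis_def intro: exI[of _ "{}"])
next
  case (insert v F)
  then obtain E where E: "orthonormal_basis (span F) b E" by auto
  have FS: "span F \<subseteq> S" using insert.prems sub by (simp add: span_minimal)
  have fE: "finite E" "E \<subseteq> S" "span E = span F" and o: "\<And>e f. e \<in> E \<Longrightarrow> f \<in> E \<Longrightarrow> b e f = (if e = f then 1 else 0)"
    using E FS span_superset[of E] by (auto simp: orthonormal_basis_def)
  let ?n = "v - (\<Sum>e\<in>E. b v e *\<^sub>R e)"
  have s: "(\<Sum>e\<in>E. b v e *\<^sub>R e) \<in> S" "(\<Sum>e\<in>E. b v e *\<^sub>R e) \<in> span F" and v: "v \<in> S"
    using fE insert.prems by (auto intro!: mem(5,6) span_sum span_scale simp: span_base simp flip: fE(3))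
  have n: "?n \<in> S" using s v mem by auto
  have on: "b ?n e = 0" if "e \<in> E" for e
  proof -
    have "b (\<Sum>e\<in>E. b v e *\<^sub>R e) e = (\<Sum>f\<in>E. b (b v f *\<^sub>R f) e)"
      using that fE by (intro sum_left) (auto intro: mem)
    also have "\<dots> = (\<Sum>f\<in>E. if e = f then b v f else 0)"
      using that fE by (intro sum.cong) (auto simp: scale_left o subset_iff)
    finally show ?thesis using that fE s v by (auto simp: diff_left subset_iff sum.delta')
  qed
  show ?case
  proof (cases "?n = 0")
    case True
    then have "v \<in> span F" using s by simp
    then have "span (insert v F) = span F" by (simp add: span_redundant)
    then show ?thesis using E by auto
  next
    case False
    let ?u = "(1 / sqrt (b ?n ?n)) *\<^sub>R ?n"
    have np: "b ?n ?n > 0" using pos[OF n False] .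
    have u: "?u \<in> S" using n mem by auto
    have "b ?u ?u = (1 / sqrt (b ?n ?n))\<^sup>2 * b ?n ?n"
      using n u by (simp add: scale_left scale_right power2_eq_square)
    then have uu: "b ?u ?u = 1" using np by (simp add: power_divide)
    have ue: "b ?u e = 0" "b e ?u = 0" if "e \<in> E" for e
      using that on[OF that] fE n u sym[of ?u e] by (auto simp: scale_left subset_iff)
    have sp: "span (insert ?u E) = span (insert v F)"
    proof -
      have veq: "v = sqrt (b ?n ?n) *\<^sub>R ?u + (\<Sum>e\<in>E. b v e *\<^sub>R e)" using np by simp
      have r: "(\<Sum>e\<in>E. b v e *\<^sub>R e) \<in> span (insert ?u E)"
        by (intro span_sum span_scale span_base) auto
      have "?u \<in> span (insert ?u E)" by (rule span_base) simp
      from span_add[OF span_scale[OF this, of "sqrt (b ?n ?n)"] r]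
      have "v \<in> span (insert ?u E)" unfolding veq[symmetric] .
      moreover have "F \<subseteq> span (insert ?u E)"
        using fE(3) span_superset[of F] span_mono[of E "insert ?u E"] by auto
      ultimately have 1: "span (insert v F) \<subseteq> span (insert ?u E)" by (intro span_minimal) auto
      have mono: "span F \<subseteq> span (insert v F)" by (intro span_mono) auto
      have "?u \<in> span (insert v F)"
        using s(2) mono by (intro span_scale span_diff) (auto intro: span_base)
      moreover have "E \<subseteq> span (insert v F)" using fE(3) mono span_superset[of E] by auto
      ultimately have "span (insert ?u E) \<subseteq> span (insert v F)" by (intro span_minimal) auto
      then show ?thesis using 1 by auto
    qed
    have nu: "?u \<notin> E" using ue(1)[of ?u] uu by force
    have orth: "b x y = (if x = y then 1 else 0)" if x: "x \<in> insert ?u E" and y: "y \<in> insert ?u E" for x y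
      using x
    proof
      assume xu: "x = ?u"
      show ?thesis using y
      proof
        assume "y = ?u"
        then show ?thesis using xu uu by simp
      next
        assume "y \<in> E"
        then show ?thesis using xu ue(1) nu by auto
      qed
    next
      assume xE: "x \<in> E"
      show ?thesis using y
      proof
        assume "y = ?u"
        then show ?thesis using ue(2)[OF xE] nu xE by auto
      next
        assume "y \<in> E"
        then show ?thesis using o xE by simp
      qed
    qed
    have "orthonormal_basis (span (insert v F)) b (insert ?u E)"
      unfolding orthonormal_basis_def
    proof (intro conjI ballI)
      show "finite (insert ?u E)" using fE(1) by simp
      show "span (insert ?u E) = span (insert v F)" by (rule sp)
    qed (rule orth)
    then show ?thesis by blast
  qed
qed

lemma onb_exists: "\<exists>E. orthonormal_basis S b E"
proof -
  obtain F where F: "finite F" "span F = S" using fin by blast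
  then show ?thesis using onb_exists_span[of F] span_superset[of F] by simp
qed

lemma riesz:
  assumes "lin_on S \<phi>"
  shows "\<exists>w\<in>S. \<forall>y\<in>S. b w y = \<phi> y"
proof -
  obtain E where E: "orthonormal_basis S b E" using onb_exists by blast
  have ES: "E \<subseteq> S" using E by (auto simp: orthonormal_basis_def span_base)
  let ?w = "\<Sum>e\<in>E. \<phi> e *\<^sub>R e"
  have w: "?w \<in> S" using ES by (auto intro!: mem(5,6))
  have "b ?w y = \<phi> y" if y: "y \<in> S" for y
  proof -
    have "b ?w y = (\<Sum>e\<in>E. b (\<phi> e *\<^sub>R e) y)" 
      using ES y by (intro sum_left) (auto intro: mem)
    also have "\<dots> = (\<Sum>e\<in>E. b y e *\<^sub>R \<phi> e)"
      using ES y by (intro sum.cong) (auto simp: scale_left subset_iff sym[of y])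
    also have "\<dots> = \<phi> (\<Sum>e\<in>E. b y e *\<^sub>R e)"
      using ES by (intro lin_on_lincomb[OF sub assms, symmetric]) auto
    also have "(\<Sum>e\<in>E. b y e *\<^sub>R e) = y" using onb_expand[OF E _ y] by simp
    finally show ?thesis .
  qed
  then show ?thesis using w by blast
qed

lemma trace_comm:
  assumes E: "orthonormal_basis S b E" and P: "endo_on S P" and Q: "endo_on S Q"
  shows "(\<Sum>e\<in>E. b (P (Q e)) e) = (\<Sum>e\<in>E. b (Q (P e)) e)"
proof -
  have ES: "E \<subseteq> S" using E by (auto simp: orthonormal_basis_def span_base)
  have expand: "b (F (G e)) e = (\<Sum>f\<in>E. b (G e) f * b (F f) e)"
    if "endo_on S F" "endo_on S G" "e \<in> E" for F G e
  proof -
    have Ge: "G e \<in> S" using that ES by (auto simp: endo_on_def)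
    have Ff: "F f \<in> S" if "f \<in> E" for f using that \<open>endo_on S F\<close> ES by (auto simp: endo_on_def)
    have eS: "e \<in> S" using that ES by auto
    have "F (G e) = F (\<Sum>f\<in>E. b (G e) f *\<^sub>R f)" using onb_expand[OF E _ Ge] by simp
    also have "\<dots> = (\<Sum>f\<in>E. b (G e) f *\<^sub>R F f)"
      using that(1) ES by (intro lin_on_lincomb[OF sub]) (auto simp: endo_on_def)
    finally have "b (F (G e)) e = (\<Sum>f\<in>E. b (b (G e) f *\<^sub>R F f) e)"
      using sum_left[OF eS, of E "\<lambda>f. b (G e) f *\<^sub>R F f"] Ff mem(5) by simp
    also have "\<dots> = (\<Sum>f\<in>E. b (G e) f * b (F f) e)"
      by (intro sum.cong) (auto simp: scale_left[OF eS Ff])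
    finally show ?thesis .
  qed
  have "(\<Sum>e\<in>E. b (P (Q e)) e) = (\<Sum>e\<in>E. \<Sum>f\<in>E. b (Q e) f * b (P f) e)"
    using expand[OF P Q] by simp
  also have "\<dots> = (\<Sum>f\<in>E. \<Sum>e\<in>E. b (P f) e * b (Q e) f)"
    by (subst sum.swap) (simp add: mult.commute)
  also have "\<dots> = (\<Sum>e\<in>E. b (Q (P e)) e)"
    using expand[OF Q P] by simp
  finally show ?thesis .
qed

lemma transp_on_eq:
  assumes "\<And>x. x \<in> S \<Longrightarrow> C x \<in> S" "\<And>x z. x \<in> S \<Longrightarrow> z \<in> S \<Longrightarrow> b (C x) z = b x (B z)" "x \<in> S"
  shows "transp_on S b B x = C x"
  unfolding transp_on_def
proof (rule the_equality)
  show "C x \<in> S \<and> (\<forall>z\<in>S. b (C x) z = b x (B z))" using assms by auto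
  fix y assume "y \<in> S \<and> (\<forall>z\<in>S. b y z = b x (B z))"
  then show "y = C x" using assms by (intro eqI) auto
qed

end


section \<open>Distributions and connections\<close>

lemma vfield_zero: "smooth_atlas A \<Longrightarrow> open W \<Longrightarrow> vfield A W (\<lambda>q. 0)"
  by (rule vfieldI) (auto intro: subspace_0 subspace_tangent smooth_fun_const dest: smooth_fun_open)

lemma vfield_sum:
  assumes "smooth_atlas A" "open W" "\<And>i. i \<in> I \<Longrightarrow> vfield A W (X i)"
  shows "vfield A W (\<lambda>q. \<Sum>i\<in>I. X i q)"
  using assms(3)
proof (induction I rule: infinite_finite_induct)
  case (insert i I)
  then have "vfield A W (\<lambda>q. X i q + (\<Sum>i\<in>I. X i q))" by (intro vfield_add) auto
  then show ?case unfolding sum.insert[OF insert(1,2)] .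
qed (use vfield_zero[OF assms(1,2)] in simp_all)

lemma distribution_frame:
  assumes "distribution A k H"
  shows "\<exists>W E. p \<in> W \<and> open W \<and> (\<forall>i<k. vfield A W (E i)) \<and> (\<forall>q\<in>W. inj_on (\<lambda>i. E i q) {..<k} \<and>
    independent ((\<lambda>i. E i q) ` {..<k}) \<and> span ((\<lambda>i. E i q) ` {..<k}) = H q \<and> H q \<subseteq> tangent A q)"
  using assms[unfolded distribution_def, THEN spec, of p] by (elim exE conjE) (intro exI conjI)

lemma distribution_subspace:
  assumes "distribution A k H"
  shows "subspace (H p)" "H p \<subseteq> tangent A p" "\<exists>F. finite F \<and> span F = H p"
proof -
  obtain W E where p: "p \<in> W" and f: "\<forall>q\<in>W. inj_on (\<lambda>i. E i q) {..<k} \<and>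
    independent ((\<lambda>i. E i q) ` {..<k}) \<and> span ((\<lambda>i. E i q) ` {..<k}) = H q \<and> H q \<subseteq> tangent A q"
    using distribution_frame[OF assms, of p] by (elim exE conjE)
  have s: "span ((\<lambda>i. E i q) ` {..<k}) = H q" and t: "H q \<subseteq> tangent A q" if "q \<in> W" for q
    using f that by auto
  show "subspace (H p)" using s[OF p] subspace_span by metis
  show "H p \<subseteq> tangent A p" by (rule t[OF p])
  show "\<exists>F. finite F \<and> span F = H p" using s[OF p] by blast
qed

lemma distribution_section_extends:
  assumes "smooth_atlas A" "distribution A k H" "x \<in> H p"
  shows "\<exists>X. dsection_near A H p X \<and> X p = x"
proof -
  obtain W E where p: "p \<in> W" "open W" and v: "\<forall>i<k. vfield A W (E i)" and f: "\<forall>q\<in>W. inj_on (\<lambda>i. E i q) {..<k} \<and>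
    independent ((\<lambda>i. E i q) ` {..<k}) \<and> span ((\<lambda>i. E i q) ` {..<k}) = H q \<and> H q \<subseteq> tangent A q"
    using distribution_frame[OF assms(2), of p] by (elim exE conjE)
  have i: "inj_on (\<lambda>i. E i q) {..<k}" and s: "span ((\<lambda>i. E i q) ` {..<k}) = H q" if "q \<in> W" for q
    using f that by auto
  have "x \<in> span ((\<lambda>i. E i p) ` {..<k})" using assms(3) s[OF p(1)] by simp
  then obtain c where c: "x = (\<Sum>e\<in>(\<lambda>i. E i p) ` {..<k}. c e *\<^sub>R e)"
    unfolding span_finite[OF finite_imageI[OF finite_lessThan]] by blast
  have c2: "x = (\<Sum>i<k. c (E i p) *\<^sub>R E i p)"
    unfolding c by (rule sum.reindex_cong[OF i[OF p(1)]]) auto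
  let ?X = "\<lambda>q. \<Sum>i<k. c (E i p) *\<^sub>R E i q"
  have "vfield A W ?X"
    by (intro vfield_sum assms(1) p(2) vfield_cscale) (use v in simp)
  moreover have "?X q \<in> H q" if "q \<in> W" for q
    unfolding s[OF that, symmetric] by (intro span_sum span_scale span_base) auto
  ultimately show ?thesis unfolding dsection_near_def dsection_def using p c2 by blast
qed

lemma dsection_near_vfield: "dsection_near A H p X \<Longrightarrow> vfield_near A p X"
  by (auto simp: dsection_near_def dsection_def vfield_near_def)

lemma dsection_near_at: "dsection_near A H p X \<Longrightarrow> X p \<in> H p"
  by (auto simp: dsection_near_def dsection_def)

lemma vfield_near_tangent: "vfield_near A p X \<Longrightarrow> X p \<in> tangent A p"
  by (auto simp: vfield_near_def intro: vfield_tangent)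

lemma common_domain:
  assumes "vfield A W X" "p \<in> W" "vfield A W' Y" "p \<in> W'"
  shows "p \<in> W \<inter> W'" "open (W \<inter> W')" "vfield A (W \<inter> W') X" "vfield A (W \<inter> W') Y"
  using assms vfield_open[OF assms(1)] vfield_open[OF assms(3)]
    vfield_subset[OF assms(1), of "W \<inter> W'"] vfield_subset[OF assms(3), of "W \<inter> W'"]
  by auto

lemma vfield_near_add: "vfield_near A p X \<Longrightarrow> vfield_near A p Y \<Longrightarrow> vfield_near A p (\<lambda>q. X q + Y q)"
proof -
  assume "vfield_near A p X" "vfield_near A p Y"
  then obtain W W' where "p \<in> W" "vfield A W X" "p \<in> W'" "vfield A W' Y"
    unfolding vfield_near_def by (elim exE conjE)
  note c = common_domain[OF this(2,1,4,3)]
  from vfield_add[OF c(3,4)] c(1) show ?thesis unfolding vfield_near_def by (intro exI conjI)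
qed

lemma vfield_near_cscale:
  "smooth_atlas A \<Longrightarrow> vfield_near A p X \<Longrightarrow> vfield_near A p (\<lambda>q. c *\<^sub>R X q)"
  unfolding vfield_near_def using vfield_cscale by blast

lemma vfield_near_diff:
  "smooth_atlas A \<Longrightarrow> vfield_near A p X \<Longrightarrow> vfield_near A p Y \<Longrightarrow> vfield_near A p (\<lambda>q. X q - Y q)"
  using vfield_near_add[of A p X "\<lambda>q. (-1) *\<^sub>R Y q"] vfield_near_cscale[of A p Y "-1"] by simp

context
  fixes A :: "('m::{second_countable_topology,t2_space}, 'e::euclidean_space) atlas" and D :: "'m conn"
  assumes D: "connection A D" and sm: "smooth_atlas A"
begin

lemmas connection_parts = D[unfolded connection_def, THEN conjunct1]
  D[unfolded connection_def, THEN conjunct2, THEN conjunct1]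
  D[unfolded connection_def, THEN conjunct2, THEN conjunct2, THEN conjunct1]
  D[unfolded connection_def, THEN conjunct2, THEN conjunct2, THEN conjunct2, THEN conjunct1]
  D[unfolded connection_def, THEN conjunct2, THEN conjunct2, THEN conjunct2, THEN conjunct2]

lemma connection_lin: "vfield_near A p Y \<Longrightarrow> lin_on (tangent A p) (\<lambda>v. D p v Y)"
  by (rule connection_parts(1)[THEN spec, THEN spec, THEN mp, THEN conjunct1])

lemma connection_tangent: "vfield_near A p Y \<Longrightarrow> v \<in> tangent A p \<Longrightarrow> D p v Y \<in> tangent A p"
  by (rule connection_parts(1)[THEN spec, THEN spec, THEN mp, THEN conjunct2, THEN bspec])

lemmas connection_add = connection_parts(2)[rule_format]

lemma connection_cscale:
  assumes "v \<in> tangent A p" "vfield_near A p Y"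
  shows "D p v (\<lambda>q. c *\<^sub>R Y q) = c *\<^sub>R D p v Y"
proof -
  from connection_parts(3)[rule_format, OF assms(1) smooth_near_const[OF sm] assms(2), of c]
  show ?thesis using tangent_const[OF sm assms(1)] by simp
qed

lemma connection_diff:
  assumes "v \<in> tangent A p" "vfield_near A p Y" "vfield_near A p Z"
  shows "D p v (\<lambda>q. Y q - Z q) = D p v Y - D p v Z"
  using connection_add[OF assms(1,2) vfield_near_cscale[OF sm assms(3), of "-1"]]
    connection_cscale[OF assms(1,3), of "-1"] by simp

lemma connection_local:
  assumes "v \<in> tangent A p" "vfield_near A p Y" "open W" "p \<in> W" "\<And>q. q \<in> W \<Longrightarrow> Y q = Z q"
  shows "D p v Y = D p v Z"
  by (rule connection_parts(4)[rule_format, OF assms(1,2)]) (use assms(3-5) in auto)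

lemmas connection_vfield = connection_parts(5)[rule_format]

end


section \<open>The scaled metric and the difference tensor\<close>

text \<open>
  A vector outside a subspace is detected by a linear functional vanishing on the subspace; so
  the annihilator of \<open>H\<close> separates vertical vectors.
\<close>

lemma separating_functional:
  fixes S :: "'a::real_vector set"
  assumes "subspace S" "v \<notin> S"
  shows "\<exists>f. linear f \<and> (\<forall>x\<in>S. f x = 0) \<and> f v = (1::real)"
proof -
  obtain B where B: "B \<subseteq> S" "independent B" "S \<subseteq> span B"
    using maximal_independent_subset[of S] by blast
  have sB: "span B \<subseteq> S" using B(1) assms(1) by (simp add: span_minimal)
  then have "v \<notin> span B" using assms(2) by auto
  then have "independent (insert v B)" using B(2) by (simp add: independent_insert)
  then obtain f where f: "linear f" "\<forall>x\<in>insert v B. f x = (if x = v then 1 else 0 :: real)"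
    using linear_independent_extend[of "insert v B" "\<lambda>x. if x = v then 1 else 0 :: real"] by blast
  have "f x = 0" if "x \<in> S" for x
  proof (rule linear_eq_0_on_span[OF f(1)])
    show "x \<in> span B" using B(3) that by auto
    show "f y = 0" if "y \<in> B" for y using f(2) that \<open>v \<notin> span B\<close> span_base[OF that] by auto
  qed
  then show ?thesis using f by auto
qed

text \<open>
  In this locale \<open>D\<close> is the Biquard connection and \<open>Dl\<close> the Levi-Civita connection of the metric \<open>g^l\<close>,
  which is called \<open>G\<close> below.
\<close>

locale qc_geometry =
  fixes A :: "('m::{second_countable_topology,t2_space}, 'e::euclidean_space) atlas"
    and H V :: "'m \<Rightarrow> 'm tvec set" and ip :: "'m metric" and h :: nat and l :: real
    and D Dl :: "'m conn"
  assumes qc: "qc_manifold A H ip h" and h: "h > 0"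
    and biquard: "biquard A H ip h V D"
    and l: "l > 0"
    and levi_civita: "levi_civita A (qc_metric_scaled A H ip h V l) Dl"
begin

abbreviation G where "G \<equiv> qc_metric_scaled A H ip h V l"

lemma sm: "smooth_atlas A"
  using qc by (simp add: qc_manifold_def sub_riemannian_def)

lemma H_distribution: "distribution A h H"
  using qc by (simp add: qc_manifold_def sub_riemannian_def)

lemma V_distribution: "\<exists>k. distribution A k V"
  using biquard by (simp add: biquard_def complement_def)

lemmas H_subspace = distribution_subspace[OF H_distribution]

lemma V_subspace: "subspace (V p)" "V p \<subseteq> tangent A p" "\<exists>F. finite F \<and> span F = V p"
  using V_distribution distribution_subspace by metis+

lemma H_extends: "x \<in> H p \<Longrightarrow> \<exists>X. dsection_near A H p X \<and> X p = x"
  using distribution_section_extends[OF sm H_distribution] .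

lemma V_extends: "x \<in> V p \<Longrightarrow> \<exists>X. dsection_near A V p X \<and> X p = x"
  using distribution_section_extends[OF sm] V_distribution by metis

lemma H_tangent: "x \<in> H p \<Longrightarrow> x \<in> tangent A p" and V_tangent: "u \<in> V p \<Longrightarrow> u \<in> tangent A p"
  using H_subspace V_subspace by blast+

lemma complement: "H p \<inter> V p = {0}" "tangent A p = {x + u | x u. x \<in> H p \<and> u \<in> V p}"
  using biquard[unfolded biquard_def, THEN conjunct1] by (simp_all add: complement_def)

lemma inter_zero: "x \<in> H p \<Longrightarrow> x \<in> V p \<Longrightarrow> x = 0"
  using complement(1)[of p] by auto

lemma splitE:
  assumes "v \<in> tangent A p"
  obtains x u where "v = x + u" "x \<in> H p" "u \<in> V p"
  using assms unfolding complement(2) by blast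

lemma tangent_extends:
  assumes "v \<in> tangent A p"
  shows "\<exists>X. vfield_near A p X \<and> X p = v"
proof -
  obtain x u where xu: "v = x + u" "x \<in> H p" "u \<in> V p" using splitE[OF assms] .
  obtain X U where X: "dsection_near A H p X" "X p = x" and U: "dsection_near A V p U" "U p = u"
    using H_extends[OF xu(2)] V_extends[OF xu(3)] by blast
  have "vfield_near A p (\<lambda>q. X q + U q)"
    using X(1) U(1) by (intro vfield_near_add dsection_near_vfield)
  then show ?thesis using X U xu by blast
qed

lemma split_unique:
  assumes "x \<in> H p" "u \<in> V p" "y \<in> H p" "w \<in> V p" "x + u = y + w"
  shows "x = y" "u = w"
proof -
  have "x - y = w - u" using assms(5) by (simp add: algebra_simps)
  moreover have "x - y \<in> H p" "w - u \<in> V p"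
    using assms subspace_diff[OF H_subspace(1)] subspace_diff[OF V_subspace(1)] by auto
  ultimately show "x = y" "u = w" using inter_zero[of "x - y" p] by auto
qed

lemma proj:
  assumes "x \<in> H p" "u \<in> V p"
  shows "proj1 (H p) (V p) (x + u) = x" "proj2 (H p) (V p) (x + u) = u"
proof -
  show "proj1 (H p) (V p) (x + u) = x" unfolding proj1_def
  proof (rule the_equality)
    fix y assume "y \<in> H p \<and> x + u - y \<in> V p"
    then show "y = x" using split_unique(1)[of y p "x + u - y" x u] assms by simp
  qed (use assms in simp)
  show "proj2 (H p) (V p) (x + u) = u" unfolding proj2_def
  proof (rule the_equality)
    fix y assume "y \<in> V p \<and> x + u - y \<in> H p"
    then show "y = u" using split_unique(2)[of "x + u - y" p y x u] assms by simp
  qed (use assms in simp)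
qed

sublocale H: inner_space "H p" "ip p" for p
  using H_subspace qc by unfold_locales (auto simp: qc_manifold_def sub_riemannian_def)

text \<open>The coframe that the definition of \<open>qc_metric\<close> chooses, at the point \<open>p\<close>.\<close>

definition cof :: "'m \<Rightarrow> nat \<Rightarrow> 'm covec" where
  "cof p a = (SOME \<eta>. \<exists>W. p \<in> W \<and> qc_coframe A H ip h W \<eta>) a p"

text \<open>The vertical summand of \<open>qc_metric\<close>; it is defined on all tangent vectors, and \<open>H\<close> lies in its kernel.\<close>

definition vert :: "'m \<Rightarrow> 'm tvec \<Rightarrow> 'm tvec \<Rightarrow> real" where
  "vert p u w = (\<Sum>a\<in>{1..3}. cof p a u * cof p a w)"

lemma cof_coframe: "\<exists>W \<eta>. p \<in> W \<and> qc_coframe A H ip h W \<eta> \<and> cof p = (\<lambda>a. \<eta> a p)"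
proof -
  have "\<exists>\<eta> W. p \<in> W \<and> qc_coframe A H ip h W \<eta>"
    using qc[unfolded qc_manifold_def, THEN conjunct2, rule_format, of p] by (rule ex_comm[THEN iffD1])
  from someI_ex[OF this] show ?thesis unfolding cof_def[abs_def] by blast
qed

lemma coframe_annihilator:
  assumes "qc_coframe A H ip h W \<eta>" "p \<in> W" "a \<in> {1..3}"
  shows "\<eta> a p \<in> annihilator A H p"
  using assms by (auto simp: qc_coframe_def ann_section_def)

lemma coframe_spans:
  assumes "qc_coframe A H ip h W \<eta>" "p \<in> W" "\<xi> \<in> annihilator A H p"
  shows "\<exists>c. \<forall>v\<in>tangent A p. \<xi> v = (\<Sum>a\<in>{1..3}. c a * \<eta> a p v)"
  using assms unfolding qc_coframe_def by blast

lemma ann: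
  assumes "\<xi> \<in> annihilator A H p"
  shows ann_lin: "lin_on (tangent A p) \<xi>" and ann_H: "x \<in> H p \<Longrightarrow> \<xi> x = 0"
  using assms by (auto simp: annihilator_def)

lemma cof_annihilator: "a \<in> {1..3} \<Longrightarrow> cof p a \<in> annihilator A H p"
  using cof_coframe[of p] coframe_annihilator by metis

lemmas lins = lin_on_def[THEN iffD1, THEN conjunct1, rule_format]
  lin_on_def[THEN iffD1, THEN conjunct2, rule_format]

lemma ann_split: "\<xi> \<in> annihilator A H p \<Longrightarrow> x \<in> H p \<Longrightarrow> u \<in> V p \<Longrightarrow> \<xi> (x + u) = \<xi> u"
  using ann_H[of \<xi> p x] lins(1)[OF ann_lin[of \<xi> p], of x u] H_tangent V_tangent by simp

lemma coframe_separates: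
  assumes "qc_coframe A H ip h W \<eta>" "p \<in> W" "u \<in> V p" "\<And>a. a \<in> {1..3} \<Longrightarrow> \<eta> a p u = 0"
  shows "u = 0"
proof (rule ccontr)
  assume "u \<noteq> 0"
  then have "u \<notin> H p" using inter_zero assms(3) by blast
  then obtain f where f: "linear f" "\<forall>x\<in>H p. f x = 0" "f u = (1::real)"
    using separating_functional[OF H_subspace(1)] by blast
  have "f \<in> annihilator A H p"
    using f(1,2) by (auto simp: annihilator_def lin_on_def linear_iff)
  then obtain c where "\<forall>v\<in>tangent A p. f v = (\<Sum>a\<in>{1..3}. c a * \<eta> a p v)"
    using coframe_spans[OF assms(1,2)] by blast
  then have "f u = 0" using assms(4) V_tangent[OF assms(3)] by simp
  then show False using f(3) by simp
qed

lemma ip_zero: "ip p 0 0 = 0"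
  using H.zero_left H_subspace(1) subspace_0 by blast

lemma qc_metric_split:
  assumes "x \<in> H p" "u \<in> V p" "y \<in> H p" "w \<in> V p"
  shows "qc_metric A H ip h V p (x + u) (y + w) = ip p x y + vert p u w"
proof -
  have "cof p a (x + u) = cof p a u" "cof p a (y + w) = cof p a w" if "a \<in> {1..3}" for a
    using ann_split[OF cof_annihilator[OF that]] assms by auto
  then have "(\<Sum>a\<in>{1..3}. cof p a (x + u) * cof p a (y + w)) = vert p u w"
    unfolding vert_def by (intro sum.cong) auto
  then show ?thesis using proj[OF assms(1,2)] proj[OF assms(3,4)]
    by (simp add: qc_metric_def flip: cof_def)
qed

lemma G_split:
  assumes "x \<in> H p" "u \<in> V p" "y \<in> H p" "w \<in> V p"
  shows "G p (x + u) (y + w) = ip p x y + l\<^sup>2 * vert p u w"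
  using proj[OF assms(1,2)] proj[OF assms(3,4)]
    qc_metric_split[OF subspace_0[OF H_subspace(1)] assms(2) subspace_0[OF H_subspace(1)] assms(4)] ip_zero
  by (simp add: qc_metric_scaled_def)

lemma vert_H: "x \<in> H p \<Longrightarrow> vert p x u = 0" "x \<in> H p \<Longrightarrow> vert p u x = 0"
  using ann_H[OF cof_annihilator] by (auto simp: vert_def intro!: sum.neutral)

lemma G_values:
  assumes "x \<in> H p" "u \<in> V p"
  shows G_HH: "y \<in> H p \<Longrightarrow> G p x y = ip p x y"
    and G_HV: "G p x u = 0" and G_VH: "G p u x = 0"
    and G_VV: "w \<in> V p \<Longrightarrow> G p u w = l\<^sup>2 * vert p u w"
  using G_split[OF assms(1) subspace_0[OF V_subspace(1)], of y 0]
    G_split[OF assms(1) subspace_0[OF V_subspace(1)] subspace_0[OF H_subspace(1)] assms(2)]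
    G_split[OF subspace_0[OF H_subspace(1)] assms(2) assms(1) subspace_0[OF V_subspace(1)]]
    G_split[OF subspace_0[OF H_subspace(1)] assms(2) subspace_0[OF H_subspace(1)], of w]
    assms vert_H subspace_0[OF V_subspace(1), of p] subspace_0[OF H_subspace(1), of p] ip_zero
    H.zero_left H.zero_right
  by auto

lemma finite_dimensional: "\<exists>F. finite F \<and> span F = tangent A p"
proof -
  obtain F1 F2 where F: "finite F1" "span F1 = H p" "finite F2" "span F2 = V p"
    using H_subspace(3) V_subspace(3) by metis
  have "F1 \<union> F2 \<subseteq> tangent A p" using F(2,4) span_superset[of F1] span_superset[of F2] H_tangent V_tangent by auto
  then have 1: "span (F1 \<union> F2) \<subseteq> tangent A p" by (intro span_minimal subspace_tangent)
  have "v \<in> span (F1 \<union> F2)" if v: "v \<in> tangent A p" for v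
  proof -
    obtain x u where xu: "v = x + u" "x \<in> H p" "u \<in> V p" using splitE[OF v] .
    have "x \<in> span (F1 \<union> F2)" "u \<in> span (F1 \<union> F2)"
      using xu F span_mono[of F1 "F1 \<union> F2"] span_mono[of F2 "F1 \<union> F2"] by auto
    then show ?thesis using xu(1) span_add by blast
  qed
  then have "span (F1 \<union> F2) = tangent A p" using 1 by blast
  then show ?thesis using F(1,3) by blast
qed

text \<open>The coframe has no common zero on \<open>V\<close>, as it spans the annihilator of \<open>H\<close>; so \<open>G\<close> is positive definite.\<close>

lemma vert_pos:
  assumes "u \<in> V p" "u \<noteq> 0"
  shows "vert p u u > 0"
proof -
  obtain W \<eta> where W: "p \<in> W" "qc_coframe A H ip h W \<eta>" "cof p = (\<lambda>a. \<eta> a p)"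
    using cof_coframe by blast
  obtain a where a: "a \<in> {1..3}" "cof p a u \<noteq> 0"
    using coframe_separates[OF W(2,1) assms(1)] assms(2) W(3) by auto
  then have "0 < cof p a u * cof p a u" by (simp add: zero_less_mult_iff linorder_neq_iff disj_commute)
  also have "\<dots> \<le> vert p u u" unfolding vert_def by (rule member_le_sum) (use a in auto)
  finally show ?thesis .
qed

lemma vert_lin:
  assumes "u \<in> tangent A p"
  shows "lin_on (tangent A p) (vert p u)"
proof -
  note L = lins[OF ann_lin[OF cof_annihilator[of _ p]]]
  have "cof p a u * cof p a (x + y) = cof p a u * cof p a x + cof p a u * cof p a y"
    "cof p a u * cof p a (c *\<^sub>R x) = c * (cof p a u * cof p a x)"
    if "a \<in> {1..3}" "x \<in> tangent A p" "y \<in> tangent A p" for a x y c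
    using L[OF that(1)] that by (auto simp: algebra_simps)
  then show ?thesis
    unfolding lin_on_def vert_def
    by (auto simp: sum_distrib_left simp flip: sum.distrib intro!: sum.cong)
qed

lemma G_formula:
  assumes "v \<in> tangent A p" "w \<in> tangent A p"
  shows "G p v w = ip p (proj1 (H p) (V p) v) (proj1 (H p) (V p) w) + l\<^sup>2 * vert p v w"
proof -
  obtain x u where xu: "v = x + u" "x \<in> H p" "u \<in> V p" using splitE[OF assms(1)] .
  obtain y t where yt: "w = y + t" "y \<in> H p" "t \<in> V p" using splitE[OF assms(2)] .
  have "vert p (x + u) (y + t) = vert p u t"
    unfolding vert_def using ann_split[OF cof_annihilator] xu(2,3) yt(2,3) by (intro sum.cong) simp_all
  then show ?thesis using G_split[OF xu(2,3) yt(2,3)] proj xu yt by simp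
qed

lemma G_inner: "inner_on (tangent A p) (G p)"
proof -
  have "lin_on (tangent A p) (proj1 (H p) (V p))"
    unfolding lin_on_def
  proof (intro conjI ballI allI)
    fix v w assume v: "v \<in> tangent A p" and w: "w \<in> tangent A p"
    obtain x u where xu: "v = x + u" "x \<in> H p" "u \<in> V p" using splitE[OF v] .
    obtain y t where yt: "w = y + t" "y \<in> H p" "t \<in> V p" using splitE[OF w] .
    have "v + w = (x + y) + (u + t)" "x + y \<in> H p" "u + t \<in> V p"
      using xu yt by (auto intro: subspace_add H_subspace V_subspace)
    then show "proj1 (H p) (V p) (v + w) = proj1 (H p) (V p) v + proj1 (H p) (V p) w"
      using proj xu yt by metis
  next
    fix c v assume v: "v \<in> tangent A p"
    obtain x u where xu: "v = x + u" "x \<in> H p" "u \<in> V p" using splitE[OF v] .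
    have "c *\<^sub>R v = c *\<^sub>R x + c *\<^sub>R u" "c *\<^sub>R x \<in> H p" "c *\<^sub>R u \<in> V p"
      using xu by (auto intro: subspace_scale H_subspace V_subspace scaleR_add_right)
    then show "proj1 (H p) (V p) (c *\<^sub>R v) = c *\<^sub>R proj1 (H p) (V p) v"
      using proj xu by metis
  qed
  note P = lins[OF this]
  have PH: "proj1 (H p) (V p) v \<in> H p" if "v \<in> tangent A p" for v
    using splitE[OF that] proj(1) by metis
  show ?thesis
    unfolding inner_on_def
  proof (intro conjI ballI impI)
    fix x assume x: "x \<in> tangent A p"
    show "lin_on (tangent A p) (G p x)"
      unfolding lin_on_def using x lins[OF vert_lin[OF x]] PH P subspace_tangent[of A p]
      by (simp add: G_formula subspace_add subspace_scale H.add_right H.scale_right algebra_simps)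
    fix y assume y: "y \<in> tangent A p"
    show "G p x y = G p y x"
      using x y PH H.sym by (simp add: G_formula vert_def mult.commute)
  next
    fix v assume v: "v \<in> tangent A p" "v \<noteq> 0"
    obtain x u where xu: "v = x + u" "x \<in> H p" "u \<in> V p" using splitE[OF v(1)] .
    have "ip p x x \<ge> 0" "x \<noteq> 0 \<longrightarrow> ip p x x > 0" "vert p u u \<ge> 0" "u \<noteq> 0 \<longrightarrow> vert p u u > 0"
      using H.pos[OF xu(2)] vert_pos[OF xu(3)] ip_zero by (auto simp: vert_def intro: sum_nonneg) (metis less_eq_real_def)
    moreover have "l\<^sup>2 > 0" using l by simp
    ultimately show "0 < G p v v"
      using G_split[OF xu(2,3,2,3)] xu(1) v(2)
      by (metis add.right_neutral add_0 add_pos_nonneg add_nonneg_pos mult_nonneg_nonneg mult_pos_pos order_less_imp_le)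
  qed
qed

sublocale G: inner_space "tangent A p" "G p" for p
  using subspace_tangent G_inner finite_dimensional by unfold_locales

end


context qc_geometry
begin

lemma biquard_parts:
  "connection A D" "parallel_distribution A D H" "parallel_distribution A D V"
  "parallel_metric A D (qc_metric A H ip h V)" "parallel_J A H ip D"
  "\<forall>p. \<forall>x\<in>H p. \<forall>y\<in>H p. torsion_at A D p x y \<in> V p"
  "\<forall>p. \<forall>x\<in>H p. \<forall>u\<in>V p. torsion_at A D p x u \<in> H p"
  "\<forall>p. \<forall>u\<in>V p. \<exists>B\<in>t_perp A H ip p. \<exists>S\<in>symmetric_endos (H p) (ip p).
        \<forall>x\<in>H p. torsion_at A D p u x = B x + S x"
  by (insert biquard[unfolded biquard_def]) (elim conjE, assumption)+

lemma levi_civita_parts: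
  "connection A Dl" "parallel_metric A Dl G"
  "\<forall>p X Y. vfield_near A p X \<longrightarrow> vfield_near A p Y \<longrightarrow> torsion A Dl X Y p = 0"
  by (insert levi_civita[unfolded levi_civita_def]) (elim conjE, assumption)+

lemmas D_conn = biquard_parts(1) and Dl_conn = levi_civita_parts(1)

lemmas D_H = biquard_parts(2)[unfolded parallel_distribution_def, rule_format]
lemmas D_V = biquard_parts(3)[unfolded parallel_distribution_def, rule_format]
lemmas D_g = biquard_parts(4)[unfolded parallel_metric_def, rule_format]
lemmas Dl_G = levi_civita_parts(2)[unfolded parallel_metric_def, rule_format]

lemmas D_tangent = connection_tangent[OF D_conn sm] and Dl_tangent = connection_tangent[OF Dl_conn sm]

lemma zeros: "0 \<in> H p" "0 \<in> V p" "0 \<in> tangent A p"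
  using subspace_0 H_subspace(1) V_subspace(1) subspace_tangent by blast+

lemma G_qc_metric:
  assumes "y \<in> tangent A p"
  shows "x \<in> H p \<Longrightarrow> G p y x = qc_metric A H ip h V p y x"
    and "u \<in> V p \<Longrightarrow> G p y u = l\<^sup>2 * qc_metric A H ip h V p y u"
proof -
  obtain a w where aw: "y = a + w" "a \<in> H p" "w \<in> V p" using splitE[OF assms] .
  show "G p y x = qc_metric A H ip h V p y x" if "x \<in> H p"
    using G_split[OF aw(2,3) that zeros(2)] qc_metric_split[OF aw(2,3) that zeros(2)]
      vert_H(2)[OF zeros(1)] aw(1) by simp
  show "G p y u = l\<^sup>2 * qc_metric A H ip h V p y u" if "u \<in> V p"
    using G_split[OF aw(2,3) zeros(1) that] qc_metric_split[OF aw(2,3) zeros(1) that]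
      H.zero_right[OF aw(2)] aw(1) by simp
qed

text \<open>
  The Biquard connection is metric for \<open>G\<close> as well, because the two metrics differ by a constant
  factor on each of the two parallel summands. It suffices to see this with one argument in a summand.
\<close>

lemma D_G:
  assumes v: "v \<in> tangent A p" and Y: "vfield_near A p Y"
    and Z: "dsection_near A H p Z \<or> dsection_near A V p Z"
  shows "v (\<lambda>q. G q (Y q) (Z q)) = G p (D p v Y) (Z p) + G p (Y p) (D p v Z)"
proof -
  obtain W where W: "p \<in> W" "vfield A W Y" using Y by (auto simp: vfield_near_def)
  note t = D_tangent[OF Y v] vfield_near_tangent[OF Y]
  show ?thesis using Z
  proof
    assume Z: "dsection_near A H p Z"
    then obtain W' where W': "p \<in> W'" "vfield A W' Z" "\<And>q. q \<in> W' \<Longrightarrow> Z q \<in> H q"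
      unfolding dsection_near_def dsection_def by blast
    note c = common_domain[OF W(2,1) W'(2,1)]
    have "v (\<lambda>q. G q (Y q) (Z q)) = v (\<lambda>q. qc_metric A H ip h V q (Y q) (Z q))"
      by (rule tangentD(2)[OF v c(2,1)]) (use W' W(2) in \<open>auto intro!: G_qc_metric vfield_tangent\<close>)
    then show ?thesis
      using D_g[OF v Y dsection_near_vfield[OF Z]] G_qc_metric(1)[OF t(1) dsection_near_at[OF Z]]
        G_qc_metric(1)[OF t(2) D_H[OF v Z]] by simp
  next
    assume Z: "dsection_near A V p Z"
    then obtain W' where W': "p \<in> W'" "vfield A W' Z" "\<And>q. q \<in> W' \<Longrightarrow> Z q \<in> V q"
      unfolding dsection_near_def dsection_def by blast
    note c = common_domain[OF W(2,1) W'(2,1)]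
    have "v (\<lambda>q. G q (Y q) (Z q)) = v (\<lambda>q. l\<^sup>2 * qc_metric A H ip h V q (Y q) (Z q))"
      by (rule tangentD(2)[OF v c(2,1)]) (use W' W(2) in \<open>auto intro!: G_qc_metric vfield_tangent\<close>)
    then show ?thesis
      using D_g[OF v Y dsection_near_vfield[OF Z]] G_qc_metric(2)[OF t(1) dsection_near_at[OF Z]]
        G_qc_metric(2)[OF t(2) D_V[OF v Z]] tangent_cmult[OF sm v] by (simp add: algebra_simps)
  qed
qed

text \<open>
  Comparing with the Levi-Civita connection, the difference is skew. This alone makes it
  tensorial: if \<open>Y\<close> vanishes at \<open>p\<close>, then so does the inner product of the difference with every
  vector.
\<close>

lemma difference_skew_fields:
  assumes v: "v \<in> tangent A p" and Y: "vfield_near A p Y"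
    and Z: "dsection_near A H p Z \<or> dsection_near A V p Z"
  shows "G p (Dl p v Y - D p v Y) (Z p) = - G p (Y p) (Dl p v Z - D p v Z)"
proof -
  have Zn: "vfield_near A p Z" using Z dsection_near_vfield by blast
  have "G p (Dl p v Y) (Z p) + G p (Y p) (Dl p v Z) = G p (D p v Y) (Z p) + G p (Y p) (D p v Z)"
    using D_G[OF v Y Z] Dl_G[OF v Y Zn] by simp
  then show ?thesis
    by (simp add: G.diff_left G.diff_right vfield_near_tangent Y Zn v D_tangent Dl_tangent)
qed

lemma difference_zero:
  assumes v: "v \<in> tangent A p" and Y: "vfield_near A p Y" "Y p = 0"
  shows "Dl p v Y = D p v Y"
proof -
  let ?d = "Dl p v Y - D p v Y"
  have d: "?d \<in> tangent A p"
    using v Y D_tangent Dl_tangent subspace_diff[OF subspace_tangent] by blast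
  have z: "G p ?d (Z p) = 0" if "dsection_near A H p Z \<or> dsection_near A V p Z" for Z
  proof -
    have "vfield_near A p Z" using that dsection_near_vfield by blast
    then have "Dl p v Z - D p v Z \<in> tangent A p"
      using v D_tangent Dl_tangent subspace_diff[OF subspace_tangent] by blast
    then show ?thesis using difference_skew_fields[OF v Y(1) that] Y(2) G.zero_left by simp
  qed
  have "G p ?d z = G p 0 z" if z': "z \<in> tangent A p" for z
  proof -
    obtain x u where xu: "z = x + u" "x \<in> H p" "u \<in> V p" using splitE[OF z'] .
    obtain X U where X: "dsection_near A H p X" "X p = x" and U: "dsection_near A V p U" "U p = u"
      using H_extends[OF xu(2)] V_extends[OF xu(3)] by blast
    have "G p ?d x = 0" "G p ?d u = 0" using z[of X] z[of U] X U by auto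
    then show ?thesis
      using xu G.add_right[OF d] H_tangent V_tangent G.zero_left[OF z'] by simp
  qed
  then have "?d = 0" using G.eqI[OF d zeros(3)] by blast
  then show ?thesis by simp
qed

text \<open>The difference of the two connections as a tensor, evaluated through an arbitrary extension of \<open>y\<close>.\<close>

definition difference :: "'m \<Rightarrow> 'm tvec \<Rightarrow> 'm tvec \<Rightarrow> 'm tvec" where
  "difference p v y = (let Y = (SOME Y. vfield_near A p Y \<and> Y p = y) in Dl p v Y - D p v Y)"

lemma diff_eq:
  assumes v: "v \<in> tangent A p" and Y: "vfield_near A p Y"
  shows "difference p v (Y p) = Dl p v Y - D p v Y"
proof -
  define Z where "Z = (SOME Z. vfield_near A p Z \<and> Z p = Y p)"
  have Z: "vfield_near A p Z" "Z p = Y p"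
    using someI[of "\<lambda>Z. vfield_near A p Z \<and> Z p = Y p" Y] Y unfolding Z_def by auto
  have "Dl p v (\<lambda>q. Z q - Y q) = D p v (\<lambda>q. Z q - Y q)"
    using Z Y by (intro difference_zero[OF v] vfield_near_diff sm) auto
  then have "Dl p v Z - Dl p v Y = D p v Z - D p v Y"
    using connection_diff[OF D_conn sm v Z(1) Y] connection_diff[OF Dl_conn sm v Z(1) Y] by simp
  then show ?thesis by (simp add: difference_def Z_def[symmetric] algebra_simps)
qed

lemma diff_tangent: "v \<in> tangent A p \<Longrightarrow> y \<in> tangent A p \<Longrightarrow> difference p v y \<in> tangent A p"
  using tangent_extends[of y p] diff_eq[of v p] D_tangent Dl_tangent
    subspace_diff[OF subspace_tangent] by metis

lemma diff_lin2:
  assumes v: "v \<in> tangent A p"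
  shows "lin_on (tangent A p) (difference p v)"
  unfolding lin_on_def
proof (intro conjI ballI allI)
  fix x y assume "x \<in> tangent A p" "y \<in> tangent A p"
  then obtain X Y where X: "vfield_near A p X" "X p = x" and Y: "vfield_near A p Y" "Y p = y"
    using tangent_extends by metis
  show "difference p v (x + y) = difference p v x + difference p v y"
    using diff_eq[OF v vfield_near_add[OF X(1) Y(1)], unfolded X(2) Y(2)]
      diff_eq[OF v X(1), unfolded X(2)] diff_eq[OF v Y(1), unfolded Y(2)]
      connection_add[OF D_conn sm v X(1) Y(1)] connection_add[OF Dl_conn sm v X(1) Y(1)]
    by (simp only: add_diff_add)
next
  fix c x assume "x \<in> tangent A p"
  then obtain X where X: "vfield_near A p X" "X p = x" using tangent_extends by metis
  show "difference p v (c *\<^sub>R x) = c *\<^sub>R difference p v x"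
    using diff_eq[OF v vfield_near_cscale[OF sm X(1), of c], unfolded X(2)]
      diff_eq[OF v X(1), unfolded X(2)]
      connection_cscale[OF D_conn sm v X(1)] connection_cscale[OF Dl_conn sm v X(1)]
    by (simp only: scaleR_diff_right)
qed

lemma diff_lin1:
  assumes y: "y \<in> tangent A p"
  shows "lin_on (tangent A p) (\<lambda>v. difference p v y)"
proof -
  obtain Y where Y: "vfield_near A p Y" "Y p = y" using tangent_extends[OF y] by blast
  note e = diff_eq[OF _ Y(1), unfolded Y(2)]
  note L = lins[OF connection_lin[OF D_conn sm Y(1)]] lins[OF connection_lin[OF Dl_conn sm Y(1)]]
  show ?thesis
    unfolding lin_on_def
    using subspace_add[OF subspace_tangent, of _ A p] subspace_scale[OF subspace_tangent, of _ A p]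
    by (simp add: e L scaleR_diff_right)
qed

lemma diff_skew:
  assumes v: "v \<in> tangent A p" and y: "y \<in> tangent A p" and z: "z \<in> tangent A p"
  shows "G p (difference p v y) z = - G p y (difference p v z)"
proof -
  obtain Y where Y: "vfield_near A p Y" "Y p = y" using tangent_extends[OF y] by blast
  obtain x u where xu: "z = x + u" "x \<in> H p" "u \<in> V p" using splitE[OF z] .
  obtain X U where X: "dsection_near A H p X" "X p = x" and U: "dsection_near A V p U" "U p = u"
    using H_extends[OF xu(2)] V_extends[OF xu(3)] by blast
  have "G p (difference p v y) x = - G p y (difference p v x)" "G p (difference p v y) u = - G p y (difference p v u)"
    using difference_skew_fields[OF v Y(1), of X] difference_skew_fields[OF v Y(1), of U]
      diff_eq[OF v Y(1)] diff_eq[OF v dsection_near_vfield[OF X(1)]]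
      diff_eq[OF v dsection_near_vfield[OF U(1)]] X U Y(2) by auto
  then show ?thesis
    using xu lins(1)[OF diff_lin2[OF v]] diff_tangent v y H_tangent V_tangent
    by (simp add: G.add_right)
qed

text \<open>The torsion of \<open>D\<close>, expressed by the difference tensor: the brackets cancel because \<open>Dl\<close> is torsion-free.\<close>

definition tors :: "'m \<Rightarrow> 'm tvec \<Rightarrow> 'm tvec \<Rightarrow> 'm tvec" where
  "tors p x y = difference p y x - difference p x y"

text \<open>Since the Levi-Civita connection has no torsion, it computes all Lie brackets.\<close>

lemma bracket_eq:
  assumes "vfield_near A p X" "vfield_near A p Y"
  shows "bracket A X Y p = Dl p (X p) Y - Dl p (Y p) X"
proof -
  have "torsion A Dl X Y p = 0" using levi_civita_parts(3) assms by blast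
  then show ?thesis by (simp add: torsion_def)
qed

lemma bracket_vfield:
  assumes "vfield A W X" "vfield A W Y"
  shows "vfield A W (bracket A X Y)"
proof (rule vfield_cong[OF sm])
  show "vfield A W (\<lambda>q. Dl q (X q) Y - Dl q (Y q) X)"
    by (intro vfield_diff[OF sm] connection_vfield[OF Dl_conn sm] assms)
  show "Dl q (X q) Y - Dl q (Y q) X = bracket A X Y q" if "q \<in> W" for q
    by (rule bracket_eq[symmetric]) (use assms that in \<open>auto simp: vfield_near_def\<close>)
qed

lemma bracket_tangent: "vfield_near A p X \<Longrightarrow> vfield_near A p Y \<Longrightarrow> bracket A X Y p \<in> tangent A p"
  unfolding bracket_eq
  by (intro subspace_diff[OF subspace_tangent] Dl_tangent vfield_near_tangent)

lemma torsion_tors: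
  assumes "vfield_near A p X" "vfield_near A p Y"
  shows "torsion A D X Y p = tors p (X p) (Y p)"
  unfolding torsion_def tors_def bracket_eq[OF assms]
    diff_eq[OF vfield_near_tangent[OF assms(1)] assms(2)]
    diff_eq[OF vfield_near_tangent[OF assms(2)] assms(1)]
  by simp

lemma torsion_at_eq:
  assumes "x \<in> tangent A p" "y \<in> tangent A p"
  shows "torsion_at A D p x y = tors p x y"
  unfolding torsion_at_def
proof (rule the_equality)
  show "\<forall>X Y. vfield_near A p X \<longrightarrow> vfield_near A p Y \<longrightarrow> X p = x \<longrightarrow> Y p = y \<longrightarrow>
    tors p x y = torsion A D X Y p"
    using torsion_tors by auto
  fix w assume w: "\<forall>X Y. vfield_near A p X \<longrightarrow> vfield_near A p Y \<longrightarrow> X p = x \<longrightarrow> Y p = y \<longrightarrow>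
    w = torsion A D X Y p"
  obtain X Y where "vfield_near A p X" "X p = x" "vfield_near A p Y" "Y p = y"
    using tangent_extends assms by metis
  then show "w = tors p x y" using w torsion_tors by blast
qed

lemma tors_tangent: "x \<in> tangent A p \<Longrightarrow> y \<in> tangent A p \<Longrightarrow> tors p x y \<in> tangent A p"
  unfolding tors_def by (intro subspace_diff[OF subspace_tangent] diff_tangent)

lemma tors_anti: "tors p x y = - tors p y x"
  by (simp add: tors_def)

lemma tors_lin2: "x \<in> tangent A p \<Longrightarrow> lin_on (tangent A p) (tors p x)"
  using lins[OF diff_lin1] lins[OF diff_lin2]
  by (simp add: lin_on_def tors_def algebra_simps)

lemma tors_lin1: "y \<in> tangent A p \<Longrightarrow> lin_on (tangent A p) (\<lambda>x. tors p x y)"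
  using lins[OF diff_lin1] lins[OF diff_lin2]
  by (simp add: lin_on_def tors_def algebra_simps)

lemma tors_HH: "x \<in> H p \<Longrightarrow> y \<in> H p \<Longrightarrow> tors p x y \<in> V p"
  using biquard_parts(6) torsion_at_eq H_tangent by metis

lemma tors_HV: "x \<in> H p \<Longrightarrow> u \<in> V p \<Longrightarrow> tors p x u \<in> H p"
  using biquard_parts(7) torsion_at_eq H_tangent V_tangent by metis

lemma tors_VH: "x \<in> H p \<Longrightarrow> u \<in> V p \<Longrightarrow> tors p u x \<in> H p"
  using tors_HV[of x p u] tors_anti[of p u x] subspace_neg[OF H_subspace(1)] by simp

text \<open>
  A tensor that is skew in its last two arguments is recovered from its skew-symmetrization in
  the first two, as in the Koszul formula.
\<close>

lemma koszul:
  assumes "x \<in> tangent A p" "y \<in> tangent A p" "z \<in> tangent A p"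
  shows "2 * G p (difference p x y) z = - G p (tors p x y) z + G p (tors p y z) x - G p (tors p z x) y"
proof -
  note t = diff_tangent assms
  have 1: "G p (tors p x y) z = G p (difference p y x) z - G p (difference p x y) z" 
    "G p (tors p y z) x = G p (difference p z y) x - G p (difference p y z) x"
    "G p (tors p z x) y = G p (difference p x z) y - G p (difference p z x) y"
    unfolding tors_def using t by (simp_all add: G.diff_left)
  show ?thesis unfolding 1
    using diff_skew[OF assms(1,2,3)] diff_skew[OF assms(2,1,3)] diff_skew[OF assms(3,1,2)]
      G.sym[of _ p] t by simp
qed

end


section \<open>Quaternionic inner product spaces\<close>

locale quaternionic_space = inner_space S b for S :: "'a::real_vector set" and b +
  fixes J :: "nat \<Rightarrow> 'a \<Rightarrow> 'a"
  assumes J_mem: "\<And>a x. a \<in> {1..3} \<Longrightarrow> x \<in> S \<Longrightarrow> J a x \<in> S"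
    and J_skew: "\<And>a x y. a \<in> {1..3} \<Longrightarrow> x \<in> S \<Longrightarrow> y \<in> S \<Longrightarrow> b (J a x) y = - b x (J a y)"
    and J_sq: "\<And>a x. a \<in> {1..3} \<Longrightarrow> x \<in> S \<Longrightarrow> J a (J a x) = - x"
    and J_123: "\<And>x. x \<in> S \<Longrightarrow> J 1 (J 2 (J 3 x)) = - x"
begin

lemma J_lin:
  assumes "a \<in> {1..3}"
  shows "lin_on S (J a)"
  unfolding lin_on_def
proof (intro conjI ballI allI)
  fix x y assume "x \<in> S" "y \<in> S"
  then show "J a (x + y) = J a x + J a y"
    by (intro eqI) (use assms in \<open>auto simp: J_skew J_mem mem add_left\<close>)
next
  fix c x assume "x \<in> S"
  then show "J a (c *\<^sub>R x) = c *\<^sub>R J a x"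
    by (intro eqI) (use assms in \<open>auto simp: J_skew J_mem mem scale_left\<close>)
qed

lemma J_minus: "a \<in> {1..3} \<Longrightarrow> x \<in> S \<Longrightarrow> J a (- x) = - J a x"
  using lin_on_minus[OF J_lin] .

lemma J_endo: "a \<in> {1..3} \<Longrightarrow> endo_on S (J a)"
  using J_lin J_mem by (auto simp: endo_on_def)

text \<open>The multiplication table of the imaginary quaternion units.\<close>

lemma J_products:
  assumes x: "x \<in> S"
  shows "J 2 (J 3 x) = J 1 x" "J 1 (J 2 x) = J 3 x" "J 3 (J 1 x) = J 2 x"
    "J 3 (J 2 x) = - J 1 x" "J 2 (J 1 x) = - J 3 x" "J 1 (J 3 x) = - J 2 x"
proof -
  have i: "(1::nat) \<in> {1..3}" "(2::nat) \<in> {1..3}" "(3::nat) \<in> {1..3}" by auto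
  have m: "J a y \<in> S" if "a \<in> {1,2,3}" "y \<in> S" for a y using J_mem that i by auto
  have p23: "J 2 (J 3 y) = J 1 y" if y: "y \<in> S" for y
  proof -
    have "J 1 (J 1 (J 2 (J 3 y))) = J 1 (- y)" using J_123[OF y] by simp
    then show ?thesis using y i m by (simp add: J_sq J_minus)
  qed
  have p12: "J 1 (J 2 y) = J 3 y" if y: "y \<in> S" for y
  proof -
    have "J 1 (J 2 (J 3 (- J 3 y))) = J 3 y" using J_123[of "- J 3 y"] y i m mem(4) by simp
    then show ?thesis using y i m by (simp add: J_sq J_minus mem(4))
  qed
  have p32: "J 3 (J 2 y) = - J 1 y" if y: "y \<in> S" for y
    using p12[of "J 2 y"] y i m by (simp add: J_sq J_minus)
  have p21: "J 2 (J 1 y) = - J 3 y" if y: "y \<in> S" for y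
    using p23[OF y, symmetric] y i m by (simp add: J_sq)
  have p13: "J 1 (J 3 y) = - J 2 y" if y: "y \<in> S" for y
    using p12[OF y, symmetric] y i m by (simp add: J_sq)
  have p31: "J 3 (J 1 y) = J 2 y" if y: "y \<in> S" for y
  proof -
    have "J 3 (J 1 y) = - J 2 (J 1 (J 1 y))" using p21[of "J 1 y"] y i m by simp
    then show ?thesis using y i m by (simp add: J_sq J_minus)
  qed
  show "J 2 (J 3 x) = J 1 x" "J 1 (J 2 x) = J 3 x" "J 3 (J 1 x) = J 2 x"
    "J 3 (J 2 x) = - J 1 x" "J 2 (J 1 x) = - J 3 x" "J 1 (J 3 x) = - J 2 x"
    using p23 p12 p31 p32 p21 p13 x by auto
qed

lemma index_cases: "a \<in> {1..3::nat} \<Longrightarrow> a = 1 \<or> a = 2 \<or> a = 3"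
  by auto

lemma J_product_third:
  assumes "a \<in> {1..3}" "d \<in> {1..3}" "a \<noteq> d"
  shows "\<exists>k\<in>{1..3}. \<exists>s. \<forall>x\<in>S. J a (J d x) = s *\<^sub>R J k x"
proof -
  have c: "?thesis" if "k \<in> {1..3}" "\<And>x. x \<in> S \<Longrightarrow> J a (J d x) = s *\<^sub>R J k x" for k s
    using that by blast
  consider "a = 1" "d = 2" | "a = 2" "d = 1" | "a = 1" "d = 3" | "a = 3" "d = 1" | "a = 2" "d = 3" | "a = 3" "d = 2"
    using index_cases[OF assms(1)] index_cases[OF assms(2)] assms(3) by auto
  then show ?thesis
  proof cases
    case 1 then show ?thesis using c[of 3 1] J_products by simp
  next
    case 2 then show ?thesis using c[of 3 "-1"] J_products by simp
  next
    case 3 then show ?thesis using c[of 2 "-1"] J_products by simp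
  next
    case 4 then show ?thesis using c[of 2 1] J_products by simp
  next
    case 5 then show ?thesis using c[of 1 1] J_products by simp
  next
    case 6 then show ?thesis using c[of 1 "-1"] J_products by simp
  qed
qed

lemma J_skew_zero:
  assumes "a \<in> {1..3}" "x \<in> S"
  shows "b (J a x) x = 0" "b x (J a x) = 0"
  using J_skew[OF assms assms(2)] sym[OF J_mem[OF assms] assms(2)] by auto

lemma J_orthogonal:
  assumes "a \<in> {1..3}" "d \<in> {1..3}" "x \<in> S"
  shows "b (J a x) (J d x) = (if a = d then b x x else 0)"
proof (cases "a = d")
  case True
  then show ?thesis
    using J_skew[OF assms(1,3) J_mem[OF assms(1,3)]] J_sq[OF assms(1,3)] assms(3) by (simp add: minus_right)
next
  case False
  obtain k s where k: "k \<in> {1..3}" "\<And>x. x \<in> S \<Longrightarrow> J a (J d x) = s *\<^sub>R J k x"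
    using J_product_third[OF assms(1,2) False] by blast
  have "b (J a x) (J d x) = - s * b x (J k x)"
    using J_skew[OF assms(1,3) J_mem[OF assms(2,3)]] k assms(3) J_mem[OF k(1) assms(3)]
    by (simp add: scale_right)
  then show ?thesis using False J_skew_zero(2)[OF k(1) assms(3)] by simp
qed

text \<open>
  The product of two different \<open>J\<close>s is a multiple of the third; \<open>B\<close> is orthogonal to it by
  hypothesis, and the symmetric \<open>P\<close> because it is skew. For equal \<open>J\<close>s the trace of \<open>B\<close> vanishes by skewness.
\<close>

lemma trace_JJ:
  assumes E: "orthonormal_basis S b E" and B: "B \<in> skew_endos S b" and P: "P \<in> symmetric_endos S b"
    and BJ: "\<And>k. k \<in> {1..3} \<Longrightarrow> (\<Sum>e\<in>E. b (B e) (J k e)) = 0"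
    and ad: "a \<in> {1..3}" "d \<in> {1..3}"
  shows "(\<Sum>e\<in>E. b (B e + P e) (J a (J d e))) = (if a = d then - (\<Sum>e\<in>E. b (P e) e) else 0)"
proof -
  have E': "\<And>e. e \<in> E \<Longrightarrow> e \<in> S" using E by (auto simp: orthonormal_basis_def span_base)
  have Bm: "B x \<in> S" and Pm: "P x \<in> S" if "x \<in> S" for x
    using B P that by (auto simp: skew_endos_def symmetric_endos_def endo_on_def)
  show ?thesis
  proof (cases "a = d")
    case True
    have "b (B e + P e) (J a (J d e)) = - b (P e) e" if "e \<in> E" for e
    proof -
      have e: "e \<in> S" using E' that .
      have "b (B e) e = - b e (B e)" using B e by (auto simp: skew_endos_def)
      then have "b (B e) e = 0" using sym[OF Bm[OF e] e] by simp
      then show ?thesis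
        using True ad e Bm[OF e] Pm[OF e] by (simp add: J_sq minus_right add_left mem)
    qed
    then show ?thesis using True by (simp add: sum_negf)
  next
    case False
    obtain k s where k: "k \<in> {1..3}" "\<And>x. x \<in> S \<Longrightarrow> J a (J d x) = s *\<^sub>R J k x"
      using J_product_third[OF ad False] by blast
    have "(\<Sum>e\<in>E. b (P e) (J k e)) = - (\<Sum>e\<in>E. b (J k (P e)) e)"
      unfolding sum_negf[symmetric] using E' Pm J_skew[OF k(1)] by (intro sum.cong) auto
    also have "(\<Sum>e\<in>E. b (J k (P e)) e) = (\<Sum>e\<in>E. b (P (J k e)) e)"
      using P by (intro trace_comm[OF E J_endo[OF k(1)]]) (auto simp: symmetric_endos_def)
    also have "\<dots> = (\<Sum>e\<in>E. b (P e) (J k e))"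
    proof (rule sum.cong[OF refl])
      fix e assume "e \<in> E"
      then have e: "e \<in> S" "J k e \<in> S" "P e \<in> S" using E' J_mem[OF k(1)] Pm by auto
      have "b (P (J k e)) e = b (J k e) (P e)" using P e by (auto simp: symmetric_endos_def)
      then show "b (P (J k e)) e = b (P e) (J k e)" using sym[OF e(2,3)] by simp
    qed
    finally have PJ: "(\<Sum>e\<in>E. b (P e) (J k e)) = 0" by simp
    have "(\<Sum>e\<in>E. b (B e + P e) (J a (J d e))) = (\<Sum>e\<in>E. s * (b (B e) (J k e) + b (P e) (J k e)))"
      using E' Bm Pm J_mem[OF k(1)] k(2)
      by (intro sum.cong) (auto simp: scale_right mem add_left)
    also have "\<dots> = s * ((\<Sum>e\<in>E. b (B e) (J k e)) + (\<Sum>e\<in>E. b (P e) (J k e)))"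
      by (simp only: sum_distrib_left[symmetric] sum.distrib)
    finally show ?thesis using False PJ BJ[OF k(1)] by simp
  qed
qed

text \<open>
  The algebra behind the skew-symmetry of the vertical torsion \<open>\<tau>\<close>. Contracting the hypothesis
  with \<open>J k\<close> over an orthonormal basis leaves \<open>N * (\<tau> k a d + \<tau> k d a)\<close>, where \<open>N\<close> is the dimension,
  and traces of the symmetric parts \<open>P a\<close>. The case \<open>a = d = k\<close> shows that these traces vanish.
\<close>

lemma contraction_skew:
  fixes \<tau> :: "nat \<Rightarrow> nat \<Rightarrow> nat \<Rightarrow> real"
  assumes E: "orthonormal_basis S b E" and S: "S \<noteq> {0}"
    and B: "\<And>a. a \<in> {1..3} \<Longrightarrow> B a \<in> skew_endos S b"
    and P: "\<And>a. a \<in> {1..3} \<Longrightarrow> P a \<in> symmetric_endos S b"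
    and BJ: "\<And>a k. a \<in> {1..3} \<Longrightarrow> k \<in> {1..3} \<Longrightarrow> (\<Sum>e\<in>E. b (B a e) (J k e)) = 0"
    and T: "\<And>a x. a \<in> {1..3} \<Longrightarrow> x \<in> S \<Longrightarrow> T a x = B a x + P a x"
    and \<tau>: "\<And>a. a \<in> {1..3} \<Longrightarrow> \<tau> a a a = 0"
    and identity: "\<And>a d x y. a \<in> {1..3} \<Longrightarrow> d \<in> {1..3} \<Longrightarrow> x \<in> S \<Longrightarrow> y \<in> S \<Longrightarrow>
      (\<Sum>c\<in>{1..3}. (\<tau> c a d + \<tau> c d a) * b (J c x) y) + b (J d (T a x)) y + b (T a y) (J d x)
        + b (J a (T d x)) y + b (T d y) (J a x) = 0"
    and ind: "a \<in> {1..3}" "d \<in> {1..3}" "k \<in> {1..3}"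
  shows "\<tau> k a d + \<tau> k d a = 0"
proof -
  define N where "N = (\<Sum>e\<in>E. b e e)"
  define tr where "tr a = (\<Sum>e\<in>E. b (P a e) e)" for a
  have E': "\<And>e. e \<in> E \<Longrightarrow> e \<in> S" and fE: "finite E" and sE: "span E = S"
    and Eo: "\<And>e. e \<in> E \<Longrightarrow> b e e = 1"
    using E by (auto simp: orthonormal_basis_def span_base)
  have "E \<noteq> {}" using sE S by auto
  then have N: "N > 0" using fE Eo by (simp add: N_def card_gt_0_iff)
  have Bm: "B a x \<in> S" and Pm: "P a x \<in> S" if "a \<in> {1..3}" "x \<in> S" for a x
    using B[OF that(1)] P[OF that(1)] that(2)
    by (auto simp: skew_endos_def symmetric_endos_def endo_on_def)
  then have Tm: "T a x \<in> S" if "a \<in> {1..3}" "x \<in> S" for a x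
    using T[OF that] mem(2) that by simp
  have Tendo: "endo_on S (T a)" if a: "a \<in> {1..3}" for a
  proof -
    have "lin_on S (B a)" "lin_on S (P a)"
      using B[OF a] P[OF a] by (auto simp: skew_endos_def symmetric_endos_def endo_on_def)
    then have "lin_on S (T a)"
      using T[OF a] mem(2,5) by (simp add: lin_on_def scaleR_add_right)
    then show ?thesis using Tm[OF a] by (auto simp: endo_on_def)
  qed
  have tJJ: "(\<Sum>e\<in>E. b (T a e) (J d (J k e))) = (if d = k then - tr a else 0)"
    if "a \<in> {1..3}" "d \<in> {1..3}" "k \<in> {1..3}" for a d k
  proof -
    have "(\<Sum>e\<in>E. b (T a e) (J d (J k e))) = (\<Sum>e\<in>E. b (B a e + P a e) (J d (J k e)))"
      using T[OF that(1)] E' by simp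
    also have "\<dots> = (if d = k then - (\<Sum>e\<in>E. b (P a e) e) else 0)"
      by (intro trace_JJ E B P BJ that)
    finally show ?thesis unfolding tr_def .
  qed
  have s1: "(\<Sum>e\<in>E. b (J d (T a e)) (J k e)) = (if d = k then tr a else 0)"
    if "a \<in> {1..3}" "d \<in> {1..3}" "k \<in> {1..3}" for a d k
  proof -
    have "(\<Sum>e\<in>E. b (J d (T a e)) (J k e)) = - (\<Sum>e\<in>E. b (T a e) (J d (J k e)))"
      unfolding sum_negf[symmetric] using J_skew[OF that(2)] Tm[OF that(1)] J_mem[OF that(3)] E'
      by (intro sum.cong) auto
    then show ?thesis using tJJ[OF that] by simp
  qed
  have s2: "(\<Sum>e\<in>E. b (T a (J k e)) (J d e)) = (if d = k then tr a else 0)"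
    if "a \<in> {1..3}" "d \<in> {1..3}" "k \<in> {1..3}" for a d k
  proof -
    have JJ: "endo_on S (\<lambda>x. J k (J d x))"
      using J_lin[OF that(2)] J_lin[OF that(3)] J_mem[OF that(2)] J_mem[OF that(3)]
      by (auto simp: endo_on_def lin_on_def)
    have TJ: "endo_on S (\<lambda>x. T a (J k x))"
      using Tendo[OF that(1)] J_lin[OF that(3)] J_mem[OF that(3)] Tm[OF that(1)]
      by (auto simp: endo_on_def lin_on_def)
    have "(\<Sum>e\<in>E. b (T a (J k e)) (J d e)) = - (\<Sum>e\<in>E. b (J d (T a (J k e))) e)"
      unfolding sum_negf[symmetric] using J_skew[OF that(2)] Tm[OF that(1)] J_mem[OF that(3)] E'
      by (intro sum.cong) auto
    also have "(\<Sum>e\<in>E. b (J d (T a (J k e))) e) = (\<Sum>e\<in>E. b (T a (J k (J d e))) e)"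
      by (rule trace_comm[OF E J_endo[OF that(2)] TJ])
    also have "\<dots> = (\<Sum>e\<in>E. b (J k (J d (T a e))) e)"
      by (rule trace_comm[OF E Tendo[OF that(1)] JJ])
    also have "\<dots> = (\<Sum>e\<in>E. b (T a e) (J d (J k e)))"
      using J_skew[OF that(2)] J_skew[OF that(3)] Tm[OF that(1)] J_mem[OF that(3)] J_mem[OF that(2)] E'
      by (intro sum.cong) auto
    finally show ?thesis using tJJ[OF that] by simp
  qed
  have key: "N * (\<tau> k a d + \<tau> k d a) + 2 * (if d = k then tr a else 0) + 2 * (if a = k then tr d else 0) = 0"
    if i: "a \<in> {1..3}" "d \<in> {1..3}" "k \<in> {1..3}" for a d k
  proof -
    have 1: "(\<Sum>c\<in>{1..3}. (\<tau> c a d + \<tau> c d a) * b (J c e) (J k e)) = (\<tau> k a d + \<tau> k d a) * b e e"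
      if e: "e \<in> E" for e
    proof -
      have "(\<Sum>c\<in>{1..3}. (\<tau> c a d + \<tau> c d a) * b (J c e) (J k e)) =
          (\<Sum>c\<in>{1..3}. if c = k then (\<tau> c a d + \<tau> c d a) * b e e else 0)"
        using J_orthogonal i(3) E'[OF e] by (intro sum.cong) auto
      then show ?thesis using i(3) by (simp add: sum.delta)
    qed
    have "(\<Sum>e\<in>E. (\<tau> k a d + \<tau> k d a) * b e e + b (J d (T a e)) (J k e) + b (T a (J k e)) (J d e)
        + b (J a (T d e)) (J k e) + b (T d (J k e)) (J a e)) = 0"
    proof (intro sum.neutral ballI)
      fix e assume e: "e \<in> E"
      show "(\<tau> k a d + \<tau> k d a) * b e e + b (J d (T a e)) (J k e) + b (T a (J k e)) (J d e)
        + b (J a (T d e)) (J k e) + b (T d (J k e)) (J a e) = 0"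
        using identity[OF i(1,2) E'[OF e] J_mem[OF i(3) E'[OF e]]] unfolding 1[OF e] .
    qed
    then show ?thesis
      using s1[OF i] s2[OF i] s1[OF i(2,1,3)] s2[OF i(2,1,3)]
      unfolding sum.distrib sum_distrib_left[symmetric] N_def[symmetric] by (simp add: mult.commute)
  qed
  have "tr a = 0" if a: "a \<in> {1..3}" for a
    using key[OF a a a] \<tau>[OF a] by simp
  then show ?thesis using key[OF ind] N ind by (simp split: if_splits)
qed

end


section \<open>Orthonormal coframes\<close>

context qc_geometry
begin

lemma ann_section_nearE:
  assumes "ann_section_near A H p \<Xi>"
  obtains W where "p \<in> W" "open W" "one_form A W \<Xi>" "\<And>q. q \<in> W \<Longrightarrow> \<Xi> q \<in> annihilator A H q"
proof -
  obtain W where "p \<in> W" "one_form A W \<Xi>" "\<forall>q\<in>W. \<Xi> q \<in> annihilator A H q"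
    using assms unfolding ann_section_near_def ann_section_def by (elim exE conjE)
  moreover have "open W" using \<open>one_form A W \<Xi>\<close> unfolding one_form_def by (elim conjE)
  ultimately show ?thesis using that by simp
qed

lemma dsection_nearE:
  assumes "dsection_near A H p X"
  obtains W where "p \<in> W" "open W" "vfield A W X" "\<And>q. q \<in> W \<Longrightarrow> X q \<in> H q"
proof -
  obtain W where "p \<in> W" "vfield A W X" "\<forall>q\<in>W. X q \<in> H q"
    using assms unfolding dsection_near_def dsection_def by (elim exE conjE)
  then show ?thesis by (intro that[of W]) (auto intro: vfield_open)
qed

text \<open>A form vanishing on \<open>H\<close> has the exterior derivative \<open>- \<Xi> [X, Y]\<close> there, and \<open>[X, Y]\<close> is minus the torsion modulo \<open>H\<close>.\<close>

lemma ext_deriv_tors: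
  assumes \<Xi>: "ann_section_near A H p \<Xi>" and X: "dsection_near A H p X" and Y: "dsection_near A H p Y"
  shows "ext_deriv A \<Xi> X Y p = \<Xi> p (tors p (X p) (Y p))"
proof -
  note n = dsection_near_vfield[OF X] dsection_near_vfield[OF Y]
  note t = vfield_near_tangent[OF n(1)] vfield_near_tangent[OF n(2)]
  obtain W where W: "p \<in> W" "open W" "\<And>q. q \<in> W \<Longrightarrow> \<Xi> q \<in> annihilator A H q"
    using ann_section_nearE[OF \<Xi>] by metis
  have zero: "v (\<lambda>q. \<Xi> q (Z q)) = 0" if v: "v \<in> tangent A p" and Z: "dsection_near A H p Z" for v Z
  proof -
    obtain W' where W': "p \<in> W'" "open W'" "\<And>q. q \<in> W' \<Longrightarrow> Z q \<in> H q"
      using dsection_nearE[OF Z] by metis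
    show ?thesis
    proof (rule tangent_locally_const[OF sm v, of "W \<inter> W'"])
      show "\<Xi> q (Z q) = 0" if "q \<in> W \<inter> W'" for q
        using ann_H[OF W(3) W'(3)] that by simp
    qed (use W(1,2) W'(1,2) in auto)
  qed
  have ann: "\<Xi> p \<in> annihilator A H p" using W by blast
  have "bracket A X Y p = D p (X p) Y - D p (Y p) X - tors p (X p) (Y p)"
    using torsion_tors[OF n] by (simp add: torsion_def algebra_simps)
  then have "\<Xi> p (bracket A X Y p) = - \<Xi> p (tors p (X p) (Y p))"
    using lin_on_diff[OF subspace_tangent ann_lin[OF ann] D_tangent[OF n(2) t(1)] D_tangent[OF n(1) t(2)]]
      lin_on_diff[OF subspace_tangent ann_lin[OF ann] subspace_diff[OF subspace_tangent
          D_tangent[OF n(2) t(1)] D_tangent[OF n(1) t(2)]] tors_tangent[OF t]]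
      ann_H[OF ann D_H[OF t(1) Y]] ann_H[OF ann D_H[OF t(2) X]] by simp
  then show ?thesis using zero[OF t(1) Y] zero[OF t(2) X] by (simp add: ext_deriv_def)
qed

lemma ann_comp_lin:
  assumes "\<xi> \<in> annihilator A H p" "x \<in> H p"
  shows "lin_on (H p) (\<lambda>y. \<xi> (tors p x y))"
  using lins[OF tors_lin2[OF H_tangent[OF assms(2)]]] lins[OF ann_lin[OF assms(1)]] H_tangent
    tors_tangent[OF H_tangent[OF assms(2)]]
  by (simp add: lin_on_def)

text \<open>
  The value is determined by its inner products because vectors extend to sections of \<open>H\<close>, and it exists because the
  torsion is a tensor, so that the inner products are a linear functional to which the Riesz lemma applies.
\<close>

lemma Jop_value:
  assumes \<Xi>: "ann_section_near A H p \<Xi>" and eq: "\<And>v. v \<in> tangent A p \<Longrightarrow> \<Xi> p v = \<xi> v"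
    and x: "x \<in> H p"
  shows "Jop A H ip p \<xi> x \<in> H p" "y \<in> H p \<Longrightarrow> ip p (Jop A H ip p \<xi> x) y = \<xi> (tors p x y)"
proof -
  have ann: "\<Xi> p \<in> annihilator A H p" using ann_section_nearE[OF \<Xi>] by metis
  obtain w where w: "w \<in> H p" "\<And>y. y \<in> H p \<Longrightarrow> ip p w y = \<Xi> p (tors p x y)"
    using H.riesz[OF ann_comp_lin[OF ann x]] by blast
  have "Jop A H ip p \<xi> x = w" unfolding Jop_def
  proof (rule the_equality)
    have "ip p w (Y p) = ext_deriv A \<Xi>' X Y p"
      if "ann_section_near A H p \<Xi>'" "\<And>v. v \<in> tangent A p \<Longrightarrow> \<Xi>' p v = \<xi> v"
        "dsection_near A H p X" "X p = x" "dsection_near A H p Y" for \<Xi>' X Y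
      using ext_deriv_tors[OF that(1,3,5)] w(2)[OF dsection_near_at[OF that(5)]] that(2,4) eq
        tors_tangent[OF H_tangent[OF x] H_tangent[OF dsection_near_at[OF that(5)]]] by simp
    then show "w \<in> H p \<and> (\<forall>\<Xi> X Y. ann_section_near A H p \<Xi> \<longrightarrow> (\<forall>v\<in>tangent A p. \<Xi> p v = \<xi> v) \<longrightarrow>
      dsection_near A H p X \<longrightarrow> X p = x \<longrightarrow> dsection_near A H p Y \<longrightarrow>
      ip p w (Y p) = ext_deriv A \<Xi> X Y p)" using w(1) by blast
  next
    fix w' assume w': "w' \<in> H p \<and> (\<forall>\<Xi> X Y. ann_section_near A H p \<Xi> \<longrightarrow> (\<forall>v\<in>tangent A p. \<Xi> p v = \<xi> v) \<longrightarrow>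
      dsection_near A H p X \<longrightarrow> X p = x \<longrightarrow> dsection_near A H p Y \<longrightarrow>
      ip p w' (Y p) = ext_deriv A \<Xi> X Y p)"
    obtain X where X: "dsection_near A H p X" "X p = x" using H_extends[OF x] by blast
    show "w' = w"
    proof (rule H.eqI)
      fix z assume "z \<in> H p"
      then obtain Z where Z: "dsection_near A H p Z" "Z p = z" using H_extends by blast
      have "ip p w' (Z p) = ext_deriv A \<Xi> X Z p"
        using w'[THEN conjunct2, rule_format, OF \<Xi> eq X Z(1)] .
      then show "ip p w' z = ip p w z" using ext_deriv_tors[OF \<Xi> X(1) Z(1)] w(2) X(2) Z \<open>z \<in> H p\<close> by simp
    qed (use w w' in auto)
  qed
  then show "Jop A H ip p \<xi> x \<in> H p" "y \<in> H p \<Longrightarrow> ip p (Jop A H ip p \<xi> x) y = \<xi> (tors p x y)"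
    using w eq[OF tors_tangent[OF H_tangent[OF x] H_tangent]] by auto
qed

lemma coframe_section:
  assumes "qc_coframe A H ip h W \<eta>" "p \<in> W" "a \<in> {1..3}"
  shows "ann_section_near A H p (\<eta> a)"
  using assms unfolding qc_coframe_def ann_section_near_def by blast

lemma coframe_quaternionic:
  assumes c: "qc_coframe A H ip h W \<eta>" "p \<in> W"
  shows "quaternionic_space (H p) (ip p) (\<lambda>a. Jop A H ip p (\<eta> a p))"
proof
  note J = Jop_value[OF coframe_section[OF c] refl]
  fix a :: nat assume a: "a \<in> {1..3}"
  note ann = coframe_annihilator[OF c a]
  fix x assume x: "x \<in> H p"
  show "Jop A H ip p (\<eta> a p) x \<in> H p" using J(1)[OF a x] .
  show "Jop A H ip p (\<eta> a p) (Jop A H ip p (\<eta> a p) x) = - x"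
    using c x a unfolding qc_coframe_def Let_def by blast
  fix y assume y: "y \<in> H p"
  have "\<eta> a p (tors p x y) = - \<eta> a p (tors p y x)"
    using lin_on_minus[OF ann_lin[OF ann] tors_tangent[OF H_tangent[OF y] H_tangent[OF x]]]
      tors_anti[of p x y] by simp
  then show "ip p (Jop A H ip p (\<eta> a p) x) y = - ip p x (Jop A H ip p (\<eta> a p) y)"
    using J(2)[OF a x y] J(2)[OF a y x] H.sym[OF x J(1)[OF a y]] by simp
next
  fix x assume x: "x \<in> H p"
  show "Jop A H ip p (\<eta> 1 p) (Jop A H ip p (\<eta> 2 p) (Jop A H ip p (\<eta> 3 p) x)) = - x"
    using c x unfolding qc_coframe_def Let_def by blast
qed

lemma H_nontrivial: "\<exists>x\<in>H p. x \<noteq> 0"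
proof -
  obtain W E where p: "p \<in> W" and f: "\<forall>q\<in>W. inj_on (\<lambda>i. E i q) {..<h} \<and>
    independent ((\<lambda>i. E i q) ` {..<h}) \<and> span ((\<lambda>i. E i q) ` {..<h}) = H q \<and> H q \<subseteq> tangent A q"
    using distribution_frame[OF H_distribution, of p] by (elim exE conjE)
  have m: "E 0 p \<in> (\<lambda>i. E i p) ` {..<h}" using h by auto
  then have "E 0 p \<noteq> 0" using f p dependent_zero by metis
  moreover have "E 0 p \<in> H p" using span_base[OF m] f p by auto
  ultimately show ?thesis by blast
qed

text \<open>
  For a vector \<open>x\<close> of \<open>H\<close> the vectors \<open>J a x\<close> are orthogonal of the same length, for either coframe.
  Hence the transition matrix is orthogonal.
\<close>

lemma coframes_orthogonal:
  assumes c: "qc_coframe A H ip h W \<eta>" "p \<in> W" and c': "qc_coframe A H ip h W' \<eta>'" "p \<in> W'"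
    and U: "\<And>a b. a \<in> {1..3} \<Longrightarrow> b \<in> {1..3} \<Longrightarrow> \<eta> a p (U b) = (if a = b then 1 else 0)"
      "\<And>b. b \<in> {1..3} \<Longrightarrow> U b \<in> tangent A p"
    and vw: "v \<in> tangent A p" "w \<in> tangent A p"
  shows "(\<Sum>a\<in>{1..3}. \<eta>' a p v * \<eta>' a p w) = (\<Sum>a\<in>{1..3}. \<eta> a p v * \<eta> a p w)"
proof -
  let ?I = "{1..3::nat}"
  interpret J: quaternionic_space "H p" "ip p" "\<lambda>a. Jop A H ip p (\<eta> a p)"
    by (rule coframe_quaternionic[OF c])
  interpret J': quaternionic_space "H p" "ip p" "\<lambda>a. Jop A H ip p (\<eta>' a p)"
    by (rule coframe_quaternionic[OF c'])
  have "\<forall>a\<in>?I. \<exists>m. \<forall>v\<in>tangent A p. \<eta>' a p v = (\<Sum>b\<in>?I. m b * \<eta> b p v)"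
    by (intro ballI coframe_spans[OF c] coframe_annihilator[OF c'])
  from bchoice[OF this] obtain M where M0: "\<forall>a\<in>?I. \<forall>v\<in>tangent A p. \<eta>' a p v = (\<Sum>b\<in>?I. M a b * \<eta> b p v)"
    by (elim exE)
  note M = M0[rule_format]
  have "\<forall>a\<in>?I. \<exists>m. \<forall>v\<in>tangent A p. \<eta> a p v = (\<Sum>b\<in>?I. m b * \<eta>' b p v)"
    by (intro ballI coframe_spans[OF c'] coframe_annihilator[OF c])
  from bchoice[OF this] obtain N where N0: "\<forall>a\<in>?I. \<forall>v\<in>tangent A p. \<eta> a p v = (\<Sum>b\<in>?I. N a b * \<eta>' b p v)"
    by (elim exE)
  note N = N0[rule_format]
  obtain x where x: "x \<in> H p" "x \<noteq> 0" using H_nontrivial by blast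
  let ?J = "\<lambda>a. Jop A H ip p (\<eta> a p) x" and ?J' = "\<lambda>a. Jop A H ip p (\<eta>' a p) x"
  have J': "?J' a = (\<Sum>b\<in>?I. M a b *\<^sub>R ?J b)" if a: "a \<in> ?I" for a
  proof (rule H.eqI)
    show "?J' a \<in> H p" using J'.J_mem[OF a x(1)] .
    show "(\<Sum>b\<in>?I. M a b *\<^sub>R ?J b) \<in> H p" using J.J_mem[OF _ x(1)] by (intro H.mem(5,6)) auto
    fix z assume z: "z \<in> H p"
    have "ip p (?J' a) z = \<eta>' a p (tors p x z)"
      by (rule Jop_value(2)[OF coframe_section[OF c' a] refl x(1) z])
    also have "\<dots> = (\<Sum>b\<in>?I. M a b * \<eta> b p (tors p x z))"
      by (rule M[OF a tors_tangent[OF H_tangent[OF x(1)] H_tangent[OF z]]])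
    also have "\<dots> = (\<Sum>b\<in>?I. ip p (M a b *\<^sub>R ?J b) z)"
    proof (rule sum.cong[OF refl])
      fix b assume b: "b \<in> ?I"
      show "M a b * \<eta> b p (tors p x z) = ip p (M a b *\<^sub>R ?J b) z"
        using Jop_value(2)[OF coframe_section[OF c b] refl x(1) z] H.scale_left[OF z J.J_mem[OF b x(1)]]
        by simp
    qed
    also have "\<dots> = ip p (\<Sum>b\<in>?I. M a b *\<^sub>R ?J b) z"
      using J.J_mem[OF _ x(1)] by (intro H.sum_left[OF z, symmetric] H.mem(5)) auto
    finally show "ip p (?J' a) z = ip p (\<Sum>b\<in>?I. M a b *\<^sub>R ?J b) z" .
  qed
  have MM: "(\<Sum>d\<in>?I. M a d * M b d) = (if a = b then 1 else 0)" if a: "a \<in> ?I" and b: "b \<in> ?I" for a b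
  proof -
    have "ip p (?J' a) (?J' b) = (\<Sum>d\<in>?I. ip p (M a d *\<^sub>R ?J d) (?J' b))"
      unfolding J'[OF a] using J.J_mem[OF _ x(1)] J'.J_mem[OF b x(1)]
      by (intro H.sum_left H.mem(5)) auto
    also have "\<dots> = (\<Sum>d\<in>?I. M a d * M b d * ip p x x)"
    proof (rule sum.cong[OF refl])
      fix d assume d: "d \<in> ?I"
      have "ip p (?J d) (?J' b) = (\<Sum>e\<in>?I. ip p (?J d) (M b e *\<^sub>R ?J e))"
        unfolding J'[OF b] using J.J_mem[OF _ x(1)] d by (intro H.sum_right H.mem(5)) auto
      also have "\<dots> = (\<Sum>e\<in>?I. if d = e then M b e * ip p x x else 0)"
      proof (rule sum.cong[OF refl])
        fix e assume e: "e \<in> ?I"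
        show "ip p (?J d) (M b e *\<^sub>R ?J e) = (if d = e then M b e * ip p x x else 0)"
          using H.scale_right[OF J.J_mem[OF d x(1)] J.J_mem[OF e x(1)]] J.J_orthogonal[OF d e x(1)] by simp
      qed
      also have "\<dots> = M b d * ip p x x" using d by (simp add: sum.delta')
      finally show "ip p (M a d *\<^sub>R ?J d) (?J' b) = M a d * M b d * ip p x x"
        using H.scale_left[OF J'.J_mem[OF b x(1)] J.J_mem[OF d x(1)]] by simp
    qed
    also have "\<dots> = (\<Sum>d\<in>?I. M a d * M b d) * ip p x x" by (simp only: sum_distrib_right)
    finally show ?thesis using J'.J_orthogonal[OF a b x(1)] H.pos[OF x] by (auto split: if_splits)
  qed
  have NM: "(\<Sum>d\<in>?I. N b d * M d e) = (if b = e then 1 else 0)" if b: "b \<in> ?I" and e: "e \<in> ?I" for b e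
  proof -
    have "\<eta>' d p (U e) = M d e" if d: "d \<in> ?I" for d
    proof -
      have "\<eta>' d p (U e) = (\<Sum>c\<in>?I. if c = e then M d c else 0)"
        unfolding M[OF d U(2)[OF e]] using U(1)[OF _ e] by (intro sum.cong) auto
      then show ?thesis using e by (simp add: sum.delta)
    qed
    then show ?thesis using N[OF b U(2)[OF e]] U(1)[OF b e] by simp
  qed
  \<comment> \<open>\<open>N\<close> is a left inverse of the matrix \<open>M\<close> with orthonormal rows, hence its transpose.\<close>
  have NMt: "N b a = M a b" if a: "a \<in> ?I" and b: "b \<in> ?I" for a b
  proof -
    have "N b a = (\<Sum>d\<in>?I. if d = a then N b d else 0)" using a by (simp add: sum.delta)
    also have "\<dots> = (\<Sum>d\<in>?I. N b d * (\<Sum>c\<in>?I. M d c * M a c))"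
      using MM[OF _ a] by (intro sum.cong) auto
    also have "\<dots> = (\<Sum>d\<in>?I. \<Sum>c\<in>?I. N b d * M d c * M a c)"
      by (simp only: sum_distrib_left mult.assoc)
    also have "\<dots> = (\<Sum>c\<in>?I. \<Sum>d\<in>?I. N b d * M d c * M a c)" by (rule sum.swap)
    also have "\<dots> = (\<Sum>c\<in>?I. (\<Sum>d\<in>?I. N b d * M d c) * M a c)" by (simp only: sum_distrib_right)
    also have "\<dots> = (\<Sum>c\<in>?I. if b = c then M a c else 0)"
      using NM[OF b] by (intro sum.cong) auto
    finally show ?thesis using b by (simp add: sum.delta')
  qed
  have "(\<Sum>a\<in>?I. \<eta>' a p v * \<eta>' a p w) = (\<Sum>a\<in>?I. \<Sum>b\<in>?I. M a b * \<eta> b p v * \<eta>' a p w)"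
    using M[OF _ vw(1)] by (intro sum.cong) (auto simp: sum_distrib_right)
  also have "\<dots> = (\<Sum>b\<in>?I. \<Sum>a\<in>?I. M a b * \<eta> b p v * \<eta>' a p w)" by (rule sum.swap)
  also have "\<dots> = (\<Sum>b\<in>?I. \<eta> b p v * (\<Sum>a\<in>?I. N b a * \<eta>' a p w))"
    using NMt by (intro sum.cong) (auto simp: sum_distrib_left intro!: sum.cong)
  also have "\<dots> = (\<Sum>b\<in>?I. \<eta> b p v * \<eta> b p w)"
    using N[OF _ vw(2)] by (intro sum.cong) auto
  finally show ?thesis .
qed

end

locale qc_frame = qc_geometry A H V ip h l D Dl
  for A :: "('m::{second_countable_topology,t2_space}, 'e::euclidean_space) atlas"
    and H V ip h l D Dl +
  fixes W :: "'m set" and \<eta> :: "nat \<Rightarrow> 'm \<Rightarrow> 'm covec" and U :: "nat \<Rightarrow> 'm vf"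
  assumes coframe: "qc_coframe A H ip h W \<eta>" and frame: "dual_frame A V W \<eta> U"
begin

lemma U_field: "a \<in> {1..3} \<Longrightarrow> vfield A W (U a)"
  and U_V: "a \<in> {1..3} \<Longrightarrow> p \<in> W \<Longrightarrow> U a p \<in> V p"
  and U_dual: "a \<in> {1..3} \<Longrightarrow> b \<in> {1..3} \<Longrightarrow> p \<in> W \<Longrightarrow> \<eta> a p (U b p) = (if a = b then 1 else 0)"
  using frame by (auto simp: dual_frame_def dsection_def)

lemma U_section: "a \<in> {1..3} \<Longrightarrow> p \<in> W \<Longrightarrow> dsection_near A V p (U a)"
  using frame by (auto simp: dual_frame_def dsection_near_def)

lemma \<eta>_ann: "a \<in> {1..3} \<Longrightarrow> p \<in> W \<Longrightarrow> \<eta> a p \<in> annihilator A H p"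
  using coframe_annihilator[OF coframe] by blast

lemma W_open: "open W"
  using coframe by (simp add: qc_coframe_def)

text \<open>Orthogonality of the transition matrix frees \<open>qc_metric\<close> from the choice of coframe in its definition.\<close>

lemma vert_\<eta>:
  assumes "p \<in> W" "v \<in> tangent A p" "w \<in> tangent A p"
  shows "vert p v w = (\<Sum>a\<in>{1..3}. \<eta> a p v * \<eta> a p w)"
proof -
  obtain W' \<eta>' where c': "p \<in> W'" "qc_coframe A H ip h W' \<eta>'" "cof p = (\<lambda>a. \<eta>' a p)"
    using cof_coframe by blast
  show ?thesis
    using coframes_orthogonal[OF coframe assms(1) c'(2,1), of "\<lambda>a. U a p" v w] U_dual U_V V_tangent assms c'(3)
    by (simp add: vert_def)
qed

lemma vert_U: "p \<in> W \<Longrightarrow> a \<in> {1..3} \<Longrightarrow> u \<in> tangent A p \<Longrightarrow> vert p u (U a p) = \<eta> a p u"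
proof -
  assume a: "p \<in> W" "a \<in> {1..3}" "u \<in> tangent A p"
  have "vert p u (U a p) = (\<Sum>b\<in>{1..3}. if b = a then \<eta> b p u else 0)"
    unfolding vert_\<eta>[OF a(1,3) V_tangent[OF U_V[OF a(2,1)]]]
    using U_dual[OF _ a(2,1)] by (intro sum.cong) auto
  then show ?thesis using a(2) by (simp add: sum.delta)
qed

lemma vertical_expand:
  assumes p: "p \<in> W" and u: "u \<in> V p"
  shows "u = (\<Sum>c\<in>{1..3}. \<eta> c p u *\<^sub>R U c p)"
proof -
  let ?w = "\<Sum>c\<in>{1..3}. \<eta> c p u *\<^sub>R U c p"
  have w: "?w \<in> V p" using U_V[OF _ p] by (intro subspace_sum subspace_scale V_subspace) auto
  have zero: "\<eta> a p (u - ?w) = 0" if a: "a \<in> {1..3}" for a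
  proof -
    have "\<eta> a p ?w = (\<Sum>c\<in>{1..3}. \<eta> c p u *\<^sub>R \<eta> a p (U c p))"
      using U_V[OF _ p] V_tangent by (intro lin_on_lincomb[OF subspace_tangent ann_lin[OF \<eta>_ann[OF a p]]]) auto
    also have "\<dots> = (\<Sum>c\<in>{1..3}. if a = c then \<eta> c p u else 0)"
      using U_dual[OF a _ p] by (intro sum.cong) auto
    finally show ?thesis
      using a lin_on_diff[OF subspace_tangent ann_lin[OF \<eta>_ann[OF a p]] V_tangent[OF u] V_tangent[OF w]]
      by (simp add: sum.delta')
  qed
  have "u - ?w \<in> V p" by (rule subspace_diff[OF V_subspace(1) u w])
  then have "u - ?w = 0" by (rule coframe_separates[OF coframe p]) (rule zero)
  then show ?thesis by simp
qed

end


section \<open>Smoothness of horizontal fields\<close>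

context qc_geometry
begin

lemma ip_smooth:
  assumes "vfield A W X" "\<And>q. q \<in> W \<Longrightarrow> X q \<in> H q" "vfield A W Y" "\<And>q. q \<in> W \<Longrightarrow> Y q \<in> H q"
  shows "smooth_fun A W (\<lambda>q. ip q (X q) (Y q))"
proof -
  have "\<forall>W X Y. dsection A H W X \<longrightarrow> dsection A H W Y \<longrightarrow> smooth_fun A W (\<lambda>q. ip q (X q) (Y q))"
    using qc[unfolded qc_manifold_def, THEN conjunct1] unfolding sub_riemannian_def by (elim conjE)
  then show ?thesis using assms by (simp add: dsection_def)
qed

text \<open>
  A field in the span of a frame is smooth as soon as its inner products with the frame are.
  Inverting the Gram matrix is avoided by orthogonal projection to the span of all but the last
  frame field: by induction, the projections of the last frame field and of the given field are smooth.
\<close>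

lemma smooth_of_inner_products:
  fixes k :: nat
  assumes "open W" "\<And>i. i < k \<Longrightarrow> vfield A W (E i)" "\<And>i q. i < k \<Longrightarrow> q \<in> W \<Longrightarrow> E i q \<in> H q"
    and "\<And>q. q \<in> W \<Longrightarrow> inj_on (\<lambda>i. E i q) {..<k}"
    and "\<And>q. q \<in> W \<Longrightarrow> independent ((\<lambda>i. E i q) ` {..<k})"
    and "\<And>q. q \<in> W \<Longrightarrow> w q \<in> span ((\<lambda>i. E i q) ` {..<k})"
    and "\<And>i. i < k \<Longrightarrow> smooth_fun A W (\<lambda>q. ip q (w q) (E i q))"
  shows "vfield A W w"
  using assms(2-7)
proof (induction k arbitrary: w)
  case 0
  then have "w q = 0" if "q \<in> W" for q using that by simp
  then show ?case using vfield_cong[OF sm vfield_zero[OF sm assms(1)]] by simp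
next
  case (Suc k)
  let ?S = "\<lambda>q. span ((\<lambda>i. E i q) ` {..<k})"
  have im: "(\<lambda>i. E i q) ` {..<Suc k} = insert (E k q) ((\<lambda>i. E i q) ` {..<k})" for q
    by (simp add: lessThan_Suc)
  have SH: "?S q \<subseteq> H q" if "q \<in> W" for q
    using Suc.prems(2)[OF _ that] by (intro span_minimal H_subspace) auto
  have Ei: "E i q \<in> ?S q" if "i < k" for i q using that by (intro span_base) auto
  have sub: "inner_space (?S q) (ip q)" if q: "q \<in> W" for q
  proof
    show "subspace (?S q)" by (rule subspace_span)
    show "inner_on (?S q) (ip q)"
      using H.inner[of q] SH[OF q] unfolding inner_on_def lin_on_def by (simp add: subset_iff)
    show "\<exists>F. finite F \<and> span F = ?S q" by blast
  qed
  have IH: "vfield A W u" if "\<And>q. q \<in> W \<Longrightarrow> u q \<in> ?S q"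
    "\<And>i. i < k \<Longrightarrow> smooth_fun A W (\<lambda>q. ip q (u q) (E i q))" for u
  proof (rule Suc.IH)
    show "E i q \<in> H q" if "i < k" "q \<in> W" for i q using Suc.prems(2) that by auto
    show "vfield A W (E i)" if "i < k" for i using Suc.prems(1) that by auto
    show "inj_on (\<lambda>i. E i q) {..<k}" if "q \<in> W" for q
      using Suc.prems(3)[OF that] by (rule inj_on_subset) auto
    show "independent ((\<lambda>i. E i q) ` {..<k})" if "q \<in> W" for q
      using Suc.prems(4)[OF that] by (rule independent_mono) auto
  qed (use that in auto)
  define pr where "pr q x = (SOME u. u \<in> ?S q \<and> (\<forall>y\<in>?S q. ip q u y = ip q x y))" for q x
  have pr: "pr q x \<in> ?S q" "y \<in> ?S q \<Longrightarrow> ip q (pr q x) y = ip q x y" if "q \<in> W" "x \<in> H q" for q x y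
  proof -
    have "lin_on (?S q) (ip q x)"
      using H.lin[OF that(2)] SH[OF that(1)] unfolding lin_on_def by (simp add: subset_iff)
    from inner_space.riesz[OF sub[OF that(1)] this]
    have "\<exists>u. u \<in> ?S q \<and> (\<forall>y\<in>?S q. ip q u y = ip q x y)" by blast
    from someI_ex[OF this, folded pr_def]
    show "pr q x \<in> ?S q" "y \<in> ?S q \<Longrightarrow> ip q (pr q x) y = ip q x y" by auto
  qed
  have Ek: "vfield A W (E k)" "\<And>q. q \<in> W \<Longrightarrow> E k q \<in> H q" using Suc.prems(1,2) by auto
  have wH: "w q \<in> H q" if q: "q \<in> W" for q
  proof -
    have "span ((\<lambda>i. E i q) ` {..<Suc k}) \<subseteq> H q"
      using Suc.prems(2)[OF _ q] by (intro span_minimal H_subspace) auto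
    then show ?thesis using Suc.prems(5)[OF q] by auto
  qed
  define e where "e q = pr q (E k q)" for q
  define w0 where "w0 q = pr q (w q)" for q
  define n where "n q = E k q - e q" for q
  have eS: "e q \<in> ?S q" and w0S: "w0 q \<in> ?S q" if "q \<in> W" for q
    unfolding e_def w0_def using pr that Ek wH by auto
  then have eH: "e q \<in> H q" and w0H: "w0 q \<in> H q" if "q \<in> W" for q using SH that by auto
  have eV: "vfield A W e"
  proof (rule IH[OF eS])
    fix i assume i: "i < k"
    show "smooth_fun A W (\<lambda>q. ip q (e q) (E i q))"
      by (rule smooth_fun_cong[OF sm ip_smooth[OF Ek Suc.prems(1,2)]])
        (use i pr(2)[OF _ Ek(2) Ei] in \<open>auto simp: e_def\<close>)
  qed
  have w0V: "vfield A W w0"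
  proof (rule IH[OF w0S])
    fix i assume i: "i < k"
    show "smooth_fun A W (\<lambda>q. ip q (w0 q) (E i q))"
      by (rule smooth_fun_cong[OF sm Suc.prems(6)[of i]])
        (use i pr(2)[OF _ wH Ei] in \<open>auto simp: w0_def\<close>)
  qed
  have nV: "vfield A W n" unfolding n_def by (rule vfield_diff[OF sm Ek(1) eV])
  have nH: "n q \<in> H q" if "q \<in> W" for q
    unfolding n_def using Ek(2) eH that subspace_diff[OF H_subspace(1)] by auto
  have n0: "n q \<noteq> 0" if q: "q \<in> W" for q
  proof
    assume "n q = 0"
    then have "E k q \<in> ?S q" using eS[OF q] by (simp add: n_def)
    moreover have "E k q \<notin> (\<lambda>i. E i q) ` {..<k}"
      using Suc.prems(3)[OF q] by (auto dest: inj_onD)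
    ultimately show False using Suc.prems(4)[OF q] by (simp add: im independent_insert)
  qed
  have orth: "ip q y (n q) = 0" if q: "q \<in> W" and y: "y \<in> ?S q" for q y
  proof -
    have yH: "y \<in> H q" using SH[OF q] y by auto
    then show ?thesis
      using pr(2)[OF q Ek(2)[OF q] y, folded e_def] H.sym[OF yH eH[OF q]] H.sym[OF yH Ek(2)[OF q]]
        H.diff_right[OF yH Ek(2)[OF q] eH[OF q]] by (simp add: n_def)
  qed
  have dec: "w q = w0 q + (ip q (w q) (n q) * inverse (ip q (n q) (n q))) *\<^sub>R n q" if q: "q \<in> W" for q
  proof -
    have "\<exists>c. w q - c *\<^sub>R E k q \<in> ?S q"
      using Suc.prems(5)[OF q] span_breakdown_eq[of "w q" "E k q"] by (simp add: im)
    then obtain c where c: "w q - c *\<^sub>R E k q \<in> ?S q" by blast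
    define z where "z = (w q - c *\<^sub>R E k q) + c *\<^sub>R e q"
    have z: "z \<in> ?S q" unfolding z_def using c eS[OF q] by (intro span_add span_scale)
    have zH: "z \<in> H q" using z SH[OF q] by auto
    have wz: "w q = z + c *\<^sub>R n q" by (simp add: z_def n_def algebra_simps)
    have cn: "c *\<^sub>R n q \<in> H q" using nH[OF q] H.mem(5) by simp
    have "ip q (w q) (n q) = c * ip q (n q) (n q)"
      unfolding wz using orth[OF q z] H.add_left[OF nH[OF q] zH cn] H.scale_left[OF nH[OF q] nH[OF q]] by simp
    then have 1: "c = ip q (w q) (n q) * inverse (ip q (n q) (n q))"
      using H.pos[OF nH[OF q] n0[OF q]] by simp
    have "w0 q = z"
    proof (rule inner_space.eqI[OF sub[OF q] w0S[OF q] z])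
      fix y assume y: "y \<in> ?S q"
      have yH: "y \<in> H q" using SH[OF q] y by auto
      have "ip q (w0 q) y = ip q (w q) y" unfolding w0_def by (rule pr(2)[OF q wH[OF q] y])
      also have "\<dots> = ip q z y"
        unfolding wz using H.add_left[OF yH zH cn] H.scale_left[OF yH nH[OF q]]
          orth[OF q y] H.sym[OF yH nH[OF q]] by simp
      finally show "ip q (w0 q) y = ip q z y" .
    qed
    then show ?thesis using wz 1 by simp
  qed
  have s1: "smooth_fun A W (\<lambda>q. ip q (w q) (n q))"
  proof (rule smooth_fun_cong[OF sm])
    show "smooth_fun A W (\<lambda>q. ip q (w q) (E k q) - ip q (w0 q) (e q))"
      by (intro smooth_fun_diff sm ip_smooth w0V eV w0H eH Suc.prems(6)) auto
    fix q assume q: "q \<in> W"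
    show "ip q (w q) (E k q) - ip q (w0 q) (e q) = ip q (w q) (n q)"
      using pr(2)[OF q wH[OF q] eS[OF q], folded w0_def] H.diff_right[OF wH[OF q] Ek(2)[OF q] eH[OF q]]
      by (simp add: n_def)
  qed
  have s2: "smooth_fun A W (\<lambda>q. inverse (ip q (n q) (n q)))"
  proof (rule smooth_fun_inverse[OF sm ip_smooth[OF nV nH nV nH]])
    show "ip q (n q) (n q) \<noteq> 0" if "q \<in> W" for q using H.pos[OF nH[OF that] n0[OF that]] by simp
  qed
  have "vfield A W (\<lambda>q. w0 q + (ip q (w q) (n q) * inverse (ip q (n q) (n q))) *\<^sub>R n q)"
    by (rule vfield_add[OF w0V vfield_scale[OF sm nV smooth_fun_mult[OF s1 s2]]])
  then show ?case by (rule vfield_cong[OF sm]) (use dec in simp)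
qed

lemma horizontal_smooth:
  assumes W: "open W" "p \<in> W" and w: "\<And>q. q \<in> W \<Longrightarrow> w q \<in> H q"
    and s: "\<And>W' Z. W' \<subseteq> W \<Longrightarrow> vfield A W' Z \<Longrightarrow> (\<And>q. q \<in> W' \<Longrightarrow> Z q \<in> H q) \<Longrightarrow>
      smooth_fun A W' (\<lambda>q. ip q (w q) (Z q))"
  shows "dsection_near A H p w"
proof -
  obtain W0 E where p: "p \<in> W0" "open W0" and v: "\<forall>i<h. vfield A W0 (E i)" and f: "\<forall>q\<in>W0. inj_on (\<lambda>i. E i q) {..<h} \<and>
    independent ((\<lambda>i. E i q) ` {..<h}) \<and> span ((\<lambda>i. E i q) ` {..<h}) = H q \<and> H q \<subseteq> tangent A q"
    using distribution_frame[OF H_distribution, of p] by (elim exE conjE)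
  let ?W = "W \<inter> W0"
  have W': "open ?W" "p \<in> ?W" using W p by auto
  have Ev: "vfield A ?W (E i)" if "i < h" for i
    by (rule vfield_subset[OF v[rule_format, OF that] W'(1)]) simp
  have EH: "E i q \<in> H q" if "i < h" "q \<in> ?W" for i q
  proof -
    have "E i q \<in> span ((\<lambda>i. E i q) ` {..<h})" by (rule span_base) (use that in auto)
    then show ?thesis using f that by simp
  qed
  have "vfield A ?W w"
  proof (rule smooth_of_inner_products[of ?W h E])
    show "smooth_fun A ?W (\<lambda>q. ip q (w q) (E i q))" if "i < h" for i
      by (rule s[OF _ Ev[OF that] EH[OF that]]) auto
  qed (use W' f w Ev EH in auto)
  then show ?thesis unfolding dsection_near_def dsection_def using W' w by blast
qed

section \<open>The first Bianchi identity\<close>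

lemma tors_vfield:
  assumes "vfield A W X" "vfield A W Y"
  shows "vfield A W (\<lambda>q. tors q (X q) (Y q))"
proof (rule vfield_cong[OF sm])
  show "vfield A W (\<lambda>q. D q (X q) Y - D q (Y q) X - bracket A X Y q)"
    by (intro vfield_diff[OF sm] connection_vfield[OF D_conn sm] bracket_vfield assms)
  show "D q (X q) Y - D q (Y q) X - bracket A X Y q = tors q (X q) (Y q)" if "q \<in> W" for q
    by (rule torsion_tors[unfolded torsion_def]) (use assms that in \<open>auto simp: vfield_near_def\<close>)
qed

text \<open>The curvature \<open>R(X,Y)Z\<close> of the Biquard connection.\<close>

definition curv :: "'m vf \<Rightarrow> 'm vf \<Rightarrow> 'm vf \<Rightarrow> 'm \<Rightarrow> 'm tvec" where
  "curv X Y Z p = D p (X p) (\<lambda>q. D q (Y q) Z) - D p (Y p) (\<lambda>q. D q (X q) Z) - D p (bracket A X Y p) Z"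

text \<open>
  In the cyclic sum of the curvature, the derivatives of two fields combine to a bracket and a torsion
  term. Applying torsion once more to the brackets leaves double brackets, which cancel by the Jacobi identity.
\<close>

lemma bianchi:
  assumes p: "p \<in> W" and v: "vfield A W X" "vfield A W Y" "vfield A W Z"
  shows "curv X Y Z p + curv Y Z X p + curv Z X Y p =
    (tors p (X p) (bracket A Y Z p) + D p (X p) (\<lambda>q. tors q (Y q) (Z q)))
    + (tors p (Y p) (bracket A Z X p) + D p (Y p) (\<lambda>q. tors q (Z q) (X q)))
    + (tors p (Z p) (bracket A X Y p) + D p (Z p) (\<lambda>q. tors q (X q) (Y q)))"
proof -
  have near: "vfield_near A p X" if "vfield A W X" for X using that p by (auto simp: vfield_near_def)
  have step: "D p (P p) (\<lambda>q. D q (Q q) R) - D p (P p) (\<lambda>q. D q (R q) Q) - D p (bracket A Q R p) P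
      = tors p (P p) (bracket A Q R p) + D p (P p) (\<lambda>q. tors q (Q q) (R q)) + bracket A P (bracket A Q R) p"
    if P: "vfield A W P" and Q: "vfield A W Q" and R: "vfield A W R" for P Q R
  proof -
    have Pp: "P p \<in> tangent A p" by (rule vfield_tangent[OF P p])
    note fields = connection_vfield[OF D_conn sm Q R] connection_vfield[OF D_conn sm R Q]
      bracket_vfield[OF Q R] tors_vfield[OF Q R]
    have "D p (P p) (\<lambda>q. D q (Q q) R - D q (R q) Q)
        = D p (P p) (\<lambda>q. bracket A Q R q + tors q (Q q) (R q))"
    proof (rule connection_local[OF D_conn sm Pp _ vfield_open[OF P] p])
      show "vfield_near A p (\<lambda>q. D q (Q q) R - D q (R q) Q)"
        by (intro near vfield_diff[OF sm] fields)
      fix q assume q: "q \<in> W"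
      have "tors q (Q q) (R q) = D q (Q q) R - D q (R q) Q - bracket A Q R q"
        by (rule torsion_tors[unfolded torsion_def, symmetric]) (use Q R q in \<open>auto simp: vfield_near_def\<close>)
      then show "D q (Q q) R - D q (R q) Q = bracket A Q R q + tors q (Q q) (R q)" by simp
    qed
    moreover have "D p (P p) (bracket A Q R) = tors p (P p) (bracket A Q R p)
        + D p (bracket A Q R p) P + bracket A P (bracket A Q R) p"
      unfolding torsion_tors[OF near[OF P] near[OF fields(3)], symmetric] torsion_def by simp
    ultimately show ?thesis
      using connection_diff[OF D_conn sm Pp near[OF fields(1)] near[OF fields(2)]]
        connection_add[OF D_conn sm Pp near[OF fields(3)] near[OF fields(4)]] by simp
  qed
  have J: "bracket A X (bracket A Y Z) p + bracket A Y (bracket A Z X) p + bracket A Z (bracket A X Y) p = 0"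
    by (intro bracket_jacobi[OF sm p] v bracket_vfield)
  have "curv X Y Z p + curv Y Z X p + curv Z X Y p =
      (D p (X p) (\<lambda>q. D q (Y q) Z) - D p (X p) (\<lambda>q. D q (Z q) Y) - D p (bracket A Y Z p) X)
    + (D p (Y p) (\<lambda>q. D q (Z q) X) - D p (Y p) (\<lambda>q. D q (X q) Z) - D p (bracket A Z X p) Y)
    + (D p (Z p) (\<lambda>q. D q (X q) Y) - D p (Z p) (\<lambda>q. D q (Y q) X) - D p (bracket A X Y p) Z)"
    by (simp add: curv_def algebra_simps)
  moreover have "bracket A Z (bracket A X Y) p = - (bracket A X (bracket A Y Z) p + bracket A Y (bracket A Z X) p)"
    using J by (simp add: add_eq_0_iff2 add.commute)
  ultimately show ?thesis
    unfolding step[OF v] step[OF v(2,3,1)] step[OF v(3,1,2)] by simp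
qed

end


section \<open>Curvature of the vertical bundle\<close>

context qc_geometry
begin

lemma one_formD:
  assumes "one_form A W \<xi>"
  shows "open W" "q \<in> W \<Longrightarrow> lin_on (tangent A q) (\<xi> q)"
    "W' \<subseteq> W \<Longrightarrow> vfield A W' X \<Longrightarrow> smooth_fun A W' (\<lambda>q. \<xi> q (X q))"
proof -
  note o = assms[unfolded one_form_def]
  show "open W" by (rule o[THEN conjunct1])
  show "q \<in> W \<Longrightarrow> lin_on (tangent A q) (\<xi> q)" by (rule o[THEN conjunct2, THEN conjunct1, THEN bspec])
  show "W' \<subseteq> W \<Longrightarrow> vfield A W' X \<Longrightarrow> smooth_fun A W' (\<lambda>q. \<xi> q (X q))"
    by (rule o[THEN conjunct2, THEN conjunct2, THEN spec, THEN spec, THEN mp, THEN mp])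
qed

lemma coframe_one_form: "qc_coframe A H ip h W \<eta> \<Longrightarrow> a \<in> {1..3} \<Longrightarrow> one_form A W (\<eta> a)"
  by (simp add: qc_coframe_def ann_section_def)

lemma coframe_lincomb_section:
  assumes c: "qc_coframe A H ip h W \<eta>" "p \<in> W"
  shows "ann_section_near A H p (\<lambda>q z. \<Sum>a\<in>{1..3}. r a * \<eta> a q z)"
proof -
  have W: "open W" using c by (simp add: qc_coframe_def)
  note f = one_formD[OF coframe_one_form[OF c(1)]]
  have lin: "lin_on (tangent A q) (\<lambda>z. \<Sum>a\<in>{1..3}. r a * \<eta> a q z)" if q: "q \<in> W" for q
  proof -
    note L = lins[OF f(2)[OF _ q]]
    show ?thesis unfolding lin_on_def
    proof (intro conjI ballI allI)
      fix x y assume "x \<in> tangent A q" "y \<in> tangent A q"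
      then have "r a * \<eta> a q (x + y) = r a * \<eta> a q x + r a * \<eta> a q y" if "a \<in> {1..3}" for a
        using L(1)[OF that] by (simp add: algebra_simps)
      then show "(\<Sum>a\<in>{1..3}. r a * \<eta> a q (x + y)) = (\<Sum>a\<in>{1..3}. r a * \<eta> a q x) + (\<Sum>a\<in>{1..3}. r a * \<eta> a q y)"
        by (simp flip: sum.distrib)
    next
      fix t x assume "x \<in> tangent A q"
      then have eq: "r a * \<eta> a q (t *\<^sub>R x) = t * (r a * \<eta> a q x)" if "a \<in> {1..3}" for a
        using L(2)[OF that] by simp
      then show "(\<Sum>a\<in>{1..3}. r a * \<eta> a q (t *\<^sub>R x)) = t *\<^sub>R (\<Sum>a\<in>{1..3}. r a * \<eta> a q x)"
        unfolding real_scaleR_def sum_distrib_left by (intro sum.cong refl eq)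
    qed
  qed
  have "one_form A W (\<lambda>q z. \<Sum>a\<in>{1..3}. r a * \<eta> a q z)"
    unfolding one_form_def
  proof (intro conjI ballI allI impI)
    fix W' X assume W': "W' \<subseteq> W" "vfield A W' X"
    show "smooth_fun A W' (\<lambda>q. \<Sum>a\<in>{1..3}. r a * \<eta> a q (X q))"
      by (intro smooth_fun_sum smooth_fun_cmult sm vfield_open[OF W'(2)] f(3)[OF _ W'])
  qed (use W lin in auto)
  moreover have "(\<lambda>z. \<Sum>a\<in>{1..3}. r a * \<eta> a q z) \<in> annihilator A H q" if "q \<in> W" for q
    using lin[OF that] ann_H[OF coframe_annihilator[OF c(1) that]] unfolding annihilator_def by simp
  ultimately show ?thesis unfolding ann_section_near_def ann_section_def using c(2) by blast
qed

text \<open>A covector in the annihilator extends with constant coefficients in a local coframe.\<close>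

lemma Jop_linear_value:
  assumes \<xi>: "\<xi> \<in> annihilator A H p" and x: "x \<in> H p"
  shows "Jop A H ip p \<xi> x \<in> H p" "y \<in> H p \<Longrightarrow> ip p (Jop A H ip p \<xi> x) y = \<xi> (tors p x y)"
proof -
  obtain W \<eta> where W: "p \<in> W" "qc_coframe A H ip h W \<eta>" using cof_coframe by blast
  obtain r where r: "\<forall>v\<in>tangent A p. \<xi> v = (\<Sum>a\<in>{1..3}. r a * \<eta> a p v)"
    using coframe_spans[OF W(2,1) \<xi>] by blast
  note J = Jop_value[OF coframe_lincomb_section[OF W(2,1), of r] r[rule_format, symmetric] x]
  show "Jop A H ip p \<xi> x \<in> H p" "y \<in> H p \<Longrightarrow> ip p (Jop A H ip p \<xi> x) y = \<xi> (tors p x y)"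
    using J by auto
qed

lemma sp1_subset_t_alg:
  assumes "\<xi> \<in> annihilator A H p"
  shows "Jop A H ip p \<xi> \<in> t_alg A H ip p"
proof -
  have "Jop A H ip p \<zeta> 0 = 0" if z: "\<zeta> \<in> annihilator A H p" for \<zeta>
  proof (rule H.eqI)
    fix y assume y: "y \<in> H p"
    have "tors p 0 y = 0" using lin_on_zero[OF tors_lin1[OF H_tangent[OF y]] zeros(3)] .
    then show "ip p (Jop A H ip p \<zeta> 0) y = ip p 0 y"
      using Jop_linear_value(2)[OF z zeros(1) y] H.zero_left[OF y] lin_on_zero[OF ann_lin[OF z] zeros(3)] by simp
  qed (use Jop_linear_value(1)[OF z zeros(1)] zeros(1) in auto)
  then have 1: "\<forall>J\<in>sp1 A H ip p. \<forall>x\<in>H p. (0::'m endo) (J x) = J ((0::'m endo) x)"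
    by (auto simp: sp1_def)
  have 2: "(0::'m endo) \<in> skew_endos (H p) (ip p)"
    using zeros(1) H.zero_left H.zero_right by (auto simp: skew_endos_def endo_on_def lin_on_def)
  have "Jop A H ip p \<xi> = Jop A H ip p \<xi> + 0" "Jop A H ip p \<xi> \<in> sp1 A H ip p"
    using assms by (auto simp: sp1_def)
  then show ?thesis unfolding t_alg_def using 1 2 by blast
qed

end

context qc_frame
begin

abbreviation J :: "nat \<Rightarrow> 'm \<Rightarrow> 'm endo" where
  "J a q \<equiv> Jop A H ip q (\<eta> a q)"

lemma J_quaternionic: "p \<in> W \<Longrightarrow> quaternionic_space (H p) (ip p) (\<lambda>a. J a p)"
  by (rule coframe_quaternionic[OF coframe])

lemma J_value:
  assumes "p \<in> W" "a \<in> {1..3}" "x \<in> H p"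
  shows "J a p x \<in> H p" "y \<in> H p \<Longrightarrow> ip p (J a p x) y = \<eta> a p (tors p x y)"
  using Jop_linear_value[OF \<eta>_ann[OF assms(2,1)] assms(3)] by auto

lemma near: "p \<in> W \<Longrightarrow> vfield A W X \<Longrightarrow> vfield_near A p X"
  unfolding vfield_near_def by blast

lemma hnear: "p \<in> W \<Longrightarrow> vfield A W X \<Longrightarrow> (\<And>q. q \<in> W \<Longrightarrow> X q \<in> H q) \<Longrightarrow> dsection_near A H p X"
  unfolding dsection_near_def dsection_def by blast

text \<open>The inner products of \<open>J a X\<close> with sections of \<open>H\<close> are components of the torsion, hence smooth.\<close>

lemma J_section:
  assumes p: "p \<in> W" and a: "a \<in> {1..3}" and X: "vfield A W X" "\<And>q. q \<in> W \<Longrightarrow> X q \<in> H q"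
  shows "dsection_near A H p (\<lambda>q. J a q (X q))"
proof (rule horizontal_smooth[OF W_open p])
  show "J a q (X q) \<in> H q" if "q \<in> W" for q using J_value(1)[OF that a X(2)[OF that]] .
  fix W' Z assume W': "W' \<subseteq> W" and Z: "vfield A W' Z" and ZH: "\<And>q. q \<in> W' \<Longrightarrow> Z q \<in> H q"
  have X': "vfield A W' X" by (rule vfield_subset[OF X(1) vfield_open[OF Z] W'])
  show "smooth_fun A W' (\<lambda>q. ip q (J a q (X q)) (Z q))"
  proof (rule smooth_fun_cong[OF sm])
    show "smooth_fun A W' (\<lambda>q. \<eta> a q (tors q (X q) (Z q)))"
      by (rule one_formD(3)[OF coframe_one_form[OF coframe a] W' tors_vfield[OF X' Z]])
    show "\<eta> a q (tors q (X q) (Z q)) = ip q (J a q (X q)) (Z q)" if "q \<in> W'" for q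
      using J_value(2)[OF _ a X(2) ZH] that W' by auto
  qed
qed

lemma qc_metric_V:
  assumes "z \<in> tangent A p" "u \<in> V p"
  shows "qc_metric A H ip h V p z u = vert p z u"
proof -
  obtain x w where xw: "z = x + w" "x \<in> H p" "w \<in> V p" using splitE[OF assms(1)] .
  have "vert p (x + w) u = vert p w u"
    unfolding vert_def using ann_split[OF cof_annihilator xw(2,3)] by (intro sum.cong) auto
  then show ?thesis
    using qc_metric_split[OF xw(2,3) zeros(1) assms(2)] H.zero_right[OF xw(2)] xw(1) by simp
qed

lemma vert_sym: "vert p u w = vert p w u"
  by (simp add: vert_def mult.commute)

text \<open>Since \<open>\<eta> a\<close> is the inner product with \<open>U a\<close>, its covariant derivative is that with the derivative of \<open>U a\<close>.\<close>

lemma derivative_\<eta>: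
  assumes p: "p \<in> W" and a: "a \<in> {1..3}" and v: "v \<in> tangent A p" and Z: "vfield_near A p Z"
  shows "v (\<lambda>q. \<eta> a q (Z q)) = \<eta> a p (D p v Z) + vert p (Z p) (D p v (U a))"
proof -
  obtain W' where W': "p \<in> W'" "vfield A W' Z" using Z unfolding vfield_near_def by (elim exE conjE)
  note c = common_domain[OF U_field[OF a] p W'(2,1)]
  have "v (\<lambda>q. \<eta> a q (Z q)) = v (\<lambda>q. qc_metric A H ip h V q (Z q) (U a q))"
  proof (rule tangentD(2)[OF v c(2,1)])
    fix q assume q: "q \<in> W \<inter> W'"
    then have "Z q \<in> tangent A q" using vfield_tangent[OF W'(2)] by auto
    then show "\<eta> a q (Z q) = qc_metric A H ip h V q (Z q) (U a q)"
      using qc_metric_V[of "Z q" q "U a q"] U_V[OF a] vert_U[OF _ a] q by simp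
  qed
  also have "\<dots> = qc_metric A H ip h V p (D p v Z) (U a p) + qc_metric A H ip h V p (Z p) (D p v (U a))"
    by (rule D_g[OF v Z near[OF p U_field[OF a]]])
  also have "\<dots> = \<eta> a p (D p v Z) + vert p (Z p) (D p v (U a))"
    using qc_metric_V[OF D_tangent[OF Z v] U_V[OF a p]] vert_U[OF p a D_tangent[OF Z v]]
      qc_metric_V[OF vfield_near_tangent[OF Z] D_V[OF v U_section[OF a p]]] by simp
  finally show ?thesis .
qed

lemma connection_matrix_skew:
  assumes p: "p \<in> W" and a: "a \<in> {1..3}" and b: "b \<in> {1..3}" and v: "v \<in> tangent A p"
  shows "\<eta> b p (D p v (U a)) = - \<eta> a p (D p v (U b))"
proof -
  have "v (\<lambda>q. \<eta> a q (U b q)) = 0"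
    by (rule tangent_locally_const[OF sm v W_open p]) (use U_dual[OF a b] in auto)
  moreover have "vert p (U b p) (D p v (U a)) = \<eta> b p (D p v (U a))"
    using vert_U[OF p b D_tangent[OF near[OF p U_field[OF a]] v]] by (simp add: vert_sym)
  ultimately show ?thesis
    using derivative_\<eta>[OF p a v near[OF p U_field[OF b]]] by simp
qed

lemma dual_conn_\<eta>:
  assumes p: "p \<in> W" and a: "a \<in> {1..3}" and v: "v \<in> tangent A p" and z: "z \<in> tangent A p"
  shows "dual_conn A D p v (\<eta> a) z = vert p z (D p v (U a))"
  unfolding dual_conn_def
proof (rule the_equality)
  show "\<forall>Z. vfield_near A p Z \<longrightarrow> Z p = z \<longrightarrow>
      vert p z (D p v (U a)) = v (\<lambda>q. \<eta> a q (Z q)) - \<eta> a p (D p v Z)"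
    using derivative_\<eta>[OF p a v] by simp
  fix r assume r: "\<forall>Z. vfield_near A p Z \<longrightarrow> Z p = z \<longrightarrow> r = v (\<lambda>q. \<eta> a q (Z q)) - \<eta> a p (D p v Z)"
  obtain Z where Z: "vfield_near A p Z" "Z p = z" using tangent_extends[OF z] by blast
  show "r = vert p z (D p v (U a))" using r[rule_format, OF Z] derivative_\<eta>[OF p a v Z(1)] Z(2) by simp
qed

text \<open>On \<open>H\<close> the torsion is \<open>J\<close> in disguise, so it is parallel because \<open>J\<close> and the metric are.\<close>

lemma tors_parallel:
  assumes p: "p \<in> W" and a: "a \<in> {1..3}" and v: "v \<in> tangent A p"
    and X: "vfield A W X" "\<And>q. q \<in> W \<Longrightarrow> X q \<in> H q" and Y: "vfield A W Y" "\<And>q. q \<in> W \<Longrightarrow> Y q \<in> H q"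
  shows "\<eta> a p (D p v (\<lambda>q. tors q (X q) (Y q)))
    = \<eta> a p (tors p (D p v X) (Y p)) + \<eta> a p (tors p (X p) (D p v Y))"
proof -
  let ?f = "\<lambda>q. \<eta> a q (tors q (X q) (Y q))"
  note JX = J_section[OF p a X]
  note hX = hnear[OF p X] and hY = hnear[OF p Y]
  note Xp = X(2)[OF p] and Yp = Y(2)[OF p] and DX = D_H[OF v hX] and DY = D_H[OF v hY]
  have g: "qc_metric A H ip h V p x y = ip p x y" if "x \<in> H p" "y \<in> H p" for x y p
    using qc_metric_split[OF that(1) zeros(2) that(2) zeros(2)] vert_H(1)[OF zeros(1)] by simp
  let ?d = "dual_conn A D p v (\<eta> a)"
  have tF: "vfield_near A p (\<lambda>q. tors q (X q) (Y q))" by (rule near[OF p tors_vfield[OF X(1) Y(1)]])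
  have txy: "tors p (X p) (Y p) \<in> tangent A p" using vfield_near_tangent[OF tF] .
  have "v ?f = v (\<lambda>q. qc_metric A H ip h V q (J a q (X q)) (Y q))"
  proof (rule tangentD(2)[OF v W_open p])
    fix q assume q: "q \<in> W"
    show "?f q = qc_metric A H ip h V q (J a q (X q)) (Y q)"
      using J_value[OF q a X(2)[OF q]] g[of _ q] Y(2)[OF q] by simp
  qed
  also have "\<dots> = ip p (D p v (\<lambda>q. J a q (X q))) (Y p) + ip p (J a p (X p)) (D p v Y)"
    using D_g[OF v dsection_near_vfield[OF JX] near[OF p Y(1)]] g[OF D_H[OF v JX] Yp]
      g[OF J_value(1)[OF p a Xp] DY] by simp
  also have "D p v (\<lambda>q. J a q (X q)) = Jop A H ip p ?d (X p) + J a p (D p v X)"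
    using biquard_parts(5)[unfolded parallel_J_def, rule_format, OF v coframe_section[OF coframe p a] hX] .
  finally have 1: "v ?f = ip p (Jop A H ip p ?d (X p) + J a p (D p v X)) (Y p) + ip p (J a p (X p)) (D p v Y)" .
  have d: "(\<Sum>c\<in>{1..3}. \<eta> c p (D p v (U a)) * \<eta> c p z) = ?d z" if z: "z \<in> tangent A p" for z
    using dual_conn_\<eta>[OF p a v z] vert_\<eta>[OF p z D_tangent[OF near[OF p U_field[OF a]] v]]
    by (simp add: mult.commute)
  note \<Xi> = coframe_lincomb_section[OF coframe p, of "\<lambda>c. \<eta> c p (D p v (U a))"]
  have Jd: "Jop A H ip p ?d (X p) \<in> H p"
    "y \<in> H p \<Longrightarrow> ip p (Jop A H ip p ?d (X p)) y = ?d (tors p (X p) y)" for y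
    by (rule Jop_value(1)[OF \<Xi> d Xp], assumption) (rule Jop_value(2)[OF \<Xi> d Xp], assumption+)
  have "ip p (Jop A H ip p ?d (X p)) (Y p) = ?d (tors p (X p) (Y p))" using Jd(2)[OF Yp] by simp
  also have "\<dots> = v ?f - \<eta> a p (D p v (\<lambda>q. tors q (X q) (Y q)))"
    using dual_conn_\<eta>[OF p a v txy] derivative_\<eta>[OF p a v tF] by simp
  finally have 2: "ip p (Jop A H ip p ?d (X p)) (Y p) = v ?f - \<eta> a p (D p v (\<lambda>q. tors q (X q) (Y q)))" .
  show ?thesis
    using 1 2 H.add_left[OF Yp Jd(1) J_value(1)[OF p a DX]] J_value(2)[OF p a DX Yp]
      J_value(2)[OF p a Xp DY] by simp
qed

lemma \<eta>_lin: "p \<in> W \<Longrightarrow> a \<in> {1..3} \<Longrightarrow> lin_on (tangent A p) (\<eta> a p)"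
  using ann_lin[OF \<eta>_ann] by blast

text \<open>
  The connection matrix of the orthonormal frame \<open>U\<close> is skew, and hence so is its curvature: the quadratic
  terms left by differentiating twice are symmetric in \<open>X\<close> and \<open>Y\<close>.
\<close>

lemma curv_\<eta>_skew:
  assumes p: "p \<in> W" and a: "a \<in> {1..3}" and b: "b \<in> {1..3}" and X: "vfield A W X" and Y: "vfield A W Y"
  shows "\<eta> b p (curv X Y (U a) p) = - \<eta> a p (curv X Y (U b) p)"
proof -
  note t = vfield_tangent[OF X p] vfield_tangent[OF Y p] bracket_tangent[OF near[OF p X] near[OF p Y]]
  have dd: "\<eta> b p (D p v (\<lambda>q. D q (Z q) (U a))) + \<eta> a p (D p v (\<lambda>q. D q (Z q) (U b)))
      = - vert p (D p (Z p) (U a)) (D p v (U b)) - vert p (D p (Z p) (U b)) (D p v (U a))"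
    if v: "v \<in> tangent A p" and Z: "vfield A W Z" for v Z
  proof -
    note f = near[OF p connection_vfield[OF D_conn sm Z U_field]]
    have "v (\<lambda>q. \<eta> b q (D q (Z q) (U a))) = v (\<lambda>q. (-1) * \<eta> a q (D q (Z q) (U b)))"
      by (rule tangentD(2)[OF v W_open p])
        (use connection_matrix_skew[OF _ a b vfield_tangent[OF Z]] in auto)
    then have "v (\<lambda>q. \<eta> b q (D q (Z q) (U a))) = - v (\<lambda>q. \<eta> a q (D q (Z q) (U b)))"
      using tangent_cmult[OF sm v, of "-1"] by simp
    then show ?thesis
      using derivative_\<eta>[OF p b v f[OF a]] derivative_\<eta>[OF p a v f[OF b]] by simp
  qed
  have e: "\<eta> c p (curv X Y (U d) p) = \<eta> c p (D p (X p) (\<lambda>q. D q (Y q) (U d)))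
      - \<eta> c p (D p (Y p) (\<lambda>q. D q (X q) (U d))) - \<eta> c p (D p (bracket A X Y p) (U d))"
    if c: "c \<in> {1..3}" and d: "d \<in> {1..3}" for c d
  proof -
    note m = D_tangent[OF near[OF p connection_vfield[OF D_conn sm Y U_field[OF d]]] t(1)]
      D_tangent[OF near[OF p connection_vfield[OF D_conn sm X U_field[OF d]]] t(2)]
      D_tangent[OF near[OF p U_field[OF d]] t(3)]
    show ?thesis unfolding curv_def
      using lin_on_diff[OF subspace_tangent \<eta>_lin[OF p c] subspace_diff[OF subspace_tangent m(1,2)] m(3)]
        lin_on_diff[OF subspace_tangent \<eta>_lin[OF p c] m(1,2)] by simp
  qed
  show ?thesis
    using e[OF b a] e[OF a b] dd[OF t(1) Y] dd[OF t(2) X] connection_matrix_skew[OF p a b t(3)]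
    by (simp add: vert_sym)
qed

text \<open>
  The other two curvature terms of the Bianchi identity are horizontal; among the remaining terms,
  the derivatives of \<open>X\<close> and \<open>Y\<close> cancel because the torsion on \<open>H\<close> is parallel.
\<close>

lemma curv_\<eta>_torsion:
  assumes p: "p \<in> W" and a: "a \<in> {1..3}" and b: "b \<in> {1..3}"
    and X: "vfield A W X" "\<And>q. q \<in> W \<Longrightarrow> X q \<in> H q" and Y: "vfield A W Y" "\<And>q. q \<in> W \<Longrightarrow> Y q \<in> H q"
  shows "\<eta> b p (curv X Y (U a) p) =
    (\<Sum>c\<in>{1..3}. \<eta> b p (tors p (U c p) (U a p)) * ip p (J c p (X p)) (Y p))
    + ip p (J b p (tors p (U a p) (X p))) (Y p) + ip p (tors p (U a p) (Y p)) (J b p (X p))"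
proof -
  let ?e = "\<eta> b p" and ?x = "X p" and ?y = "Y p" and ?u = "U a p"
  note U = U_field[OF a]
  note n = near[OF p X(1)] near[OF p Y(1)] near[OF p U]
  note hX = hnear[OF p X] and hY = hnear[OF p Y] and sU = U_section[OF a p]
  note xH = X(2)[OF p] and yH = Y(2)[OF p] and uV = U_V[OF a p]
  note t = H_tangent[OF xH] H_tangent[OF yH] V_tangent[OF uV]
  have add: "?e (v + w) = ?e v + ?e w" if "v \<in> tangent A p" "w \<in> tangent A p" for v w
    using lins(1)[OF \<eta>_lin[OF p b] that] .
  have sub: "?e (v - w) = ?e v - ?e w" if "v \<in> tangent A p" "w \<in> tangent A p" for v w
    using lin_on_diff[OF subspace_tangent \<eta>_lin[OF p b] that] .
  have z: "?e v = 0" if "v \<in> H p" for v using ann_H[OF \<eta>_ann[OF b p] that] .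
  have DH: "dsection_near A H p (\<lambda>q. D q (P q) Q)" if "vfield A W P" "vfield A W Q" "\<And>q. q \<in> W \<Longrightarrow> Q q \<in> H q" for P Q
    by (rule hnear[OF p connection_vfield[OF D_conn sm that(1,2)]])
      (use D_H[OF vfield_tangent[OF that(1)] hnear[OF _ that(2,3)]] in blast)
  have curvH: "curv P Q R p \<in> H p" if "vfield A W P" "vfield A W Q" "vfield A W R" "\<And>q. q \<in> W \<Longrightarrow> R q \<in> H q" for P Q R
    unfolding curv_def
    using D_H[OF vfield_tangent[OF that(1) p] DH[OF that(2,3,4)]]
      D_H[OF vfield_tangent[OF that(2) p] DH[OF that(1,3,4)]]
      D_H[OF bracket_tangent[OF near[OF p that(1)] near[OF p that(2)]] hnear[OF p that(3,4)]]
    by (intro H.mem(3))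
  have tH: "dsection_near A H p (\<lambda>q. tors q (P q) (Q q))"
    if "vfield A W P" "vfield A W Q" "\<And>q. q \<in> W \<Longrightarrow> tors q (P q) (Q q) \<in> H q" for P Q
    by (rule hnear[OF p tors_vfield[OF that(1,2)] that(3)])
  have br: "bracket A P Q p = D p (P p) Q - D p (Q p) P - tors p (P p) (Q p)"
    if "vfield A W P" "vfield A W Q" for P Q
    using torsion_tors[OF near[OF p that(1)] near[OF p that(2)], unfolded torsion_def] by (simp add: algebra_simps)
  \<comment> \<open>the two curvatures applied to horizontal fields do not contribute to the vertical component\<close>
  have c: "curv Y (U a) X p \<in> H p" "curv (U a) X Y p \<in> H p"
    by (rule curvH[OF Y(1) U X(1)], erule X(2)) (rule curvH[OF U X(1) Y(1)], erule Y(2))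
  have ct: "curv X Y (U a) p \<in> tangent A p"
    unfolding curv_def
    using D_tangent[OF near[OF p connection_vfield[OF D_conn sm Y(1) U]] t(1)]
      D_tangent[OF near[OF p connection_vfield[OF D_conn sm X(1) U]] t(2)]
      D_tangent[OF n(3) bracket_tangent[OF n(1,2)]]
    by (intro subspace_diff[OF subspace_tangent])
  have lhs: "?e (curv X Y (U a) p + curv Y (U a) X p + curv (U a) X Y p) = ?e (curv X Y (U a) p)"
    using c ct z H_tangent[OF c(1)] H_tangent[OF c(2)]
    by (simp add: add subspace_add[OF subspace_tangent])
  have tor3: "tors p v (w1 - w2 - w3) = tors p v w1 - tors p v w2 - tors p v w3"
    if "v \<in> tangent A p" "w1 \<in> tangent A p" "w2 \<in> tangent A p" "w3 \<in> tangent A p" for v w1 w2 w3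
    using lin_on_diff[OF subspace_tangent tors_lin2[OF that(1)]] that
      subspace_diff[OF subspace_tangent that(2,3)] by simp
  have e3: "?e (w1 - w2 - w3) = ?e w1 - ?e w2 - ?e w3"
    if "w1 \<in> tangent A p" "w2 \<in> tangent A p" "w3 \<in> tangent A p" for w1 w2 w3
    using sub that subspace_diff[OF subspace_tangent that(1,2)] by simp
  note Dt = D_tangent[OF n(3) t(2)] D_tangent[OF n(2) t(3)] D_tangent[OF n(1) t(3)] D_tangent[OF n(3) t(1)]
    D_tangent[OF n(2) t(1)] D_tangent[OF n(1) t(2)]
  note DV = D_V[OF t(2) sU] D_V[OF t(1) sU] and DHs = D_H[OF t(1) hY] D_H[OF t(2) hX]
  have 1: "?e (tors p ?x (bracket A Y (U a) p)) = - ?e (tors p ?x (D p ?u Y)) - ?e (tors p ?x (tors p ?y ?u))"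
    unfolding br[OF Y(1) U] using Dt t tors_tangent[OF t(2,3)] z[OF tors_HV[OF xH DV(1)]]
    by (simp add: tor3 e3 tors_tangent)
  have 2: "?e (tors p ?y (bracket A (U a) X p)) = ?e (tors p ?y (D p ?u X)) - ?e (tors p ?y (tors p ?u ?x))"
    unfolding br[OF U X(1)] using Dt t tors_tangent[OF t(3,1)] z[OF tors_HV[OF yH DV(2)]]
    by (simp add: tor3 e3 tors_tangent)
  have 3: "?e (tors p ?u (bracket A X Y p)) = - ?e (tors p ?u (tors p ?x ?y))"
    unfolding br[OF X(1) Y(1)] using Dt t tors_tangent[OF t(1,2)] z[OF tors_VH[OF DHs(1) uV]] z[OF tors_VH[OF DHs(2) uV]]
    by (simp add: tor3 e3 tors_tangent)
  have YU: "tors q (Y q) (U a q) \<in> H q" and UX: "tors q (U a q) (X q) \<in> H q" if "q \<in> W" for q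
    using tors_HV[OF Y(2)[OF that] U_V[OF a that]] tors_VH[OF X(2)[OF that] U_V[OF a that]] .
  have 4: "?e (D p ?x (\<lambda>q. tors q (Y q) (U a q))) = 0"
    by (rule z, rule D_H[OF t(1)], rule tH[OF Y(1) U], rule YU)
  have 5: "?e (D p ?y (\<lambda>q. tors q (U a q) (X q))) = 0"
    by (rule z, rule D_H[OF t(2)], rule tH[OF U X(1)], rule UX)
  have mem: "tors p ?x (bracket A Y (U a) p) \<in> tangent A p" "tors p ?y (bracket A (U a) X p) \<in> tangent A p"
    "tors p ?u (bracket A X Y p) \<in> tangent A p" "D p ?x (\<lambda>q. tors q (Y q) (U a q)) \<in> tangent A p"
    "D p ?y (\<lambda>q. tors q (U a q) (X q)) \<in> tangent A p" "D p ?u (\<lambda>q. tors q (X q) (Y q)) \<in> tangent A p"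
    using bracket_tangent n t tors_tangent D_tangent near[OF p tors_vfield] X(1) Y(1) U by auto
  have "?e (curv X Y (U a) p) =
      (?e (tors p ?x (bracket A Y (U a) p)) + ?e (D p ?x (\<lambda>q. tors q (Y q) (U a q))))
      + (?e (tors p ?y (bracket A (U a) X p)) + ?e (D p ?y (\<lambda>q. tors q (U a q) (X q))))
      + (?e (tors p ?u (bracket A X Y p)) + ?e (D p ?u (\<lambda>q. tors q (X q) (Y q))))"
    unfolding lhs[symmetric] bianchi[OF p X(1) Y(1) U]
    using mem by (simp add: add subspace_add[OF subspace_tangent])
  moreover have "?e (tors p (D p ?u X) ?y) = - ?e (tors p ?y (D p ?u X))"
    using tors_anti[of p "D p ?u X" ?y] lin_on_minus[OF \<eta>_lin[OF p b]] tors_tangent[OF t(2) Dt(3)] by simp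
  ultimately have E: "?e (curv X Y (U a) p) =
      - ?e (tors p ?x (tors p ?y ?u)) - ?e (tors p ?y (tors p ?u ?x)) - ?e (tors p ?u (tors p ?x ?y))"
    using tors_parallel[OF p b t(3) X Y] unfolding 1 2 3 4 5 by simp
  have TuH: "tors p ?u ?x \<in> H p" "tors p ?u ?y \<in> H p" using tors_VH xH yH uV by auto
  have 6: "- ?e (tors p ?x (tors p ?y ?u)) = ip p (tors p ?u ?y) (J b p ?x)"
  proof -
    have "tors p ?x (tors p ?y ?u) = - tors p ?x (tors p ?u ?y)"
      using tors_anti[of p ?y ?u] lin_on_minus[OF tors_lin2[OF t(1)] H_tangent[OF TuH(2)]] by simp
    then have "- ?e (tors p ?x (tors p ?y ?u)) = ?e (tors p ?x (tors p ?u ?y))"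
      using lin_on_minus[OF \<eta>_lin[OF p b] tors_tangent[OF t(1) H_tangent[OF TuH(2)]]] by simp
    then show ?thesis using J_value[OF p b xH] TuH(2) H.sym[of "J b p ?x" p] by simp
  qed
  have 7: "- ?e (tors p ?y (tors p ?u ?x)) = ip p (J b p (tors p ?u ?x)) ?y"
    using J_value(2)[OF p b TuH(1) yH] tors_anti[of p "tors p ?u ?x" ?y]
      lin_on_minus[OF \<eta>_lin[OF p b] tors_tangent[OF t(2) H_tangent[OF TuH(1)]]] by simp
  have 8: "- ?e (tors p ?u (tors p ?x ?y)) = (\<Sum>c\<in>{1..3}. ?e (tors p (U c p) ?u) * ip p (J c p ?x) ?y)"
  proof -
    have UT: "U c p \<in> tangent A p" if "c \<in> {1..3}" for c using V_tangent[OF U_V[OF that p]] .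
    have "tors p ?x ?y = (\<Sum>c\<in>{1..3}. \<eta> c p (tors p ?x ?y) *\<^sub>R U c p)"
      by (rule vertical_expand[OF p tors_HH[OF xH yH]])
    also have "\<dots> = (\<Sum>c\<in>{1..3}. ip p (J c p ?x) ?y *\<^sub>R U c p)"
      by (rule sum.cong) (simp_all add: J_value(2)[OF p _ xH yH])
    finally have "tors p ?u (tors p ?x ?y) = (\<Sum>c\<in>{1..3}. ip p (J c p ?x) ?y *\<^sub>R tors p ?u (U c p))"
      by (simp only:) (intro lin_on_lincomb[OF subspace_tangent tors_lin2[OF t(3)]] UT)
    then have "?e (tors p ?u (tors p ?x ?y)) = (\<Sum>c\<in>{1..3}. ip p (J c p ?x) ?y *\<^sub>R ?e (tors p ?u (U c p)))"
      by (simp only:) (intro lin_on_lincomb[OF subspace_tangent \<eta>_lin[OF p b]] tors_tangent[OF t(3)] UT)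
    also have "\<dots> = (\<Sum>c\<in>{1..3}. - (?e (tors p (U c p) ?u) * ip p (J c p ?x) ?y))"
    proof (rule sum.cong[OF refl])
      fix c assume c: "c \<in> {1..3::nat}"
      show "ip p (J c p ?x) ?y *\<^sub>R ?e (tors p ?u (U c p)) = - (?e (tors p (U c p) ?u) * ip p (J c p ?x) ?y)"
        using tors_anti[of p ?u "U c p"] lin_on_minus[OF \<eta>_lin[OF p b] tors_tangent[OF UT[OF c] t(3)]] by simp
    qed
    finally show ?thesis by (simp add: sum_negf)
  qed
  show ?thesis using E 6 7 8 by simp
qed

end


section \<open>Skew-symmetry of the vertical torsion\<close>

lemma (in qc_geometry) frame_restrict:
  assumes "qc_frame A H V ip h l D Dl W \<eta> U" "open W'" "W' \<subseteq> W"
  shows "qc_frame A H V ip h l D Dl W' \<eta> U"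
proof -
  interpret F: qc_frame A H V ip h l D Dl W \<eta> U by (rule assms(1))
  have "one_form A W' (\<eta> a)" if a: "a \<in> {1..3}" for a
  proof -
    note f = one_formD[OF coframe_one_form[OF F.coframe a]]
    show ?thesis unfolding one_form_def
    proof (intro conjI allI impI ballI)
      show "lin_on (tangent A q) (\<eta> a q)" if "q \<in> W'" for q using f(2) that assms(3) by blast
      show "smooth_fun A W'' (\<lambda>q. \<eta> a q (X q))" if "W'' \<subseteq> W'" "vfield A W'' X" for W'' X
        by (rule f(3)[OF _ that(2)]) (use that(1) assms(3) in blast)
    qed (rule assms(2))
  qed
  then have "ann_section A H W' (\<eta> a)" if "a \<in> {1..3}" for a
    using that F.\<eta>_ann assms(3) by (auto simp: ann_section_def)
  then have c: "qc_coframe A H ip h W' \<eta>"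
    using F.coframe assms(2,3) unfolding qc_coframe_def by blast
  have d: "dual_frame A V W' \<eta> U"
    unfolding dual_frame_def dsection_def
  proof (intro conjI ballI)
    fix a assume a: "a \<in> {1..3::nat}"
    show "vfield A W' (U a)" by (rule vfield_subset[OF F.U_field[OF a] assms(2,3)])
    show "U a q \<in> V q" if "q \<in> W'" for q using F.U_V[OF a] assms(3) that by auto
    fix b q assume "b \<in> {1..3::nat}" "q \<in> W'"
    then show "\<eta> a q (U b q) = (if a = b then 1 else 0)" using F.U_dual[OF a] assms(3) by auto
  qed
  show ?thesis by unfold_locales (rule c, rule d)
qed

context qc_frame
begin

text \<open>The symmetric part in \<open>a\<close> and \<open>b\<close> of the torsion expression for the curvature has to vanish.\<close>

lemma curvature_identity:
  assumes p: "p \<in> W" and a: "a \<in> {1..3}" and b: "b \<in> {1..3}" and x: "x \<in> H p" and y: "y \<in> H p"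
  shows "(\<Sum>c\<in>{1..3}. (\<eta> b p (tors p (U c p) (U a p)) + \<eta> a p (tors p (U c p) (U b p))) * ip p (J c p x) y)
    + ip p (J b p (tors p (U a p) x)) y + ip p (tors p (U a p) y) (J b p x)
    + ip p (J a p (tors p (U b p) x)) y + ip p (tors p (U b p) y) (J a p x) = 0"
proof -
  obtain X Y where X: "dsection_near A H p X" "X p = x" and Y: "dsection_near A H p Y" "Y p = y"
    using H_extends[OF x] H_extends[OF y] by blast
  obtain W1 W2 where d: "p \<in> W1" "dsection A H W1 X" "p \<in> W2" "dsection A H W2 Y"
    using X(1) Y(1) unfolding dsection_near_def by (elim exE conjE)
  then have W1: "p \<in> W1" "open W1" "vfield A W1 X" "\<And>q. q \<in> W1 \<Longrightarrow> X q \<in> H q"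
    and W2: "p \<in> W2" "open W2" "vfield A W2 Y" "\<And>q. q \<in> W2 \<Longrightarrow> Y q \<in> H q"
    unfolding dsection_def using vfield_open[of A W1 X] vfield_open[of A W2 Y] by simp_all
  define W' where "W' = W \<inter> (W1 \<inter> W2)"
  have W': "p \<in> W'" "open W'" "W' \<subseteq> W" "W' \<subseteq> W1" "W' \<subseteq> W2"
    using p W1(1,2) W2(1,2) W_open by (auto simp: W'_def)
  interpret F: qc_frame A H V ip h l D Dl W' \<eta> U
    by (rule frame_restrict[OF _ W'(2,3)]) unfold_locales
  have X': "vfield A W' X" and Y': "vfield A W' Y"
    using vfield_subset[OF W1(3) W'(2,4)] vfield_subset[OF W2(3) W'(2,5)] by auto
  have XH: "X q \<in> H q" and YH: "Y q \<in> H q" if "q \<in> W'" for q using W1(4) W2(4) W' that by auto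
  note t1 = F.curv_\<eta>_torsion[OF W'(1) a b X' XH Y' YH, unfolded X(2) Y(2)]
  note t2 = F.curv_\<eta>_torsion[OF W'(1) b a X' XH Y' YH, unfolded X(2) Y(2)]
  have "(\<Sum>c\<in>{1..3}. (\<eta> b p (tors p (U c p) (U a p)) + \<eta> a p (tors p (U c p) (U b p))) * ip p (J c p x) y) =
     (\<Sum>c\<in>{1..3}. \<eta> b p (tors p (U c p) (U a p)) * ip p (J c p x) y)
   + (\<Sum>c\<in>{1..3}. \<eta> a p (tors p (U c p) (U b p)) * ip p (J c p x) y)"
    by (simp only: distrib_right sum.distrib)
  then show ?thesis
    using F.curv_\<eta>_skew[OF W'(1) a b X' Y'] t1 t2 by simp
qed

text \<open>
  The transpose of a sum of a symmetric and a skew endomorphism is immediate, so the decomposition in the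
  definition of the Biquard connection is the one into symmetric and skew part. The \<open>J k\<close> belong to
  \<open>t_alg\<close>, and so the skew part is orthogonal to them.
\<close>

lemma torsion_parts:
  assumes p: "p \<in> W" and a: "a \<in> {1..3}"
  shows "\<exists>B P. B \<in> skew_endos (H p) (ip p) \<and> P \<in> symmetric_endos (H p) (ip p) \<and>
    (\<forall>x\<in>H p. tors p (U a p) x = B x + P x) \<and>
    (\<forall>k\<in>{1..3}. (\<Sum>e\<in>(SOME E. orthonormal_basis (H p) (ip p) E). ip p (B e) (J k p e)) = 0) \<and>
    (\<forall>x\<in>H p. sym_part (H p) (ip p) (torsion_at A D p (U a p)) x = P x \<and>
      skew_part (H p) (ip p) (torsion_at A D p (U a p)) x = B x)"
proof -
  note uV = U_V[OF a p]
  obtain B P where B: "B \<in> t_perp A H ip p" and P: "P \<in> symmetric_endos (H p) (ip p)"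
    and BP: "\<forall>x\<in>H p. torsion_at A D p (U a p) x = B x + P x"
    using biquard_parts(8)[rule_format, OF uV] by blast
  have Bs: "B \<in> skew_endos (H p) (ip p)" and Bo: "\<forall>C\<in>t_alg A H ip p. endo_inner (H p) (ip p) B C = 0"
    using B by (auto simp: t_perp_def)
  have Bm: "B x \<in> H p" and Pm: "P x \<in> H p" if "x \<in> H p" for x
    using Bs P that by (auto simp: skew_endos_def symmetric_endos_def endo_on_def)
  have Bsk: "ip p (B x) y = - ip p x (B y)" and Psy: "ip p (P x) y = ip p x (P y)" if "x \<in> H p" "y \<in> H p" for x y
    using Bs P that by (auto simp: skew_endos_def symmetric_endos_def)
  have T: "tors p (U a p) x = B x + P x" if "x \<in> H p" for x
    using BP that torsion_at_eq[OF V_tangent[OF uV] H_tangent[OF that]] by simp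
  interpret Q: quaternionic_space "H p" "ip p" "\<lambda>a. J a p" by (rule J_quaternionic[OF p])
  define E where "E = (SOME E. orthonormal_basis (H p) (ip p) E)"
  have E: "orthonormal_basis (H p) (ip p) E" unfolding E_def by (rule someI_ex[OF H.onb_exists])
  have E': "e \<in> H p" if "e \<in> E" for e using E that by (auto simp: orthonormal_basis_def span_base)
  have BJ: "(\<Sum>e\<in>E. ip p (B e) (J k p e)) = 0" if k: "k \<in> {1..3}" for k
  proof -
    have tr: "transp_on (H p) (ip p) (J k p) x = - J k p x" if x: "x \<in> H p" for x
    proof (rule H.transp_on_eq[OF _ _ x])
      show "- J k p z \<in> H p" if "z \<in> H p" for z using Q.J_mem[OF k that] H.mem(4) by blast
      show "ip p (- J k p z) y = ip p z (J k p y)" if "z \<in> H p" "y \<in> H p" for z y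
        using Q.J_skew[OF k that] H.minus_left[OF that(2) Q.J_mem[OF k that(1)]] by simp
    qed
    have "endo_inner (H p) (ip p) B (J k p) = (\<Sum>e\<in>E. ip p (transp_on (H p) (ip p) (J k p) (B e)) e)"
      by (simp add: endo_inner_def trace_on_def E_def)
    also have "\<dots> = (\<Sum>e\<in>E. ip p (B e) (J k p e))"
    proof (rule sum.cong[OF refl])
      fix e assume "e \<in> E"
      then have e: "e \<in> H p" by (rule E')
      show "ip p (transp_on (H p) (ip p) (J k p) (B e)) e = ip p (B e) (J k p e)"
        unfolding tr[OF Bm[OF e]]
        using Q.J_skew[OF k Bm[OF e] e] H.minus_left[OF e Q.J_mem[OF k Bm[OF e]]] by simp
    qed
    finally show ?thesis using Bo sp1_subset_t_alg[OF \<eta>_ann[OF k p]] by simp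
  qed
  have tr: "transp_on (H p) (ip p) (torsion_at A D p (U a p)) x = P x - B x" if x: "x \<in> H p" for x
  proof (rule H.transp_on_eq[OF _ _ x])
    show "P z - B z \<in> H p" if "z \<in> H p" for z using Bm[OF that] Pm[OF that] H.mem(3) by blast
    show "ip p (P z - B z) y = ip p z (torsion_at A D p (U a p) y)" if "z \<in> H p" "y \<in> H p" for z y
      using BP[rule_format, OF that(2)] Bsk[OF that] Psy[OF that]
        H.diff_left[OF that(2) Pm[OF that(1)] Bm[OF that(1)]]
        H.add_right[OF that(1) Bm[OF that(2)] Pm[OF that(2)]] by simp
  qed
  have half: "(1/2) *\<^sub>R (v + v) = v" for v :: "'m tvec"
    by (simp flip: scaleR_left_distrib scaleR_2)
  show ?thesis
  proof (intro exI conjI ballI)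
    show "B \<in> skew_endos (H p) (ip p)" "P \<in> symmetric_endos (H p) (ip p)" by (rule Bs) (rule P)
    show "(\<Sum>e\<in>(SOME E. orthonormal_basis (H p) (ip p) E). ip p (B e) (J k p e)) = 0" if "k \<in> {1..3}" for k
      using BJ[OF that] by (simp add: E_def)
    fix x assume x: "x \<in> H p"
    show "tors p (U a p) x = B x + P x" by (rule T[OF x])
    show "sym_part (H p) (ip p) (torsion_at A D p (U a p)) x = P x"
      unfolding sym_part_def tr[OF x] BP[rule_format, OF x] using half[of "P x"] by simp
    show "skew_part (H p) (ip p) (torsion_at A D p (U a p)) x = B x"
      unfolding skew_part_def tr[OF x] BP[rule_format, OF x] using half[of "B x"] by simp
  qed
qed

lemma vertical_torsion_skew:
  assumes p: "p \<in> W" and i: "a \<in> {1..3}" "d \<in> {1..3}" "k \<in> {1..3}"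
  shows "\<eta> d p (tors p (U k p) (U a p)) + \<eta> a p (tors p (U k p) (U d p)) = 0"
proof -
  interpret Q: quaternionic_space "H p" "ip p" "\<lambda>a. J a p" by (rule J_quaternionic[OF p])
  define E where "E = (SOME E. orthonormal_basis (H p) (ip p) E)"
  have E: "orthonormal_basis (H p) (ip p) E" unfolding E_def by (rule someI_ex[OF H.onb_exists])
  have "\<forall>a\<in>{1..3}. \<exists>BP. fst BP \<in> skew_endos (H p) (ip p) \<and> snd BP \<in> symmetric_endos (H p) (ip p) \<and>
    (\<forall>x\<in>H p. tors p (U a p) x = fst BP x + snd BP x) \<and>
    (\<forall>k\<in>{1..3}. (\<Sum>e\<in>E. ip p (fst BP e) (J k p e)) = 0)"
  proof
    fix a assume a: "a \<in> {1..3::nat}"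
    obtain B P where "B \<in> skew_endos (H p) (ip p)" "P \<in> symmetric_endos (H p) (ip p)"
      "\<forall>x\<in>H p. tors p (U a p) x = B x + P x"
      "\<forall>k\<in>{1..3}. (\<Sum>e\<in>E. ip p (B e) (J k p e)) = 0"
      using torsion_parts[OF p a, folded E_def] by (elim exE conjE)
    then show "\<exists>BP. fst BP \<in> skew_endos (H p) (ip p) \<and> snd BP \<in> symmetric_endos (H p) (ip p) \<and>
      (\<forall>x\<in>H p. tors p (U a p) x = fst BP x + snd BP x) \<and>
      (\<forall>k\<in>{1..3}. (\<Sum>e\<in>E. ip p (fst BP e) (J k p e)) = 0)"
      by (intro exI[of _ "(B, P)"]) simp
  qed
  from bchoice[OF this] obtain BP where BP: "\<forall>a\<in>{1..3}. fst (BP a) \<in> skew_endos (H p) (ip p) \<and>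
    snd (BP a) \<in> symmetric_endos (H p) (ip p) \<and>
    (\<forall>x\<in>H p. tors p (U a p) x = fst (BP a) x + snd (BP a) x) \<and>
    (\<forall>k\<in>{1..3}. (\<Sum>e\<in>E. ip p (fst (BP a) e) (J k p e)) = 0)" by (elim exE)
  have zero: "\<eta> a p (tors p (U a p) (U a p)) = 0" if a: "a \<in> {1..3}" for a
    using lin_on_zero[OF \<eta>_lin[OF p a] zeros(3)] by (simp add: tors_def)
  show ?thesis
  proof (rule Q.contraction_skew[where \<tau> = "\<lambda>c a d. \<eta> d p (tors p (U c p) (U a p))"
        and T = "\<lambda>a x. tors p (U a p) x" and B = "\<lambda>a. fst (BP a)" and P = "\<lambda>a. snd (BP a)", OF E])
    show "H p \<noteq> {0}" using H_nontrivial[of p] by auto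
  qed (use BP zero i curvature_identity[OF p] in auto)
qed


section \<open>The Levi-Civita connection\<close>

text \<open>
  Locally \<open>V\<close> consists of the vectors that annihilate certain functions, and the bracket of two fields
  annihilating a function annihilates it too.
\<close>

lemma torsion_VV:
  assumes int: "integrable_distribution A V" and p: "p \<in> W" and a: "a \<in> {1..3}" and b: "b \<in> {1..3}"
  shows "tors p (U a p) (U b p) \<in> V p"
proof -
  note n = near[OF p U_field[OF a]] near[OF p U_field[OF b]]
  note t = V_tangent[OF U_V[OF a p]] V_tangent[OF U_V[OF b p]]
  obtain W' m f where W': "open W'" "p \<in> W'" and f: "\<forall>j<m. smooth_fun A W' (f j)"
    and V: "\<forall>q\<in>W'. (\<forall>c::nat \<Rightarrow> real. \<exists>v\<in>tangent A q. \<forall>j<m. v (f j) = c j) \<and>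
           V q = {v \<in> tangent A q. \<forall>j<(m::nat). v (f j) = 0}"
    using int[unfolded integrable_distribution_def, THEN spec, of p] by (elim exE conjE)
  have "bracket A (U a) (U b) p (f j) = 0" if j: "j < m" for j
  proof -
    have fj: "smooth_near A p (f j)" using f j W' by (auto simp: smooth_near_def)
    have zero: "v (\<lambda>q. U c q (f j)) = 0" if v: "v \<in> tangent A p" and c: "c \<in> {1..3}" for v c
    proof (rule tangent_locally_const[OF sm v, of "W \<inter> W'"])
      fix q assume "q \<in> W \<inter> W'"
      then have "q \<in> W'" "U c q \<in> V q" using U_V[OF c] by auto
      then show "U c q (f j) = 0" using V j by auto
    qed (use W_open W' p in auto)
    show ?thesis using fj zero[OF t(1) b] zero[OF t(2) a] by (simp add: bracket_def)
  qed
  then have br: "bracket A (U a) (U b) p \<in> V p"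
    using V[rule_format, OF W'(2)] bracket_tangent[OF n] by simp
  have "tors p (U a p) (U b p) = D p (U a p) (U b) - D p (U b p) (U a) - bracket A (U a) (U b) p"
    using torsion_tors[OF n] by (simp add: torsion_def)
  then show ?thesis
    using br D_V[OF t(1) U_section[OF b p]] D_V[OF t(2) U_section[OF a p]]
      subspace_diff[OF V_subspace(1)] by simp
qed

lemma eqI_frame:
  assumes p: "p \<in> W" and v: "v \<in> tangent A p" "v' \<in> tangent A p"
    and eq: "\<And>z. z \<in> H p \<Longrightarrow> G p v z = G p v' z" "\<And>c. c \<in> {1..3} \<Longrightarrow> G p v (U c p) = G p v' (U c p)"
  shows "v = v'"
proof (rule G.eqI[OF v])
  fix z assume z: "z \<in> tangent A p"
  obtain x u where xu: "z = x + u" "x \<in> H p" "u \<in> V p" using splitE[OF z] .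
  have UT: "U c p \<in> tangent A p" if "c \<in> {1..3}" for c using V_tangent[OF U_V[OF that p]] .
  define r where "r c = \<eta> c p u" for c
  have u: "u = (\<Sum>c\<in>{1..3}. r c *\<^sub>R U c p)"
    unfolding r_def by (rule vertical_expand[OF p xu(3)])
  have Gu: "G p w u = (\<Sum>c\<in>{1..3}. r c *\<^sub>R G p w (U c p))" if "w \<in> tangent A p" for w
    by (subst u) (intro lin_on_lincomb[OF subspace_tangent G.lin[OF that]] UT)
  have "G p v u = G p v' u"
    unfolding Gu[OF v(1)] Gu[OF v(2)] using eq(2) by (intro sum.cong) auto
  then show "G p v z = G p v' z"
    using xu eq(1) H_tangent V_tangent G.add_right[OF v(1)] G.add_right[OF v(2)] by simp
qed

lemma G_VU: "p \<in> W \<Longrightarrow> c \<in> {1..3} \<Longrightarrow> u \<in> V p \<Longrightarrow> G p u (U c p) = l\<^sup>2 * \<eta> c p u"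
  using G_VV[OF zeros(1) _ U_V] vert_U[OF _ _ V_tangent] by simp

lemma \<eta>_frame_sum:
  assumes p: "p \<in> W" and c: "c \<in> {1..3}"
  shows "\<eta> c p (\<Sum>d\<in>{1..3}. r d *\<^sub>R U d p) = r c"
proof -
  have "\<eta> c p (\<Sum>d\<in>{1..3}. r d *\<^sub>R U d p) = (\<Sum>d\<in>{1..3}. r d *\<^sub>R \<eta> c p (U d p))"
    using V_tangent[OF U_V[OF _ p]] by (intro lin_on_lincomb[OF subspace_tangent \<eta>_lin[OF p c]]) auto
  also have "\<dots> = (\<Sum>d\<in>{1..3}. if c = d then r d else 0)"
    using U_dual[OF c _ p] by (intro sum.cong) auto
  finally show ?thesis using c by (simp add: sum.delta')
qed

lemma frame_sum_V: "p \<in> W \<Longrightarrow> (\<Sum>d\<in>{1..3}. r d *\<^sub>R U d p) \<in> V p"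
  using U_V by (intro subspace_sum subspace_scale V_subspace) auto

abbreviation TS :: "nat \<Rightarrow> 'm \<Rightarrow> 'm endo" where
  "TS a p \<equiv> sym_part (H p) (ip p) (torsion_at A D p (U a p))"

abbreviation TO :: "nat \<Rightarrow> 'm \<Rightarrow> 'm endo" where
  "TO a p \<equiv> skew_part (H p) (ip p) (torsion_at A D p (U a p))"

lemma T_parts:
  assumes p: "p \<in> W" and a: "a \<in> {1..3}" and x: "x \<in> H p"
  shows "TS a p x \<in> H p" "TO a p x \<in> H p" "tors p (U a p) x = TO a p x + TS a p x"
    "y \<in> H p \<Longrightarrow> ip p (TS a p x) y = ip p (TS a p y) x"
    "y \<in> H p \<Longrightarrow> ip p (TO a p x) y = - ip p (TO a p y) x"
proof -
  obtain B P where B: "B \<in> skew_endos (H p) (ip p)" and P: "P \<in> symmetric_endos (H p) (ip p)"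
    and T: "\<forall>x\<in>H p. tors p (U a p) x = B x + P x"
    and SO: "\<forall>x\<in>H p. TS a p x = P x \<and> TO a p x = B x"
    using torsion_parts[OF p a] by (elim exE conjE)
  have S: "TS a p x = P x" and O: "TO a p x = B x" if "x \<in> H p" for x
    using SO that by auto
  have m: "B z \<in> H p" "P z \<in> H p" if "z \<in> H p" for z
    using B P that by (auto simp: skew_endos_def symmetric_endos_def endo_on_def)
  show "TS a p x \<in> H p" "TO a p x \<in> H p" "tors p (U a p) x = TO a p x + TS a p x"
    using m[OF x] T[rule_format, OF x] S[OF x] O[OF x] by auto
  assume y: "y \<in> H p"
  show "ip p (TS a p x) y = ip p (TS a p y) x"
    using P x y S H.sym[OF x m(2)[OF y]] by (auto simp: symmetric_endos_def)
  show "ip p (TO a p x) y = - ip p (TO a p y) x"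
    using B x y O H.sym[OF x m(1)[OF y]] by (auto simp: skew_endos_def)
qed

text \<open>
  Now the Koszul formula is evaluated on \<open>H\<close> and on the frame \<open>U\<close>, for each type of arguments. Torsion
  maps two vectors of the same type into \<open>V\<close> and two of different type into \<open>H\<close>; so for given types at most one
  orthogonal component of the result is different from zero.
\<close>

lemma diff_HH:
  assumes p: "p \<in> W" and x: "x \<in> H p" and y: "y \<in> H p"
  shows "difference p x y = - ((1/2) *\<^sub>R (\<Sum>c\<in>{1..3}. ip p (J c p x) y *\<^sub>R U c p)
    + (1 / l\<^sup>2) *\<^sub>R (\<Sum>c\<in>{1..3}. ip p (TS c p x) y *\<^sub>R U c p))"
proof -
  let ?r = "\<lambda>c. - (1/2 * ip p (J c p x) y + 1 / l\<^sup>2 * ip p (TS c p x) y)"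
  note t = H_tangent[OF x] H_tangent[OF y]
  have "difference p x y = (\<Sum>c\<in>{1..3}. ?r c *\<^sub>R U c p)"
  proof (rule eqI_frame[OF p diff_tangent[OF t] V_tangent[OF frame_sum_V[OF p]]])
    fix z assume z: "z \<in> H p"
    have "2 * G p (difference p x y) z = 0"
      using koszul[OF t H_tangent[OF z]] G_VH tors_HH x y z by simp
    then show "G p (difference p x y) z = G p (\<Sum>c\<in>{1..3}. ?r c *\<^sub>R U c p) z"
      using G_VH[OF z frame_sum_V[OF p, of ?r]] by simp
  next
    fix c assume c: "c \<in> {1..3::nat}"
    note u = U_V[OF c p]
    have T: "tors p (U c p) z \<in> H p" "tors p z (U c p) = - tors p (U c p) z" if "z \<in> H p" for z
      by (rule tors_VH[OF that u]) (rule tors_anti)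
    have g: "G p (tors p (U c p) z) w = ip p (TO c p z) w + ip p (TS c p z) w"
      "G p (tors p z (U c p)) w = - (ip p (TO c p z) w + ip p (TS c p z) w)" if "z \<in> H p" "w \<in> H p" for z w
    proof -
      show 1: "G p (tors p (U c p) z) w = ip p (TO c p z) w + ip p (TS c p z) w"
        using G_HH[OF T(1)[OF that(1)] zeros(2) that(2)] T_parts(1-3)[OF p c that(1)] H.add_left[OF that(2)] by simp
      show "G p (tors p z (U c p)) w = - (ip p (TO c p z) w + ip p (TS c p z) w)"
        unfolding T(2)[OF that(1)] using 1 G.minus_left[OF H_tangent[OF that(2)] H_tangent[OF T(1)[OF that(1)]]] by simp
    qed
    have 1: "2 * G p (difference p x y) (U c p) = - (l\<^sup>2 * ip p (J c p x) y) - 2 * ip p (TS c p x) y"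
      using koszul[OF t V_tangent[OF u]] G_VU[OF p c tors_HH[OF x y]] J_value(2)[OF p c x y]
        g(1)[OF x y] g(2)[OF y x] T_parts(4,5)[OF p c y x] by simp
    have 2: "G p (\<Sum>c\<in>{1..3}. ?r c *\<^sub>R U c p) (U c p) = l\<^sup>2 * ?r c"
      unfolding G_VU[OF p c frame_sum_V[OF p]] \<eta>_frame_sum[OF p c] ..
    have "l\<^sup>2 * ?r c = - (l\<^sup>2 * ip p (J c p x) y) / 2 - ip p (TS c p x) y"
      using l by (simp add: algebra_simps)
    then show "G p (difference p x y) (U c p) = G p (\<Sum>c\<in>{1..3}. ?r c *\<^sub>R U c p) (U c p)"
      using 1 unfolding 2 by simp
  qed
  then show ?thesis
    by (simp add: scaleR_sum_right scaleR_left_distrib sum.distrib sum_negf scaleR_diff_left sum_subtractf)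
qed

lemma diff_VH:
  assumes int: "integrable_distribution A V" and p: "p \<in> W" and a: "a \<in> {1..3}" and x: "x \<in> H p"
  shows "difference p (U a p) x = (l\<^sup>2 / 2) *\<^sub>R J a p x - TO a p x"
proof -
  note u = U_V[OF a p]
  note t = V_tangent[OF u] H_tangent[OF x]
  note J = J_value(1)[OF p a x] and O = T_parts(2)[OF p a x]
  have R: "(l\<^sup>2 / 2) *\<^sub>R J a p x - TO a p x \<in> H p" by (intro H.mem(3,5) J O)
  show ?thesis
  proof (rule eqI_frame[OF p diff_tangent[OF t] H_tangent[OF R]])
    fix z assume z: "z \<in> H p"
    have g: "G p (tors p (U a p) z) w = ip p (TO a p z) w + ip p (TS a p z) w" if "z \<in> H p" "w \<in> H p" for z w
      using G_HH[OF tors_VH[OF that(1) u] zeros(2) that(2)] T_parts(1-3)[OF p a that(1)] H.add_left[OF that(2)] by simp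
    have "G p (tors p z (U a p)) x = - G p (tors p (U a p) z) x"
      using tors_anti[of p z] G.minus_left[OF t(2) tors_tangent[OF t(1) H_tangent[OF z]]] by simp
    then have "2 * G p (difference p (U a p) x) z = l\<^sup>2 * ip p (J a p x) z - 2 * ip p (TO a p x) z"
      using koszul[OF t H_tangent[OF z]] g[OF x z] g[OF z x] G_VU[OF p a tors_HH[OF x z]]
        J_value(2)[OF p a x z] T_parts(4,5)[OF p a x z] by simp
    then show "G p (difference p (U a p) x) z = G p ((l\<^sup>2 / 2) *\<^sub>R J a p x - TO a p x) z"
      using G_HH[OF R zeros(2) z] H.diff_left[OF z H.mem(5)[OF J] O] H.scale_left[OF z J] by simp
  next
    fix c assume c: "c \<in> {1..3::nat}"
    note w = U_V[OF c p]
    have "2 * G p (difference p (U a p) x) (U c p) = 0"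
      using koszul[OF t V_tangent[OF w]] G_HV[OF tors_VH[OF x u] w] G_HV[OF tors_HV[OF x w] u]
        G_VH[OF x torsion_VV[OF int p c a]] by simp
    then show "G p (difference p (U a p) x) (U c p) = G p ((l\<^sup>2 / 2) *\<^sub>R J a p x - TO a p x) (U c p)"
      using G_HV[OF R w] by simp
  qed
qed

lemma diff_HV:
  assumes int: "integrable_distribution A V" and p: "p \<in> W" and a: "a \<in> {1..3}" and x: "x \<in> H p"
  shows "difference p x (U a p) = (l\<^sup>2 / 2) *\<^sub>R J a p x + TS a p x"
proof -
  have "difference p x (U a p) = difference p (U a p) x + tors p (U a p) x" by (simp add: tors_def)
  then show ?thesis using diff_VH[OF assms] T_parts(3)[OF p a x] by simp
qed

text \<open>Here the Koszul formula gives three torsion terms, and total skew-symmetry makes two of them cancel.\<close>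

lemma diff_VV:
  assumes int: "integrable_distribution A V" and p: "p \<in> W" and a: "a \<in> {1..3}" and b: "b \<in> {1..3}"
  shows "difference p (U a p) (U b p) = - ((1/2) *\<^sub>R (\<Sum>c\<in>{1..3}. \<eta> c p (tors p (U a p) (U b p)) *\<^sub>R U c p))"
proof -
  let ?r = "\<lambda>c. - (1/2 * \<eta> c p (tors p (U a p) (U b p)))"
  note u = U_V[OF a p] U_V[OF b p]
  note t = V_tangent[OF u(1)] V_tangent[OF u(2)]
  have "difference p (U a p) (U b p) = (\<Sum>c\<in>{1..3}. ?r c *\<^sub>R U c p)"
  proof (rule eqI_frame[OF p diff_tangent[OF t] V_tangent[OF frame_sum_V[OF p]]])
    fix z assume z: "z \<in> H p"
    have "2 * G p (difference p (U a p) (U b p)) z = 0"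
      using koszul[OF t H_tangent[OF z]] G_VH[OF z torsion_VV[OF int p a b]]
        G_HV[OF tors_VH[OF z u(2)] u(1)] G_HV[OF tors_HV[OF z u(1)] u(2)] by simp
    then show "G p (difference p (U a p) (U b p)) z = G p (\<Sum>c\<in>{1..3}. ?r c *\<^sub>R U c p) z"
      using G_VH[OF z frame_sum_V[OF p, of ?r]] by simp
  next
    fix c assume c: "c \<in> {1..3::nat}"
    have "\<eta> a p (tors p (U b p) (U c p)) = - \<eta> a p (tors p (U c p) (U b p))"
      using tors_anti[of p "U b p"] lin_on_minus[OF \<eta>_lin[OF p a] tors_tangent[OF V_tangent[OF U_V[OF c p]] t(2)]] by simp
    then have sk: "\<eta> a p (tors p (U b p) (U c p)) = \<eta> b p (tors p (U c p) (U a p))"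
      using vertical_torsion_skew[OF p a b c] by simp
    have "2 * G p (difference p (U a p) (U b p)) (U c p) = - (l\<^sup>2 * \<eta> c p (tors p (U a p) (U b p)))"
      using koszul[OF t V_tangent[OF U_V[OF c p]]] sk G_VU[OF p c torsion_VV[OF int p a b]]
        G_VU[OF p a torsion_VV[OF int p b c]] G_VU[OF p b torsion_VV[OF int p c a]] by simp
    moreover have "G p (\<Sum>c\<in>{1..3}. ?r c *\<^sub>R U c p) (U c p) = l\<^sup>2 * ?r c"
      unfolding G_VU[OF p c frame_sum_V[OF p]] \<eta>_frame_sum[OF p c] ..
    ultimately show "G p (difference p (U a p) (U b p)) (U c p) = G p (\<Sum>c\<in>{1..3}. ?r c *\<^sub>R U c p) (U c p)" by simp
  qed
  then show ?thesis by (simp add: scaleR_sum_right sum_negf)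
qed

end

theorem lemma3p1:
  fixes A :: "('m::{second_countable_topology,t2_space}, 'e::euclidean_space) atlas"
    and H V :: "'m \<Rightarrow> 'm tvec set" and ip :: "'m metric" and h :: nat and l :: real
    and D Dl :: "'m conn" and W :: "'m set"
    and \<eta> :: "nat \<Rightarrow> 'm \<Rightarrow> 'm covec" and U :: "nat \<Rightarrow> 'm vf" and X Y :: "'m vf" and a b :: nat
    and J T :: "nat \<Rightarrow> 'm \<Rightarrow> 'm endo" and \<tau> :: "nat \<Rightarrow> nat \<Rightarrow> nat \<Rightarrow> 'm \<Rightarrow> real"
  assumes "integrable_qc A H ip h"
    and "biquard A H ip h V D"
    and "integrable_distribution A V"
    and "l > 0"
    and "levi_civita A (qc_metric_scaled A H ip h V l) Dl"
    and "qc_coframe A H ip h W \<eta>"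
    and "dual_frame A V W \<eta> U"
    and "J = (\<lambda>a p. Jop A H ip p (\<eta> a p))"
    and "T = (\<lambda>a p x. torsion_at A D p (U a p) x)"
    and "\<tau> = (\<lambda>a b c p. \<eta> c p (torsion_at A D p (U a p) (U b p)))"
    and "dsection A H W X" and "dsection A H W Y"
    and "a \<in> {1..3}" and "b \<in> {1..3}"
    and "p \<in> W"
  shows "Dl p (X p) Y = D p (X p) Y
           - (1/2) *\<^sub>R (\<Sum>c\<in>{1..3}. ip p (J c p (X p)) (Y p) *\<^sub>R U c p)
           - (1 / l\<^sup>2) *\<^sub>R
               (\<Sum>c\<in>{1..3}. ip p (sym_part (H p) (ip p) (T c p) (X p)) (Y p) *\<^sub>R U c p) \<and>
         Dl p (U a p) X = D p (U a p) X + (l\<^sup>2 / 2) *\<^sub>R J a p (X p)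
           - skew_part (H p) (ip p) (T a p) (X p) \<and>
         Dl p (X p) (U a) = D p (X p) (U a) + (l\<^sup>2 / 2) *\<^sub>R J a p (X p)
           + sym_part (H p) (ip p) (T a p) (X p) \<and>
         Dl p (U a p) (U b) = D p (U a p) (U b) - (1/2) *\<^sub>R (\<Sum>c\<in>{1..3}. \<tau> a b c p *\<^sub>R U c p)"
proof -
  interpret F: qc_frame A H V ip h l D Dl W \<eta> U
    using assms(1-7) by unfold_locales (auto simp: integrable_qc_def)
  note a = assms(13) and b = assms(14) and p = assms(15) and int = assms(3)
  have X: "vfield A W X" "X p \<in> H p" and Y: "vfield A W Y" "Y p \<in> H p"
    using assms(11,12) p by (auto simp: dsection_def)
  note n = F.near[OF p X(1)] F.near[OF p Y(1)] F.near[OF p F.U_field[OF a]] F.near[OF p F.U_field[OF b]]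
  note t = F.H_tangent[OF X(2)] F.V_tangent[OF F.U_V[OF a p]] F.V_tangent[OF F.U_V[OF b p]]
  have shift: "Dl p v Z = D p v Z + F.difference p v (Z p)" if "v \<in> tangent A p" "vfield_near A p Z" for v Z
    using F.diff_eq[OF that] by simp
  have \<tau>: "\<tau> a b c p = \<eta> c p (F.tors p (U a p) (U b p))" for c
    using F.torsion_at_eq[OF t(2,3)] assms(10) by simp
  show ?thesis
    unfolding shift[OF t(1) n(2)] shift[OF t(2) n(1)] shift[OF t(1) n(3)] shift[OF t(2) n(4)]
      F.diff_HH[OF p X(2) Y(2)] F.diff_VH[OF int p a X(2)] F.diff_HV[OF int p a X(2)]
      F.diff_VV[OF int p a b] \<tau> assms(8,9)
    by simp
qed

end
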